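(* Assume that the deterministic coefficients $f,\sigma,g,h$ satisfy (A1) and (A2) of the context, and fix $t\in[0,T]$, $x\in\mathbb{R}^n$. Let $(X^{\varepsilon,t,x},Y^{\varepsilon,t,x},Z^{\varepsilon,t,x})$, $\varepsilon\in(0,1]$, be the solution of the FBSDE of the context and $(\mathcal{X}^{t,x},\mathcal{Y}^{t,x})$ the solution of the deterministic limit system of the context. Then: (i) For all $\delta>0$, $$\lim_{\varepsilon\to 0}P\Big\{\sup_{t\le s\le T}\big|X^{\varepsilon,t,x}(s)-\mathcal{X}^{t,x}(s)\big|>\delta\Big\}=0 .$$ (ii) Let $Q^{\varepsilon}=P\circ (Y^{\varepsilon,t,x}(\cdot))^{-1}$ be the law of $Y^{\varepsilon,t,x}$ on $D(\mathbb{R}^n)$. Then there exist a sequence $\varepsilon_k\to 0$ and a probability law $Q$ on $D(\mathbb{R}^n)$ such that $Q^{\varepsilon_k}$ converges weakly to $Q$ as $k\to+\infty$, where $D(\mathbb{R}^n)$ carries the Meyer-Zheng topology.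
   Context: Setting. $T>0$; $W$ is a $d$-dimensional Brownian motion on the classical Wiener space $(\Omega,\mathcal{F},P)$ over $[0,T]$, with its $P$-augmented natural filtration. The coefficients are deterministic functions $f:[0,T]\times\mathbb{R}^n\times\mathbb{R}^n\to\mathbb{R}^n$, $\sigma:[0,T]\times\mathbb{R}^n\times\mathbb{R}^n\to\mathbb{R}^{n\times d}$, $g:[0,T]\times\mathbb{R}^n\times\mathbb{R}^n\times\mathbb{R}^{n\times d}\to\mathbb{R}^n$, $h:\mathbb{R}^n\to\mathbb{R}^n$. Euclidean (Frobenius for matrices) inner products and norms are used. FBSDE. For $\varepsilon\in(0,1]$, $t\in[0,T]$, $x\in\mathbb{R}^n$, consider for $t\le s\le T$ $$X^{\varepsilon,t,x}(s)=x+\int_t^s f(r,X^{\varepsilon,t,x}(r),Y^{\varepsilon,t,x}(r))\,dr+\sqrt{\varepsilon}\int_t^s\sigma(r,X^{\varepsilon,t,x}(r),Y^{\varepsilon,t,x}(r))\,dW(r),$$ $$Y^{\varepsilon,t,x}(s)=h(X^{\varepsilon,t,x}(T))+\int_s^T g(r,X^{\varepsilon,t,x}(r),Y^{\varepsilon,t,x}(r),Z^{\varepsilon,t,x}(r))\,dr-\int_s^T Z^{\varepsilon,t,x}(r)\,dW(r).$$ A solution is a triple of adapted processes in $\mathcal{N}_t=\mathcal{S}^2(t,T;\mathbb{R}^n)\times\mathcal{S}^2(t,T;\mathbb{R}^n)\times\mathcal{M}^2(t,T;\mathbb{R}^{n\times d})$ satisfying these equations $P$-a.s.; here $\mathcal{S}^2$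 is the space of adapted $v$ with $E[\sup_{t\le s\le T}|v(s)|^2]<\infty$ and $\mathcal{M}^2$ that of adapted $v$ with $E[\int_t^T|v(s)|^2ds]<\infty$. Under (A1) and (A2) it is known that the solution exists and is unique. (A1) $f,\sigma,g$ are continuous in $t$, and there is $C_1>0$ such that for all arguments and a.e. $t$: $|g(t,x^1,y^1,z^1)-g(t,x^2,y^2,z^2)|\le C_1(|x^1-x^2|+|y^1-y^2|+|z^1-z^2|)$; $|f(t,x^1,y^1)-f(t,x^2,y^2)|\le C_1(|x^1-x^2|+|y^1-y^2|)$; $|\sigma(t,x^1,y^1)-\sigma(t,x^2,y^2)|\le C_1(|x^1-x^2|+|y^1-y^2|)$; $|h(x^1)-h(x^2)|\le C_1|x^1-x^2|$. (A2) There is $C_2>0$ such that for every $\varepsilon\in(0,1]$, all $u^i=(x^i,y^i,z^i)\in\mathbb{R}^n\times\mathbb{R}^n\times\mathbb{R}^{n\times d}$ ($i=1,2$) and a.e. $t$, $$\langle A^\varepsilon(t,u^1)-A^\varepsilon(t,u^2),u^1-u^2\rangle\le-(C_2+\sqrt{\varepsilon})\big(|x^1-x^2|^2+|y^1-y^2|^2\big),$$ where $A^\varepsilon(t,u)=(-g(t,x,y,z),\,f(t,x,y),\,\sqrt{\varepsilon}\,\sigma(t,x,y))$ for $u=(x,y,z)$; and $\langle h(x^1)-h(x^2),x^1-x^2\rangle\ge C_2|x^1-x^2|^2$ for all $x^1,x^2\in\mathbb{R}^n$. Deterministic limit system. $(\mathcal{X}^{t,x},\mathcal{Y}^{t,x})$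 is the unique solution on $[t,T]$ of $$\mathcal{X}^{t,x}(s)=x+\int_t^s f(r,\mathcal{X}^{t,x}(r),\mathcal{Y}^{t,x}(r))\,dr,\qquad \mathcal{Y}^{t,x}(s)=h(\mathcal{X}^{t,x}(T))+\int_s^T g(r,\mathcal{X}^{t,x}(r),\mathcal{Y}^{t,x}(r),0)\,dr .$$ Meyer-Zheng topology. $D(\mathbb{R}^n)$ is the space of right-continuous functions $w:[0,T]\to\mathbb{R}^n$ with left limits such that $w(T-)=w(T)$. The Meyer-Zheng (pseudo-path) topology on $D(\mathbb{R}^n)$ is the topology induced by the metric $\rho(w,w')=\int_0^T(|w(s)-w'(s)|\wedge 1)\,ds$, i.e. convergence in Lebesgue measure. Its Borel $\sigma$-algebra coincides with the one generated by the coordinate maps. The process $Y^{\varepsilon,t,x}$ is regarded as a $D(\mathbb{R}^n)$-valued random variable by setting $Y^{\varepsilon,t,x}(s)=Y^{\varepsilon,t,x}(t)$ for $0\le s\le t$. *)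

theory Defs
  imports "HOL-Probability.Probability"
begin

section \<open>Classical Wiener space and its augmented filtration\<close>

definition wiener_paths :: "real \<Rightarrow> (real \<Rightarrow> real ^ 'd) set" where
  "wiener_paths T = {\<omega> \<in> extensional {0..T}. continuous_on {0..T} \<omega> \<and> \<omega> 0 = 0}"

text \<open>The coordinate \<sigma>-algebra is also the Borel \<sigma>-algebra of the uniform topology on
  \<^const>\<open>wiener_paths\<close>.\<close>

definition coordinate_sigma :: "real \<Rightarrow> (real \<Rightarrow> real ^ 'd) measure" where
  "coordinate_sigma T = restrict_space (PiM {0..T} (\<lambda>_. borel)) (wiener_paths T)"

definition natural_filtration ::
  "'w measure \<Rightarrow> (real \<Rightarrow> 'w \<Rightarrow> 'b::topological_space) \<Rightarrow> real \<Rightarrow> 'w measure" where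
  "natural_filtration M W s =
     sigma (space M) (\<Union>u\<in>{0..s}. sets (vimage_algebra (space M) (W u) borel))"

definition augmented_filtration ::
  "'w measure \<Rightarrow> (real \<Rightarrow> 'w \<Rightarrow> 'b::topological_space) \<Rightarrow> real \<Rightarrow> 'w measure" where
  "augmented_filtration M W s =
     sigma (space M) (sets (natural_filtration M W s) \<union> null_sets M)"

definition coordinate_process :: "real \<Rightarrow> (real \<Rightarrow> real ^ 'd) \<Rightarrow> real ^ 'd" where
  "coordinate_process s \<omega> = \<omega> s"

text \<open>Wiener measure is the law on path space under which the coordinate process is a Brownian
  motion: increments over \<open>[s, r]\<close> are independent of the past up to \<open>s\<close> and have the centred
  Gaussian law with covariance matrix \<open>(r - s) I\<close>.\<close>

definition wiener_measure :: "real \<Rightarrow> (real \<Rightarrow> real ^ 'd) measure \<Rightarrow> bool" where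
  "wiener_measure T P \<longleftrightarrow>
     prob_space P \<and> space P = wiener_paths T \<and> sets P = sets (coordinate_sigma T) \<and>
     (\<forall>s r. 0 \<le> s \<and> s < r \<and> r \<le> T \<longrightarrow>
        distributed P lborel (\<lambda>\<omega>. coordinate_process r \<omega> - coordinate_process s \<omega>)
          (\<lambda>x. ennreal (\<Prod>i\<in>UNIV. normal_density 0 (sqrt (r - s)) (x $ i))) \<and>
        prob_space.indep_set P
          (sets (natural_filtration P coordinate_process s))
          (sets (vimage_algebra (space P)
             (\<lambda>\<omega>. coordinate_process r \<omega> - coordinate_process s \<omega>) borel)))"

definition classical_wiener_space :: "real \<Rightarrow> (real \<Rightarrow> real ^ 'd) measure \<Rightarrow> bool" where
  "classical_wiener_space T M \<longleftrightarrow> (\<exists>P. wiener_measure T P \<and> M = completion P)"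


section \<open>Process spaces on \<open>[t, T]\<close>\<close>

text \<open>``Adapted'' includes joint measurability, which is needed for
  \<open>E[\<integral> |v(s)|\<^sup>2 ds]\<close> to make sense.\<close>

definition adapted_processes ::
  "'w measure \<Rightarrow> (real \<Rightarrow> 'w measure) \<Rightarrow> real \<Rightarrow> real \<Rightarrow> (real \<Rightarrow> 'w \<Rightarrow> 'a::topological_space) set" where
  "adapted_processes M F t T = {v.
     (\<lambda>(s, \<omega>). v s \<omega>) \<in> borel_measurable (restrict_space borel {t..T} \<Otimes>\<^sub>M M) \<and>
     (\<forall>s\<in>{t..T}. v s \<in> borel_measurable (F s))}"

definition S2 ::
  "'w measure \<Rightarrow> (real \<Rightarrow> 'w measure) \<Rightarrow> real \<Rightarrow> real \<Rightarrow> (real \<Rightarrow> 'w \<Rightarrow> 'a::real_normed_vector) set" where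
  "S2 M F t T = {v \<in> adapted_processes M F t T.
     (\<integral>\<^sup>+\<omega>. (SUP s\<in>{t..T}. ennreal ((norm (v s \<omega>))\<^sup>2)) \<partial>M) < \<infinity>}"

definition M2 ::
  "'w measure \<Rightarrow> (real \<Rightarrow> 'w measure) \<Rightarrow> real \<Rightarrow> real \<Rightarrow> (real \<Rightarrow> 'w \<Rightarrow> 'a::real_normed_vector) set" where
  "M2 M F t T = {v \<in> adapted_processes M F t T.
     (\<integral>\<^sup>+\<omega>. (\<integral>\<^sup>+s\<in>{t..T}. ennreal ((norm (v s \<omega>))\<^sup>2) \<partial>lborel) \<partial>M) < \<infinity>}"


section \<open>The Ito integral\<close>

text \<open>A simple process is
  \<open>\<Sum>i<k. \<xi>\<^sub>i 1\<^bsub>(\<tau>\<^sub>i, \<tau>\<^sub>i\<^sub>+\<^sub>1]\<^esub>\<close> for a partition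
  \<open>t = \<tau>\<^sub>0 \<le> \<dots> \<le> \<tau>\<^sub>k = T\<close> and bounded \<open>\<xi>\<^sub>i\<close> measurable with respect to the
  information at time \<open>\<tau>\<^sub>i\<close>. Matrices carry the Frobenius norm, which is the library norm of
  \<^typ>\<open>real ^ 'd ^ 'n\<close>.\<close>

definition simple_process ::
  "'w measure \<Rightarrow> (real \<Rightarrow> 'w measure) \<Rightarrow> real \<Rightarrow> real \<Rightarrow>
   nat \<Rightarrow> (nat \<Rightarrow> real) \<Rightarrow> (nat \<Rightarrow> 'w \<Rightarrow> real ^ 'd ^ 'n) \<Rightarrow> bool" where
  "simple_process M F t T k \<tau> \<xi> \<longleftrightarrow>
     \<tau> 0 = t \<and> \<tau> k = T \<and>
     (\<forall>i<k. \<tau> i \<le> \<tau> (Suc i) \<and> \<xi> i \<in> borel_measurable (F (\<tau> i)) \<and> bounded (\<xi> i ` space M))"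

definition simple_value ::
  "nat \<Rightarrow> (nat \<Rightarrow> real) \<Rightarrow> (nat \<Rightarrow> 'w \<Rightarrow> real ^ 'd ^ 'n) \<Rightarrow> real \<Rightarrow> 'w \<Rightarrow> real ^ 'd ^ 'n" where
  "simple_value k \<tau> \<xi> s \<omega> = (\<Sum>i<k. indicator {\<tau> i<..\<tau> (Suc i)} s *\<^sub>R \<xi> i \<omega>)"

definition simple_integral ::
  "(real \<Rightarrow> 'w \<Rightarrow> real ^ 'd) \<Rightarrow> nat \<Rightarrow> (nat \<Rightarrow> real) \<Rightarrow> (nat \<Rightarrow> 'w \<Rightarrow> real ^ 'd ^ 'n) \<Rightarrow>
   real \<Rightarrow> 'w \<Rightarrow> real ^ 'n" where
  "simple_integral W k \<tau> \<xi> s \<omega> =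
     (\<Sum>i<k. \<xi> i \<omega> *v (W (min s (\<tau> (Suc i))) \<omega> - W (min s (\<tau> i)) \<omega>))"

text \<open>\<open>I(s) = \<integral>\<^sub>t\<^sup>s H dW\<close> for \<open>s \<in> [t, T]\<close>: the a.s. continuous version of the \<open>L\<^sup>2\<close>-limit of
  the integrals of simple processes approximating \<open>H\<close> in \<open>L\<^sup>2(dt \<otimes> P)\<close>. This determines \<open>I\<close> up to
  indistinguishability.\<close>

definition has_ito_integral ::
  "'w measure \<Rightarrow> (real \<Rightarrow> 'w measure) \<Rightarrow> (real \<Rightarrow> 'w \<Rightarrow> real ^ 'd) \<Rightarrow> real \<Rightarrow> real \<Rightarrow>
   (real \<Rightarrow> 'w \<Rightarrow> real ^ 'd ^ 'n) \<Rightarrow> (real \<Rightarrow> 'w \<Rightarrow> real ^ 'n) \<Rightarrow> bool" where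
  "has_ito_integral M F W t T H I \<longleftrightarrow>
     H \<in> M2 M F t T \<and>
     (\<forall>s\<in>{t..T}. I s \<in> borel_measurable (F s)) \<and>
     (AE \<omega> in M. continuous_on {t..T} (\<lambda>s. I s \<omega>)) \<and>
     (\<exists>k \<tau> \<xi>.
        (\<forall>m. simple_process M F t T (k m) (\<tau> m) (\<xi> m)) \<and>
        (\<lambda>m. \<integral>\<^sup>+\<omega>. (\<integral>\<^sup>+s\<in>{t..T}.
            ennreal ((norm (H s \<omega> - simple_value (k m) (\<tau> m) (\<xi> m) s \<omega>))\<^sup>2) \<partial>lborel) \<partial>M)
          \<longlonglongrightarrow> 0 \<and>
        (\<forall>s\<in>{t..T}.
          (\<lambda>m. \<integral>\<^sup>+\<omega>.
            ennreal ((norm (I s \<omega> - simple_integral W (k m) (\<tau> m) (\<xi> m) s \<omega>))\<^sup>2) \<partial>M)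
          \<longlonglongrightarrow> 0))"


section \<open>Assumptions on the coefficients\<close>

definition assumption_A1 ::
  "real \<Rightarrow> (real \<Rightarrow> real ^ 'n \<Rightarrow> real ^ 'n \<Rightarrow> real ^ 'n) \<Rightarrow>
   (real \<Rightarrow> real ^ 'n \<Rightarrow> real ^ 'n \<Rightarrow> real ^ 'd ^ 'n) \<Rightarrow>
   (real \<Rightarrow> real ^ 'n \<Rightarrow> real ^ 'n \<Rightarrow> real ^ 'd ^ 'n \<Rightarrow> real ^ 'n) \<Rightarrow>
   (real ^ 'n \<Rightarrow> real ^ 'n) \<Rightarrow> bool" where
  "assumption_A1 T f \<sigma> g h \<longleftrightarrow>
     (\<forall>x y. continuous_on {0..T} (\<lambda>r. f r x y)) \<and>
     (\<forall>x y. continuous_on {0..T} (\<lambda>r. \<sigma> r x y)) \<and>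
     (\<forall>x y z. continuous_on {0..T} (\<lambda>r. g r x y z)) \<and>
     (\<exists>C1>0.
        (\<forall>x1 x2 y1 y2 z1 z2. AE r\<in>{0..T} in lborel.
           norm (g r x1 y1 z1 - g r x2 y2 z2)
             \<le> C1 * (norm (x1 - x2) + norm (y1 - y2) + norm (z1 - z2))) \<and>
        (\<forall>x1 x2 y1 y2. AE r\<in>{0..T} in lborel.
           norm (f r x1 y1 - f r x2 y2) \<le> C1 * (norm (x1 - x2) + norm (y1 - y2))) \<and>
        (\<forall>x1 x2 y1 y2. AE r\<in>{0..T} in lborel.
           norm (\<sigma> r x1 y1 - \<sigma> r x2 y2) \<le> C1 * (norm (x1 - x2) + norm (y1 - y2))) \<and>
        (\<forall>x1 x2. norm (h x1 - h x2) \<le> C1 * norm (x1 - x2)))"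

fun A_op ::
  "(real \<Rightarrow> real ^ 'n \<Rightarrow> real ^ 'n \<Rightarrow> real ^ 'n) \<Rightarrow>
   (real \<Rightarrow> real ^ 'n \<Rightarrow> real ^ 'n \<Rightarrow> real ^ 'd ^ 'n) \<Rightarrow>
   (real \<Rightarrow> real ^ 'n \<Rightarrow> real ^ 'n \<Rightarrow> real ^ 'd ^ 'n \<Rightarrow> real ^ 'n) \<Rightarrow>
   real \<Rightarrow> real \<Rightarrow> (real ^ 'n) \<times> (real ^ 'n) \<times> (real ^ 'd ^ 'n) \<Rightarrow>
   (real ^ 'n) \<times> (real ^ 'n) \<times> (real ^ 'd ^ 'n)" where
  "A_op f \<sigma> g \<epsilon> r (x, y, z) = (- g r x y z, f r x y, sqrt \<epsilon> *\<^sub>R \<sigma> r x y)"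

definition assumption_A2 ::
  "real \<Rightarrow> (real \<Rightarrow> real ^ 'n \<Rightarrow> real ^ 'n \<Rightarrow> real ^ 'n) \<Rightarrow>
   (real \<Rightarrow> real ^ 'n \<Rightarrow> real ^ 'n \<Rightarrow> real ^ 'd ^ 'n) \<Rightarrow>
   (real \<Rightarrow> real ^ 'n \<Rightarrow> real ^ 'n \<Rightarrow> real ^ 'd ^ 'n \<Rightarrow> real ^ 'n) \<Rightarrow>
   (real ^ 'n \<Rightarrow> real ^ 'n) \<Rightarrow> bool" where
  "assumption_A2 T f \<sigma> g h \<longleftrightarrow>
     (\<exists>C2>0.
        (\<forall>\<epsilon>\<in>{0<..1}. \<forall>x1 y1 z1 x2 y2 z2. AE r\<in>{0..T} in lborel.
           (A_op f \<sigma> g \<epsilon> r (x1, y1, z1) - A_op f \<sigma> g \<epsilon> r (x2, y2, z2))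
             \<bullet> ((x1, y1, z1) - (x2, y2, z2))
           \<le> - (C2 + sqrt \<epsilon>) * ((norm (x1 - x2))\<^sup>2 + (norm (y1 - y2))\<^sup>2)) \<and>
        (\<forall>x1 x2. (h x1 - h x2) \<bullet> (x1 - x2) \<ge> C2 * (norm (x1 - x2))\<^sup>2))"


section \<open>The FBSDE and the deterministic limit system\<close>

text \<open>The equations hold a.s. simultaneously for all \<open>s\<close>. The backward stochastic integral over
  \<open>[s, T]\<close> is \<open>J(T) - J(s)\<close>, where \<open>J\<close> is the integral process of \<open>Z\<close> started at \<open>t\<close>.\<close>

definition fbsde_solution ::
  "(real \<Rightarrow> real ^ 'd) measure \<Rightarrow> real \<Rightarrow>
   (real \<Rightarrow> real ^ 'n \<Rightarrow> real ^ 'n \<Rightarrow> real ^ 'n) \<Rightarrow>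
   (real \<Rightarrow> real ^ 'n \<Rightarrow> real ^ 'n \<Rightarrow> real ^ 'd ^ 'n) \<Rightarrow>
   (real \<Rightarrow> real ^ 'n \<Rightarrow> real ^ 'n \<Rightarrow> real ^ 'd ^ 'n \<Rightarrow> real ^ 'n) \<Rightarrow>
   (real ^ 'n \<Rightarrow> real ^ 'n) \<Rightarrow> real \<Rightarrow> real \<Rightarrow> real ^ 'n \<Rightarrow>
   (real \<Rightarrow> (real \<Rightarrow> real ^ 'd) \<Rightarrow> real ^ 'n) \<Rightarrow>
   (real \<Rightarrow> (real \<Rightarrow> real ^ 'd) \<Rightarrow> real ^ 'n) \<Rightarrow>
   (real \<Rightarrow> (real \<Rightarrow> real ^ 'd) \<Rightarrow> real ^ 'd ^ 'n) \<Rightarrow> bool" where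
  "fbsde_solution M T f \<sigma> g h \<epsilon> t x X Y Z \<longleftrightarrow>
     (let W = coordinate_process; F = augmented_filtration M W in
      X \<in> S2 M F t T \<and> Y \<in> S2 M F t T \<and> Z \<in> M2 M F t T \<and>
      (\<exists>I J.
         has_ito_integral M F W t T (\<lambda>r \<omega>. \<sigma> r (X r \<omega>) (Y r \<omega>)) I \<and>
         has_ito_integral M F W t T Z J \<and>
         (AE \<omega> in M. \<forall>s\<in>{t..T}.
            X s \<omega> = x + (LINT r:{t..s}|lborel. f r (X r \<omega>) (Y r \<omega>)) + sqrt \<epsilon> *\<^sub>R I s \<omega> \<and>
            Y s \<omega> = h (X T \<omega>) + (LINT r:{s..T}|lborel. g r (X r \<omega>) (Y r \<omega>) (Z r \<omega>))
                      - (J T \<omega> - J s \<omega>))))"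

definition limit_solution ::
  "real \<Rightarrow> (real \<Rightarrow> real ^ 'n \<Rightarrow> real ^ 'n \<Rightarrow> real ^ 'n) \<Rightarrow>
   (real \<Rightarrow> real ^ 'n \<Rightarrow> real ^ 'n \<Rightarrow> real ^ 'd ^ 'n \<Rightarrow> real ^ 'n) \<Rightarrow>
   (real ^ 'n \<Rightarrow> real ^ 'n) \<Rightarrow> real \<Rightarrow> real ^ 'n \<Rightarrow>
   (real \<Rightarrow> real ^ 'n) \<Rightarrow> (real \<Rightarrow> real ^ 'n) \<Rightarrow> bool" where
  "limit_solution T f g h t x \<X> \<Y> \<longleftrightarrow>
     continuous_on {t..T} \<X> \<and> continuous_on {t..T} \<Y> \<and>
     (\<forall>s\<in>{t..T}.
        \<X> s = x + (LINT r:{t..s}|lborel. f r (\<X> r) (\<Y> r)) \<and>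
        \<Y> s = h (\<X> T) + (LINT r:{s..T}|lborel. g r (\<X> r) (\<Y> r) 0))"


section \<open>The Meyer-Zheng topology and weak convergence\<close>

definition cadlag_paths :: "real \<Rightarrow> (real \<Rightarrow> 'a::real_normed_vector) set" where
  "cadlag_paths T = {w \<in> extensional {0..T}.
     (\<forall>s\<in>{0..<T}. (w \<longlongrightarrow> w s) (at_right s)) \<and>
     (\<forall>s\<in>{0<..T}. \<exists>l. (w \<longlongrightarrow> l) (at_left s)) \<and>
     (w \<longlongrightarrow> w T) (at_left T)}"

definition mz_dist ::
  "real \<Rightarrow> (real \<Rightarrow> 'a::{banach, second_countable_topology}) \<Rightarrow> (real \<Rightarrow> 'a) \<Rightarrow> real" where
  "mz_dist T w w' = (LINT s:{0..T}|lborel. min (norm (w s - w' s)) 1)"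

definition mz_topology ::
  "real \<Rightarrow> (real \<Rightarrow> 'a::{banach, second_countable_topology}) topology" where
  "mz_topology T = Metric_space.mtopology (cadlag_paths T) (mz_dist T)"

definition mz_borel ::
  "real \<Rightarrow> (real \<Rightarrow> 'a::{banach, second_countable_topology}) measure" where
  "mz_borel T = sigma (cadlag_paths T) {U. openin (mz_topology T) U}"

definition weakly_converges :: "'a topology \<Rightarrow> (nat \<Rightarrow> 'a measure) \<Rightarrow> 'a measure \<Rightarrow> bool" where
  "weakly_converges \<T> Qs Q \<longleftrightarrow>
     (\<forall>\<phi> :: 'a \<Rightarrow> real. continuous_map \<T> euclideanreal \<phi> \<and> bounded (\<phi> ` topspace \<T>) \<longrightarrow>
        (\<lambda>k. LINT w|Qs k. \<phi> w) \<longlonglongrightarrow> (LINT w|Q. \<phi> w))"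

text \<open>A solution \<open>Y\<close> has continuous paths on \<open>[t, T]\<close> only almost surely; on the exceptional null
  set the path is replaced by zero, which does not affect the law.\<close>

definition path_map ::
  "real \<Rightarrow> real \<Rightarrow> (real \<Rightarrow> 'w \<Rightarrow> 'a::real_normed_vector) \<Rightarrow> 'w \<Rightarrow> (real \<Rightarrow> 'a)" where
  "path_map T t Y \<omega> =
     (let w = (\<lambda>s\<in>{0..T}. Y (max t s) \<omega>) in
      if w \<in> cadlag_paths T then w else (\<lambda>s\<in>{0..T}. 0))"

definition path_law ::
  "'w measure \<Rightarrow> real \<Rightarrow> real \<Rightarrow> (real \<Rightarrow> 'w \<Rightarrow> 'a::{banach, second_countable_topology}) \<Rightarrow>
   (real \<Rightarrow> 'a) measure" where
  "path_law M T t Y = distr M (mz_borel T) (path_map T t Y)"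

end

theory Submission
  imports Defs
begin

text \<open>Let \<open>dX\<close> and \<open>dY\<close> be the differences between the solution of the FBSDE and
  the solution of the limit system. The proof is an energy estimate of order
  \<open>\<epsilon>\<close> for this pair.

  The product rule applied to \<open>dX \<bullet> dY\<close> expresses \<open>E[dX(T) \<bullet>
  dY(T)]\<close> as the integral of exactly the quantity that the monotonicity assumption controls,
  where \<open>Z\<close> is compared with \<open>0\<close>. The only term left over is
  \<open>\<surd>\<epsilon> E \<integral> \<sigma>(r, \<X>, \<Y>) \<bullet> Z dr\<close>. On the
  other side, \<open>E[dX(T) \<bullet> dY(T)]\<close> is bounded below by the monotonicity of the
  terminal condition. The product rule applied to \<open>dY \<bullet> dY\<close> together with the
  Lipschitz bounds dominates \<open>E \<integral> |Z|\<^sup>2\<close> by the energy of \<open>(dX,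
  dY)\<close>. Splitting the left-over term by Young's inequality and absorbing \<open>Z\<close>
  gives \<open>E|dX(T)|\<^sup>2 + E \<integral> |dX|\<^sup>2 + |dY|\<^sup>2 = O(\<epsilon>)\<close>
  and \<open>E|dY(t)|\<^sup>2 = O(\<epsilon>)\<close> (\<open>energy_estimate\<close>).

  For the forward component, \<open>sup |dX|\<close> is at most \<open>\<integral> |f(X, Y) - f(\<X>,
  \<Y>)| dr + \<surd>\<epsilon> sup |I|\<close>, where \<open>I\<close> is the stochastic integral.
  The first summand is small in mean by the energy estimate and the second is small in probability
  by Kolmogorov's maximal inequality (\<open>maximal_inequality\<close>,
  \<open>deviation_probability\<close>).

  For the backward component, the mean Meyer-Zheng distance between the path of \<open>Y\<close> and
  the path of \<open>\<Y>\<close> is \<open>O(\<surd>\<epsilon>)\<close>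
  (\<open>path_error\<close>). Hence the laws converge weakly along every sequence
  \<open>\<epsilon>\<^sub>k \<rightarrow> 0\<close>, and the limit \<open>Q\<close> is the point
  mass at \<open>\<Y>\<close>, extended to \<open>[0, t]\<close> by its value at \<open>t\<close>
  (\<open>weakly_converges_return\<close>).

  The stochastic calculus behind this uses expectations only. The increments of Brownian motion are
  independent of the augmented filtration, so simple integrals are orthogonal to the past and
  satisfy the isometry; both properties pass to \<open>L\<^sup>2\<close>-limits
  (\<open>ito_integral_martingale\<close>, \<open>ito_isometry\<close>). The product rule in
  expectation (\<open>ito_product_formula\<close>) follows from these two properties and Fubini's
  theorem.\<close>

section \<open>Square-integrable functions\<close>

definition square_integrable :: "'a measure \<Rightarrow> ('a \<Rightarrow> 'b::euclidean_space) \<Rightarrow> bool" where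
  "square_integrable N u \<longleftrightarrow> u \<in> borel_measurable N \<and> integrable N (\<lambda>x. (norm (u x))\<^sup>2)"

lemma square_integrable_measurable [measurable_dest]:
  "square_integrable N u \<Longrightarrow> u \<in> borel_measurable N"
  by (simp add: square_integrable_def)

lemma square_integrable_norm: "square_integrable N u \<Longrightarrow> integrable N (\<lambda>x. (norm (u x))\<^sup>2)"
  by (simp add: square_integrable_def)

lemma square_integrable_nn:
  "square_integrable N u \<longleftrightarrow>
     u \<in> borel_measurable N \<and> (\<integral>\<^sup>+x. ennreal ((norm (u x))\<^sup>2) \<partial>N) < \<infinity>"
  by (auto simp: square_integrable_def integrable_iff_bounded)

lemma square_integrable_bound:
  assumes "square_integrable N v" "u \<in> borel_measurable N" "AE x in N. norm (u x) \<le> norm (v x)"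
  shows "square_integrable N u"
  unfolding square_integrable_def
proof (safe intro!: assms(2))
  show "integrable N (\<lambda>x. (norm (u x))\<^sup>2)"
    by (rule Bochner_Integration.integrable_bound[OF square_integrable_norm[OF assms(1)]])
      (use assms(2,3) in \<open>auto intro: power_mono\<close>)
qed

lemma square_integrable_scaleR:
  "square_integrable N u \<Longrightarrow> square_integrable N (\<lambda>x. c *\<^sub>R u x)"
  by (auto simp: square_integrable_def power_mult_distrib)

lemma square_integrable_uminus:
  "square_integrable N u \<Longrightarrow> square_integrable N (\<lambda>x. - u x)"
  by (auto simp: square_integrable_def)

lemma square_integrable_add:
  assumes "square_integrable N u" "square_integrable N v"
  shows "square_integrable N (\<lambda>x. u x + v x)"
  unfolding square_integrable_def
proof
  have [measurable]: "u \<in> borel_measurable N" "v \<in> borel_measurable N"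
    using assms by (auto simp: square_integrable_def)
  show "(\<lambda>x. u x + v x) \<in> borel_measurable N" by measurable
  have *: "(norm (a + b))\<^sup>2 \<le> 2 * (norm a)\<^sup>2 + 2 * (norm b)\<^sup>2" for a b :: 'b
  proof -
    have "(norm (a + b))\<^sup>2 \<le> (norm a + norm b)\<^sup>2"
      by (intro power_mono norm_triangle_ineq) auto
    also have "\<dots> \<le> 2 * (norm a)\<^sup>2 + 2 * (norm b)\<^sup>2"
      using sum_squares_bound[of "norm a" "norm b"] by (simp add: power2_sum)
    finally show ?thesis .
  qed
  show "integrable N (\<lambda>x. (norm (u x + v x))\<^sup>2)"
    by (rule Bochner_Integration.integrable_bound
        [where f="\<lambda>x. 2 * (norm (u x))\<^sup>2 + 2 * (norm (v x))\<^sup>2"])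
      (use assms * in \<open>auto simp: square_integrable_def\<close>)
qed

lemma square_integrable_diff:
  assumes "square_integrable N u" "square_integrable N v"
  shows "square_integrable N (\<lambda>x. u x - v x)"
  using square_integrable_add[OF assms(1) square_integrable_uminus[OF assms(2)]] by simp

lemma square_integrable_sum:
  assumes "\<And>i. i \<in> I \<Longrightarrow> square_integrable N (u i)"
  shows "square_integrable N (\<lambda>x. \<Sum>i\<in>I. u i x)"
  using assms
proof (induction I rule: infinite_finite_induct)
  case (insert i I)
  then show ?case by (auto intro!: square_integrable_add)
qed (auto simp: square_integrable_def)

lemma integrable_inner:
  assumes "square_integrable N u" "square_integrable N v"
  shows "integrable N (\<lambda>x. u x \<bullet> v x)"
proof (rule Bochner_Integration.integrable_bound
    [where f="\<lambda>x. (norm (u x))\<^sup>2 + (norm (v x))\<^sup>2"])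
  have "norm (a \<bullet> b) \<le> (norm a)\<^sup>2 + (norm b)\<^sup>2" for a b :: 'b
  proof -
    have "norm (a \<bullet> b) \<le> norm a * norm b" by (simp add: Cauchy_Schwarz_ineq2)
    also have "\<dots> \<le> (norm a)\<^sup>2 + (norm b)\<^sup>2"
    proof -
      have "0 \<le> norm a * norm b" by simp
      with sum_squares_bound[of "norm a" "norm b"] show ?thesis by linarith
    qed
    finally show ?thesis .
  qed
  then show "AE x in N. norm (u x \<bullet> v x) \<le> norm ((norm (u x))\<^sup>2 + (norm (v x))\<^sup>2)"
    by auto
qed (use assms in \<open>auto simp: square_integrable_def\<close>)

lemma (in finite_measure) square_integrable_bounded:
  fixes u :: "'a \<Rightarrow> 'b::euclidean_space"
  assumes "u \<in> borel_measurable M" "AE x in M. norm (u x) \<le> B"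
  shows "square_integrable M u"
  unfolding square_integrable_def
proof
  show "integrable M (\<lambda>x. (norm (u x))\<^sup>2)"
    by (rule integrable_const_bound[where B="B\<^sup>2"])
      (use assms in \<open>auto elim!: eventually_mono intro!: power_mono\<close>)
qed fact

lemma (in finite_measure) square_integrable_integrable:
  fixes u :: "'a \<Rightarrow> 'b::euclidean_space"
  assumes "square_integrable M u"
  shows "integrable M u"
proof (rule Bochner_Integration.integrable_bound[where f="\<lambda>x. 1 + (norm (u x))\<^sup>2"])
  have "a \<le> 1 + a\<^sup>2" for a :: real
    using sum_squares_bound[of a 1] zero_le_power2[of a] by (simp; linarith)
  then show "AE x in M. norm (u x) \<le> norm (1 + (norm (u x))\<^sup>2)"
    by (auto simp: add_nonneg_nonneg)
qed (use assms in \<open>auto simp: square_integrable_def\<close>)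

text \<open>The quadratic \<open>\<integral> |l u + v|\<^sup>2\<close> in \<open>l\<close> is nonnegative, so
  its discriminant is not positive.\<close>

lemma Cauchy_Schwarz_integral:
  assumes u: "square_integrable N u" and v: "square_integrable N v"
  shows "(\<integral>x. u x \<bullet> v x \<partial>N)\<^sup>2 \<le> (\<integral>x. (norm (u x))\<^sup>2 \<partial>N) * (\<integral>x. (norm (v x))\<^sup>2 \<partial>N)"
proof -
  define P Q R where "P = (\<integral>x. (norm (u x))\<^sup>2 \<partial>N)" and "Q = (\<integral>x. (norm (v x))\<^sup>2 \<partial>N)"
    and "R = (\<integral>x. u x \<bullet> v x \<partial>N)"
  have iP: "integrable N (\<lambda>x. (norm (u x))\<^sup>2)" and iQ: "integrable N (\<lambda>x. (norm (v x))\<^sup>2)"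
    and iR: "integrable N (\<lambda>x. u x \<bullet> v x)"
    using u v by (auto simp: square_integrable_norm integrable_inner)
  have *: "0 \<le> P * l\<^sup>2 + 2 * R * l + Q" for l :: real
  proof -
    have "0 \<le> (\<integral>x. (norm (l *\<^sub>R u x + v x))\<^sup>2 \<partial>N)" by simp
    also have "\<dots> = (\<integral>x. l\<^sup>2 * (norm (u x))\<^sup>2 + (2 * l) * (u x \<bullet> v x) + (norm (v x))\<^sup>2 \<partial>N)"
      unfolding power2_norm_eq_inner
      by (intro Bochner_Integration.integral_cong)
        (auto simp: inner_add inner_commute power2_eq_square distrib_left)
    also have "\<dots> = l\<^sup>2 * P + (2 * l) * R + Q"
      using iP iQ iR by (simp add: P_def Q_def R_def)
    finally show ?thesis by (simp add: algebra_simps)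
  qed
  have "0 \<le> P" "0 \<le> Q" by (auto simp: P_def Q_def)
  show ?thesis
  proof (cases "P = 0")
    case True
    have "R = 0"
    proof (rule ccontr)
      assume "R \<noteq> 0"
      with *[of "-(Q + 1) / (2 * R)"] True show False by simp
    qed
    then show ?thesis using \<open>0 \<le> P\<close> \<open>0 \<le> Q\<close> unfolding P_def[symmetric] Q_def[symmetric] R_def[symmetric]
      by simp
  next
    case False
    with \<open>0 \<le> P\<close> have "P > 0" by simp
    have "P * (- R / P)\<^sup>2 + 2 * R * (- R / P) + Q = Q - R\<^sup>2 / P"
      using \<open>P > 0\<close> by (simp add: field_simps power2_eq_square)
    with *[of "- R / P"] have "R\<^sup>2 / P \<le> Q" by linarith
    then show ?thesis using \<open>P > 0\<close> unfolding P_def[symmetric] Q_def[symmetric] R_def[symmetric]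
      by (simp add: field_simps)
  qed
qed

text \<open>The inner product of \<open>L\<^sup>2\<close> is jointly continuous. The hypotheses are phrased with
  nonnegative integrals because the Ito integral is defined by such limits.\<close>

lemma tendsto_integral_inner:
  assumes u: "square_integrable N u" and v: "square_integrable N v"
    and um: "\<And>m. square_integrable N (u' m)" and vm: "\<And>m. square_integrable N (v' m)"
    and cu: "(\<lambda>m. \<integral>\<^sup>+x. ennreal ((norm (u x - u' m x))\<^sup>2) \<partial>N) \<longlonglongrightarrow> 0"
    and cv: "(\<lambda>m. \<integral>\<^sup>+x. ennreal ((norm (v x - v' m x))\<^sup>2) \<partial>N) \<longlonglongrightarrow> 0"
  shows "(\<lambda>m. \<integral>x. u' m x \<bullet> v' m x \<partial>N) \<longlonglongrightarrow> (\<integral>x. u x \<bullet> v x \<partial>N)"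
proof -
  note du = square_integrable_diff[OF u um] and dv = square_integrable_diff[OF v vm]
  have conv: "(\<lambda>m. \<integral>x. (norm (w x - w' m x))\<^sup>2 \<partial>N) \<longlonglongrightarrow> 0"
    if "\<And>m. square_integrable N (\<lambda>x. w x - w' m x)"
      "(\<lambda>m. \<integral>\<^sup>+x. ennreal ((norm (w x - w' m x))\<^sup>2) \<partial>N) \<longlonglongrightarrow> 0" for w :: "'a \<Rightarrow> 'b" and w'
  proof -
    have "(\<integral>\<^sup>+x. ennreal ((norm (w x - w' m x))\<^sup>2) \<partial>N) = ennreal (\<integral>x. (norm (w x - w' m x))\<^sup>2 \<partial>N)" for m
      using that(1)[of m] by (intro nn_integral_eq_integral) (auto simp: square_integrable_def)
    with that(2) show ?thesis
      by (simp add: ennreal_tendsto_0_iff)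
  qed
  note cu' = conv[OF du cu] and cv' = conv[OF dv cv]
  have small: "(\<lambda>m. \<integral>x. p m x \<bullet> q m x \<partial>N) \<longlonglongrightarrow> 0"
    if "\<And>m. square_integrable N (p m)" "\<And>m. square_integrable N (q m)"
      "(\<lambda>m. (\<integral>x. (norm (p m x))\<^sup>2 \<partial>N) * (\<integral>x. (norm (q m x))\<^sup>2 \<partial>N)) \<longlonglongrightarrow> 0" for p q :: "nat \<Rightarrow> 'a \<Rightarrow> 'b"
  proof -
    have "(\<lambda>m. (\<integral>x. p m x \<bullet> q m x \<partial>N)\<^sup>2) \<longlonglongrightarrow> 0"
      by (rule tendsto_sandwich[OF _ _ tendsto_const that(3)])
        (auto intro!: Cauchy_Schwarz_integral that always_eventually)
    from tendsto_real_sqrt[OF this] show ?thesis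
      by (simp add: tendsto_rabs_zero_iff)
  qed
  have e: "(\<integral>x. u' m x \<bullet> v' m x \<partial>N) =
     (\<integral>x. (u x - u' m x) \<bullet> (v x - v' m x) \<partial>N) - (\<integral>x. (u x - u' m x) \<bullet> v x \<partial>N)
      - (\<integral>x. u x \<bullet> (v x - v' m x) \<partial>N) + (\<integral>x. u x \<bullet> v x \<partial>N)" for m
  proof -
    have "(\<integral>x. u' m x \<bullet> v' m x \<partial>N) = (\<integral>x. (u x - u' m x) \<bullet> (v x - v' m x) - (u x - u' m x) \<bullet> v x
       - u x \<bullet> (v x - v' m x) + u x \<bullet> v x \<partial>N)"
      by (intro Bochner_Integration.integral_cong) (auto simp: inner_diff algebra_simps)
    also have "\<dots> = (\<integral>x. (u x - u' m x) \<bullet> (v x - v' m x) \<partial>N) - (\<integral>x. (u x - u' m x) \<bullet> v x \<partial>N)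
      - (\<integral>x. u x \<bullet> (v x - v' m x) \<partial>N) + (\<integral>x. u x \<bullet> v x \<partial>N)"
      by (intro has_bochner_integral_integral_eq has_bochner_integral_add has_bochner_integral_diff
        has_bochner_integral_integrable integrable_inner du dv u v)
    finally show ?thesis .
  qed
  have "(\<lambda>m. \<integral>x. u' m x \<bullet> v' m x \<partial>N) \<longlonglongrightarrow> 0 - 0 - 0 + (\<integral>x. u x \<bullet> v x \<partial>N)"
    unfolding e
    by (intro tendsto_intros small du dv u v tendsto_mult_zero tendsto_mult_left_zero
      tendsto_mult_right_zero cu' cv')
  then show ?thesis by simp
qed

section \<open>Brownian increments and the augmented filtration\<close>

text \<open>Lebesgue measure on \<open>real ^ 'd\<close> is the image of a product measure indexed by the
  standard basis, so integrals of products of functions of the single coordinates factor.\<close>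

lemma integral_lborel_vec_prod:
  fixes f :: "'d::finite \<Rightarrow> real \<Rightarrow> real"
  assumes f: "\<And>i. integrable lborel (f i)"
  shows "integrable lborel (\<lambda>x::real^'d. \<Prod>i\<in>UNIV. f i (x $ i))"
    and "(\<integral>x. (\<Prod>i\<in>UNIV. f i (x $ i)) \<partial>(lborel :: (real^'d) measure)) = (\<Prod>i\<in>UNIV. \<integral>y. f i y \<partial>lborel)"
proof -
  let ?e = "\<lambda>i::'d. axis i (1::real)"
  let ?S = "\<lambda>y::(real^'d \<Rightarrow> real). \<Sum>b\<in>Basis. y b *\<^sub>R b"
  have inj: "inj ?e" by (auto simp: inj_on_def axis_eq_axis)
  have B: "Basis = range ?e" by (auto simp: Basis_vec_def)
  define g where "g b = f (inv ?e b)" for b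
  have g: "g (?e i) = f i" for i by (simp add: g_def inv_f_f[OF inj])
  interpret product_sigma_finite "\<lambda>_::real^'d. lborel :: real measure" ..
  have S: "?S y $ i = y (?e i)" for y i
  proof -
    have "?S y $ i = (\<Sum>b\<in>Basis. y b * (b $ i))" by simp
    also have "\<dots> = (\<Sum>j\<in>UNIV. y (?e j) * (?e j $ i))"
      unfolding B by (subst sum.reindex[OF inj]) simp
    also have "\<dots> = (\<Sum>j\<in>UNIV. if j = i then y (?e j) else 0)"
      by (intro sum.cong) (auto simp: axis_def)
    finally show ?thesis by simp
  qed
  have p: "(\<Prod>i\<in>UNIV. f i (?S y $ i)) = (\<Prod>b\<in>Basis. g b (y b))" for y
  proof -
    have "(\<Prod>b\<in>Basis. g b (y b)) = (\<Prod>i\<in>UNIV. f i (y (?e i)))"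
      unfolding B by (subst prod.reindex[OF inj]) (simp add: g)
    then show ?thesis unfolding S by simp
  qed
  have [measurable]: "f i \<in> borel_measurable borel" for i
    using borel_measurable_integrable[OF f[of i]] by simp
  have gi: "integrable lborel (g b)" for b by (simp add: g_def f)
  show "integrable lborel (\<lambda>x::real^'d. \<Prod>i\<in>UNIV. f i (x $ i))"
  proof -
    have "integrable (\<Pi>\<^sub>M b\<in>(Basis::(real^'d) set). lborel) (\<lambda>y. \<Prod>i\<in>UNIV. f i (?S y $ i))"
      unfolding p by (rule product_integrable_prod) (auto simp: gi)
    then show ?thesis
      unfolding lborel_eq[where 'a="real^'d"] by (subst integrable_distr_eq) simp_all
  qed
  have "(\<integral>x. (\<Prod>i\<in>UNIV. f i (x $ i)) \<partial>(lborel :: (real^'d) measure)) =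
        (\<integral>y. (\<Prod>b\<in>Basis. g b (y b)) \<partial>(\<Pi>\<^sub>M b\<in>(Basis::(real^'d) set). lborel))"
    unfolding p[symmetric] lborel_eq[where 'a="real^'d"] by (subst integral_distr) simp_all
  also have "\<dots> = (\<Prod>b\<in>Basis. \<integral>y. g b y \<partial>lborel)"
    by (rule product_integral_prod) (auto simp: gi)
  also have "\<dots> = (\<Prod>i\<in>UNIV. \<integral>y. f i y \<partial>lborel)"
    unfolding B by (subst prod.reindex[OF inj]) (simp add: g)
  finally show "(\<integral>x. (\<Prod>i\<in>UNIV. f i (x $ i)) \<partial>(lborel :: (real^'d) measure)) = (\<Prod>i\<in>UNIV. \<integral>y. f i y \<partial>lborel)" .
qed

lemma gaussian_vec_moments:
  fixes k l :: "'d::finite" and c :: real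
  assumes c: "c > 0"
  defines "p \<equiv> \<lambda>x::real^'d. \<Prod>i\<in>UNIV. normal_density 0 (sqrt c) (x $ i)"
  shows "integrable lborel (\<lambda>x. p x * x $ l)" "(\<integral>x. p x * x $ l \<partial>lborel) = 0"
    and "integrable lborel (\<lambda>x. p x * (x $ l * x $ k))"
    and "(\<integral>x. p x * (x $ l * x $ k) \<partial>lborel) = (if l = k then c else 0)"
proof -
  let ?n = "normal_density 0 (sqrt c)"
  have s: "sqrt c > 0" using c by simp
  have i0: "integrable lborel ?n" "(\<integral>y. ?n y \<partial>lborel) = 1" using s by auto
  have i1: "integrable lborel (\<lambda>y. ?n y * y)" "(\<integral>y. ?n y * y \<partial>lborel) = 0"
    using integrable_normal_moment_nz_1[OF s, of 0] integral_normal_moment_nz_1[OF s, of 0] by auto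
  have i2: "integrable lborel (\<lambda>y. ?n y * (y * y))" "(\<integral>y. ?n y * (y * y) \<partial>lborel) = c"
    using integrable_normal_moment[OF s, of 0 2] integral_normal_moment_even[OF s, of 0 1] c
    by (auto simp: power2_eq_square)
  \<comment> \<open>The factor \<open>x $ l\<close> is absorbed into the marginal density with index \<open>l\<close>, so that the integrand is a product.\<close>
  let ?f1 = "\<lambda>i y. ?n y * (if i = l then y else 1)"
  have if1: "integrable lborel (?f1 i)" for i using i0 i1 by (cases "i = l") auto
  have e1: "(\<Prod>i\<in>UNIV. ?f1 i (x $ i)) = p x * x $ l" for x
    by (simp add: p_def prod.distrib prod.delta)
  show "integrable lborel (\<lambda>x. p x * x $ l)"
    using integral_lborel_vec_prod(1)[of ?f1, OF if1] by (simp add: e1)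
  have "(\<integral>x. p x * x $ l \<partial>lborel) = (\<Prod>i\<in>UNIV. \<integral>y. ?f1 i y \<partial>lborel)"
    using integral_lborel_vec_prod(2)[of ?f1, OF if1] by (simp add: e1)
  also have "\<dots> = 0" using i1 by (intro prod_zero bexI[of _ l]) auto
  finally show "(\<integral>x. p x * x $ l \<partial>lborel) = 0" .
  let ?f2 = "\<lambda>i y. ?n y * ((if i = l then y else 1) * (if i = k then y else 1))"
  have if2: "integrable lborel (?f2 i)" for i
    using i0 i1 i2 by (cases "i = l"; cases "i = k") auto
  have e2: "(\<Prod>i\<in>UNIV. ?f2 i (x $ i)) = p x * (x $ l * x $ k)" for x
    by (simp add: p_def prod.distrib prod.delta)
  show "integrable lborel (\<lambda>x. p x * (x $ l * x $ k))"
    using integral_lborel_vec_prod(1)[of ?f2, OF if2] by (simp add: e2)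
  have *: "(\<integral>x. p x * (x $ l * x $ k) \<partial>lborel) = (\<Prod>i\<in>UNIV. \<integral>y. ?f2 i y \<partial>lborel)"
    using integral_lborel_vec_prod(2)[of ?f2, OF if2] by (simp add: e2)
  show "(\<integral>x. p x * (x $ l * x $ k) \<partial>lborel) = (if l = k then c else 0)"
  proof (cases "l = k")
    case True
    have "(\<Prod>i\<in>UNIV. \<integral>y. ?f2 i y \<partial>lborel) = (\<Prod>i\<in>UNIV. if i = l then c else 1)"
      using i0 i2 True by (intro prod.cong) auto
    then show ?thesis using * True by simp
  next
    case False
    have "(\<Prod>i\<in>UNIV. \<integral>y. ?f2 i y \<partial>lborel) = 0" using i1 False
      by (intro prod_zero bexI[of _ l]) auto
    then show ?thesis using * False by simp
  qed
qed

text \<open>The completed space \<open>M\<close> carries the filtration, whereas independence and the Gaussian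
  law are given on the uncompleted space \<open>P\<close>; both are therefore kept as parameters.\<close>

locale wiener_space =
  fixes T :: real and P M :: "(real \<Rightarrow> real ^ 'd) measure"
  assumes T_pos: "T > 0" and wiener: "wiener_measure T P" and completion: "M = completion P"
begin

abbreviation "W \<equiv> coordinate_process :: real \<Rightarrow> (real \<Rightarrow> real ^ 'd) \<Rightarrow> real ^ 'd"
abbreviation "F \<equiv> augmented_filtration M W"

sublocale prob_space M
proof -
  interpret P: prob_space P using wiener by (simp add: wiener_measure_def)
  show "prob_space M" unfolding completion by (rule P.prob_space_completion)
qed

sublocale complete_measure M
  unfolding completion ..

lemma space_M: "space M = space P"
  by (subst completion) simp

lemma W_measurable_P: "u \<in> {0..T} \<Longrightarrow> W u \<in> borel_measurable P"
proof -
  assume u: "u \<in> {0..T}"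
  have "sets P = sets (coordinate_sigma T)" using wiener by (simp add: wiener_measure_def)
  then have "measurable P borel = measurable (coordinate_sigma T) (borel :: (real^'d) measure)"
    by (rule measurable_cong_sets) simp
  moreover have "(\<lambda>\<omega>. \<omega> u) \<in> borel_measurable (coordinate_sigma T :: (real \<Rightarrow> real^'d) measure)"
    unfolding coordinate_sigma_def
    by (intro measurable_restrict_space1 measurable_component_singleton u)
  moreover have "W u = (\<lambda>\<omega>. \<omega> u)" by (auto simp: coordinate_process_def)
  ultimately show ?thesis by simp
qed

lemma W_measurable: "u \<in> {0..T} \<Longrightarrow> W u \<in> borel_measurable M"
  by (subst completion) (intro measurable_completion W_measurable_P)

lemma natural_eq: "natural_filtration M W s = natural_filtration P W s"
  by (simp add: natural_filtration_def space_M)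

lemma sets_natural:
  "sets (natural_filtration P W s) =
     sigma_sets (space P) (\<Union>u\<in>{0..s}. sets (vimage_algebra (space P) (W u) borel))"
  unfolding natural_filtration_def
  proof (rule sets_measure_of)
  have "A \<subseteq> space P" if "A \<in> sets (vimage_algebra (space P) (W u) borel)" for A u
    using sets.sets_into_space[OF that] by simp
  then show "(\<Union>u\<in>{0..s}. sets (vimage_algebra (space P) (W u) borel)) \<subseteq> Pow (space P)"
    by blast
qed

lemma natural_sub: "s \<le> T \<Longrightarrow> sets (natural_filtration P W s) \<subseteq> sets P"
  unfolding sets_natural
  by (rule sets.sigma_sets_subset)
    (auto simp: sets_vimage_algebra2 intro!: measurable_sets W_measurable_P)

lemma space_F [simp]: "space (F s) = space M"
  by (simp add: augmented_filtration_def space_measure_of_conv)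

lemma F_gen_sub: "sets (natural_filtration P W s) \<union> null_sets M \<subseteq> Pow (space M)"
  using sets.sets_into_space[of _ "natural_filtration P W s"] sets.sets_into_space[of _ M]
  by (auto simp: space_M null_sets_def natural_filtration_def space_measure_of_conv)

lemma sets_F: "sets (F s) = sigma_sets (space M) (sets (natural_filtration P W s) \<union> null_sets M)"
  unfolding augmented_filtration_def natural_eq
  by (intro sets_measure_of F_gen_sub)

lemma F_sub: "s \<le> T \<Longrightarrow> sets (F s) \<subseteq> sets M"
  unfolding sets_F
proof (rule sets.sigma_sets_subset)
  assume "s \<le> T"
  have "sets P \<subseteq> sets M" by (subst completion) auto
  with natural_sub[OF \<open>s \<le> T\<close>] show "sets (natural_filtration P W s) \<union> null_sets M \<subseteq> sets M"
    by (auto simp: null_sets_def)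
qed

lemma F_mono: "s \<le> r \<Longrightarrow> sets (F s) \<subseteq> sets (F r)"
  unfolding sets_F sets_natural
  by (intro sigma_sets_mono' Un_mono order_refl UN_mono) auto

lemma F_measurable_mono:
  "u \<in> borel_measurable (F s) \<Longrightarrow> s \<le> r \<Longrightarrow> u \<in> borel_measurable (F r)"
  using measurable_mono[OF order_refl refl F_mono[of s r], of borel] by auto

lemma F_measurable_M:
  "u \<in> borel_measurable (F s) \<Longrightarrow> s \<le> T \<Longrightarrow> u \<in> borel_measurable M"
  using measurable_mono[OF order_refl refl F_sub[of s], of borel] by auto

lemma W_measurable_F:
  assumes "0 \<le> u" "u \<le> s"
  shows "W u \<in> borel_measurable (F s)"
proof (rule measurableI)
  fix A :: "(real^'d) set" assume "A \<in> sets borel"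
  then have "W u -` A \<inter> space P \<in> sets (vimage_algebra (space P) (W u) borel)"
    by (rule in_vimage_algebra)
  then have "W u -` A \<inter> space P \<in> sets (natural_filtration P W s)"
    unfolding sets_natural using assms by (intro sigma_sets.Basic) auto
  then show "W u -` A \<inter> space (F s) \<in> sets (F s)"
    by (auto simp: space_M sets_F)
qed simp

text \<open>The events with such a raw version form a \<open>\<sigma>\<close>-algebra that contains the generators. This is how
  independence of the increments survives the augmentation.\<close>

lemma F_approx:
  assumes "s \<le> T" "A \<in> sets (F s)"
  shows "\<exists>B\<in>sets (natural_filtration P W s). sym_diff A B \<in> null_sets M"
  using assms(2) unfolding sets_F
proof (induction A rule: sigma_sets.induct)
  case (Basic A)
  then show ?case
  proof
    assume "A \<in> null_sets M"
    then show ?thesis by (intro bexI[of _ "{}"]) auto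
  qed (auto intro!: bexI[of _ A])
next
  case Empty
  show ?case by (intro bexI[of _ "{}"]) auto
next
  case (Compl A)
  then obtain B where B: "B \<in> sets (natural_filtration P W s)" "sym_diff A B \<in> null_sets M" by auto
  have "A \<subseteq> space M" "B \<subseteq> space M"
    using sigma_sets_into_sp[OF F_gen_sub Compl.hyps] B(1) F_gen_sub by auto
  then have "sym_diff (space M - A) (space M - B) = sym_diff A B" by auto
  moreover have "space M - B \<in> sets (natural_filtration P W s)"
    using sets.compl_sets[OF B(1)] by (simp add: natural_filtration_def space_measure_of_conv space_M)
  ultimately show ?case using B(2) by (intro bexI[of _ "space M - B"]) auto
next
  case (Union A)
  then obtain B where B: "\<And>i. B i \<in> sets (natural_filtration P W s)"
    "\<And>i. sym_diff (A i) (B i) \<in> null_sets M" by metis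
  have "A i \<in> sets M" for i using Union.hyps F_sub[OF assms(1)] by (auto simp: sets_F)
  moreover have sb: "B i \<in> sets M" for i
    using B(1)[of i] natural_sub[OF assms(1)] by (subst completion) auto
  ultimately have "sym_diff (\<Union>i. A i) (\<Union>i. B i) \<in> sets M" by auto
  moreover have "(\<Union>i. sym_diff (A i) (B i)) \<in> null_sets M"
    using B(2) by (intro null_sets_UN) auto
  moreover have "sym_diff (\<Union>i. A i) (\<Union>i. B i) \<subseteq> (\<Union>i. sym_diff (A i) (B i))" by auto
  ultimately have "sym_diff (\<Union>i. A i) (\<Union>i. B i) \<in> null_sets M" using null_sets_subset by blast
  with B(1) show ?case by (intro bexI[of _ "\<Union>i. B i"]) auto
qed

abbreviation "incr s r \<omega> \<equiv> W r \<omega> - W s \<omega>"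

text \<open>Replacing the event of the augmented filtration by its raw version changes no probability, so the
  independence stated for \<open>P\<close> carries over to the completion.\<close>

lemma incr_indep:
  assumes "0 \<le> s" "s < r" "r \<le> T" and \<eta>: "\<eta> \<in> borel_measurable (F s)"
    and \<theta>: "\<theta> \<in> borel_measurable borel"
  shows "indep_var borel (\<eta> :: _ \<Rightarrow> real) borel (\<lambda>\<omega>. \<theta> (incr s r \<omega>) :: real)"
proof -
  interpret P: prob_space P using wiener by (simp add: wiener_measure_def)
  let ?V = "vimage_algebra (space P) (incr s r) borel"
  have ind: "P.indep_set (sets (natural_filtration P W s)) (sets ?V)"
    using wiener assms(1-3) unfolding wiener_measure_def by blast
  have Wm: "incr s r \<in> borel_measurable P"
    using W_measurable_P[of r] W_measurable_P[of s] assms(1-3) by auto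
  have \<eta>M: "\<eta> \<in> borel_measurable M" using F_measurable_M[OF \<eta>] assms by simp
  have WM: "incr s r \<in> borel_measurable M"
    using W_measurable[of r] W_measurable[of s] assms(1-3) by auto
  have "indep_set {\<eta> -` A \<inter> space M |A. A \<in> sets borel}
     {(\<lambda>\<omega>. \<theta> (incr s r \<omega>)) -` A \<inter> space M |A. A \<in> sets borel}"
  proof (rule indep_setI)
    show "{\<eta> -` A \<inter> space M |A. A \<in> sets borel} \<subseteq> events" using \<eta>M by auto
    show "{(\<lambda>\<omega>. \<theta> (incr s r \<omega>)) -` A \<inter> space M |A. A \<in> sets borel} \<subseteq> events"
      using measurable_sets[OF measurable_compose[OF WM \<theta>]] by auto
    fix a b assume "a \<in> {\<eta> -` A \<inter> space M |A. A \<in> sets borel}"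
      and "b \<in> {(\<lambda>\<omega>. \<theta> (incr s r \<omega>)) -` A \<inter> space M |A. A \<in> sets borel}"
    then obtain A B where A: "A \<in> sets borel" "a = \<eta> -` A \<inter> space M"
      and B: "B \<in> sets borel" "b = (\<lambda>\<omega>. \<theta> (incr s r \<omega>)) -` B \<inter> space M" by auto
    have aF: "a \<in> sets (F s)" using measurable_sets[OF \<eta> A(1)] A(2) by simp
    have "\<theta> -` B \<in> sets borel" using measurable_sets[OF \<theta> B(1)] by simp
    moreover have "b = incr s r -` (\<theta> -` B) \<inter> space P" using B(2) by (auto simp: space_M)
    ultimately have bV: "b \<in> sets ?V" by (auto intro: in_vimage_algebra)
    have bP: "b \<in> sets P" using ind bV by (auto simp: P.indep_sets2_eq)
    from F_approx[OF _ aF] assms obtain a' where a': "a' \<in> sets (natural_filtration P W s)"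
      "sym_diff a a' \<in> null_sets M" by auto
    have a'P: "a' \<in> sets P" using a'(1) natural_sub[of s] assms by auto
    have PM: "sets P \<subseteq> sets M" by (subst completion) auto
    have ae: "AE x in M. x \<in> a \<longleftrightarrow> x \<in> a'" using AE_not_in[OF a'(2)] by eventually_elim auto
    have aM: "a \<in> sets M" using aF F_sub[of s] assms by auto
    have "prob (a \<inter> b) = prob (a' \<inter> b)"
      by (rule finite_measure_eq_AE) (use ae aM a'P bP PM in auto)
    also have "\<dots> = P.prob (a' \<inter> b)"
      using a'P bP by (subst completion) simp
    also have "\<dots> = P.prob a' * P.prob b" using P.indep_setD[OF ind a'(1) bV] .
    also have "\<dots> = prob a' * prob b"
      using a'P bP by (subst (1 2) completion) simp
    also have "prob a' = prob a"
      by (rule finite_measure_eq_AE) (use ae aM a'P PM in auto)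
    finally show "prob (a \<inter> b) = prob a * prob b" .
  qed
  then have "indep_set (sigma_sets (space M) {\<eta> -` A \<inter> space M |A. A \<in> sets borel})
     (sigma_sets (space M) {(\<lambda>\<omega>. \<theta> (incr s r \<omega>)) -` A \<inter> space M |A. A \<in> sets borel})"
  proof (rule indep_set_sigma_sets)
    have "Int_stable {\<zeta> -` A \<inter> space M |A. A \<in> sets borel}" for \<zeta> :: "_ \<Rightarrow> real"
      unfolding Int_stable_def
    proof safe
      fix A B :: "real set" assume "A \<in> sets borel" "B \<in> sets borel"
      then show "\<exists>C. (\<zeta> -` A \<inter> space M) \<inter> (\<zeta> -` B \<inter> space M) = \<zeta> -` C \<inter> space M \<and> C \<in> sets borel"
        by (intro exI[of _ "A \<inter> B"]) auto
    qed
    then show "Int_stable {\<eta> -` A \<inter> space M |A. A \<in> sets borel}"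
      "Int_stable {(\<lambda>\<omega>. \<theta> (incr s r \<omega>)) -` A \<inter> space M |A. A \<in> sets borel}" by auto
  qed
  moreover have "random_variable borel (\<lambda>\<omega>. \<theta> (incr s r \<omega>))"
    using measurable_compose[OF WM \<theta>] .
  ultimately show ?thesis using \<eta>M by (simp add: indep_var_eq)
qed

lemma incr_moments:
  assumes "0 \<le> s" "s \<le> r" "r \<le> T"
  shows "integrable M (\<lambda>\<omega>. incr s r \<omega> $ l)" "(\<integral>\<omega>. incr s r \<omega> $ l \<partial>M) = 0"
    and "integrable M (\<lambda>\<omega>. incr s r \<omega> $ l * incr s r \<omega> $ k)"
    and "(\<integral>\<omega>. incr s r \<omega> $ l * incr s r \<omega> $ k \<partial>M) = (if l = k then r - s else 0)"
proof -
  have "integrable M (\<lambda>\<omega>. incr s r \<omega> $ l) \<and> (\<integral>\<omega>. incr s r \<omega> $ l \<partial>M) = 0 \<and>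
    integrable M (\<lambda>\<omega>. incr s r \<omega> $ l * incr s r \<omega> $ k) \<and>
    (\<integral>\<omega>. incr s r \<omega> $ l * incr s r \<omega> $ k \<partial>M) = (if l = k then r - s else 0)"
  proof (cases "s = r")
  case False
  with assms have c: "r - s > 0" by simp
  let ?p = "\<lambda>x::real^'d. \<Prod>i\<in>UNIV. normal_density 0 (sqrt (r - s)) (x $ i)"
  have d: "distributed P lborel (incr s r) (\<lambda>x. ennreal (?p x))"
    using wiener assms c unfolding wiener_measure_def by auto
  have WP: "incr s r \<in> borel_measurable P"
    using W_measurable_P[of r] W_measurable_P[of s] assms by auto
  have p0: "0 \<le> ?p x" for x by (intro prod_nonneg) auto
  have I: "integrable M (\<lambda>\<omega>. h (incr s r \<omega>))" "(\<integral>\<omega>. h (incr s r \<omega>) \<partial>M) = (\<integral>x. ?p x * h x \<partial>lborel)"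
    if h: "h \<in> borel_measurable borel" "integrable lborel (\<lambda>x. ?p x * h x)" for h :: "real^'d \<Rightarrow> real"
  proof -
    have hm: "(\<lambda>\<omega>. h (incr s r \<omega>)) \<in> borel_measurable P" using measurable_compose[OF WP h(1)] .
    have "integrable P (\<lambda>\<omega>. h (incr s r \<omega>))"
      using distributed_integrable[OF d, of h] h p0 by auto
    then show "integrable M (\<lambda>\<omega>. h (incr s r \<omega>))"
      using hm by (subst completion) (simp add: integrable_completion)
    show "(\<integral>\<omega>. h (incr s r \<omega>) \<partial>M) = (\<integral>x. ?p x * h x \<partial>lborel)"
      using distributed_integral[OF d, of h] h p0 hm by (subst completion) (simp add: integral_completion)
  qed
  note g = gaussian_vec_moments[OF c]
  show ?thesis
    using I[of "\<lambda>x. x $ l"] g(1,2)[of l] I[of "\<lambda>x. x $ l * x $ k"] g(3,4)[of l k] by auto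
  qed simp
  then show "integrable M (\<lambda>\<omega>. incr s r \<omega> $ l)" "(\<integral>\<omega>. incr s r \<omega> $ l \<partial>M) = 0"
    and "integrable M (\<lambda>\<omega>. incr s r \<omega> $ l * incr s r \<omega> $ k)"
    and "(\<integral>\<omega>. incr s r \<omega> $ l * incr s r \<omega> $ k \<partial>M) = (if l = k then r - s else 0)"
    by auto
qed

text \<open>This and the next lemma are all that the Ito integral needs from Brownian motion: by independence, a
  factor known at time \<open>s\<close> separates from the increment over \<open>[s, r]\<close>.\<close>

lemma incr_mean:
  assumes "0 \<le> s" "s \<le> r" "r \<le> T" "\<eta> \<in> borel_measurable (F s)" "integrable M \<eta>"
  shows "integrable M (\<lambda>\<omega>. \<eta> \<omega> * incr s r \<omega> $ l)" "(\<integral>\<omega>. \<eta> \<omega> * incr s r \<omega> $ l \<partial>M) = 0"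
proof -
  have "integrable M (\<lambda>\<omega>. \<eta> \<omega> * incr s r \<omega> $ l) \<and> (\<integral>\<omega>. \<eta> \<omega> * incr s r \<omega> $ l \<partial>M) = 0"
  proof (cases "s = r")
    case False
    with assms have i: "indep_var borel \<eta> borel (\<lambda>\<omega>. (\<lambda>x. x $ l) (incr s r \<omega>))"
      by (intro incr_indep) auto
    then show ?thesis
      using indep_var_integrable[OF i assms(5)] indep_var_lebesgue_integral[OF i assms(5)]
        incr_moments[OF assms(1-3), of l] by simp
  qed simp
  then show "integrable M (\<lambda>\<omega>. \<eta> \<omega> * incr s r \<omega> $ l)" "(\<integral>\<omega>. \<eta> \<omega> * incr s r \<omega> $ l \<partial>M) = 0"
    by auto
qed

lemma incr_variance:
  assumes "0 \<le> s" "s \<le> r" "r \<le> T" "\<eta> \<in> borel_measurable (F s)" "integrable M \<eta>"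
  shows "integrable M (\<lambda>\<omega>. \<eta> \<omega> * (incr s r \<omega> $ l * incr s r \<omega> $ k))"
    and "(\<integral>\<omega>. \<eta> \<omega> * (incr s r \<omega> $ l * incr s r \<omega> $ k) \<partial>M) = (if l = k then r - s else 0) * (\<integral>\<omega>. \<eta> \<omega> \<partial>M)"
proof -
  have "integrable M (\<lambda>\<omega>. \<eta> \<omega> * (incr s r \<omega> $ l * incr s r \<omega> $ k)) \<and>
    (\<integral>\<omega>. \<eta> \<omega> * (incr s r \<omega> $ l * incr s r \<omega> $ k) \<partial>M) = (if l = k then r - s else 0) * (\<integral>\<omega>. \<eta> \<omega> \<partial>M)"
  proof (cases "s = r")
    case False
    with assms have i: "indep_var borel \<eta> borel (\<lambda>\<omega>. (\<lambda>x. x $ l * x $ k) (incr s r \<omega>))"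
      by (intro incr_indep) auto
    then show ?thesis
      using indep_var_integrable[OF i assms(5)] indep_var_lebesgue_integral[OF i assms(5)]
        incr_moments[OF assms(1-3)] by (simp add: mult.commute)
  qed simp
  then show "integrable M (\<lambda>\<omega>. \<eta> \<omega> * (incr s r \<omega> $ l * incr s r \<omega> $ k))"
    and "(\<integral>\<omega>. \<eta> \<omega> * (incr s r \<omega> $ l * incr s r \<omega> $ k) \<partial>M) = (if l = k then r - s else 0) * (\<integral>\<omega>. \<eta> \<omega> \<partial>M)"
    by auto
qed

end

section \<open>Covariances of weighted increments\<close>

lemma norm_vec_square: "(norm (x :: 'a::real_normed_vector ^ 'n))\<^sup>2 = (\<Sum>i\<in>UNIV. (norm (x $ i))\<^sup>2)"
  by (simp add: norm_vec_def L2_set_def sum_nonneg)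

lemma norm_matrix_vector_mult_le: "norm (A *v x) \<le> norm A * norm (x :: real ^ 'd)"
proof (rule power2_le_imp_le)
  have "(norm (A *v x))\<^sup>2 = (\<Sum>i\<in>UNIV. (A $ i \<bullet> x)\<^sup>2)"
    by (simp add: norm_vec_square matrix_vector_mul_component)
  also have "\<dots> \<le> (\<Sum>i\<in>UNIV. (norm (A $ i))\<^sup>2 * (norm x)\<^sup>2)"
    by (intro sum_mono) (use Cauchy_Schwarz_ineq in \<open>simp add: power2_norm_eq_inner\<close>)
  also have "\<dots> = (norm A * norm x)\<^sup>2"
    by (simp add: norm_vec_square[of A] power_mult_distrib sum_distrib_right)
  finally show "(norm (A *v x))\<^sup>2 \<le> (norm A * norm x)\<^sup>2" .
qed simp

text \<open>The entries of a matrix are reached by two applications, hence the general component type.\<close>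

lemma borel_measurable_vec_component [measurable (raw)]:
  fixes u :: "'a \<Rightarrow> 'b::{euclidean_space} ^ 'n"
  assumes "u \<in> borel_measurable K"
  shows "(\<lambda>x. u x $ i) \<in> borel_measurable K"
proof -
  have "continuous_on UNIV (\<lambda>v::'b^'n. v $ i)" by (intro continuous_intros)
  from measurable_compose[OF assms borel_measurable_continuous_onI[OF this]] show ?thesis .
qed

text \<open>Processes on \<open>[t, T]\<close> are treated as functions on the product \<open>N\<close> of
  Lebesgue measure \<open>L\<close> on the time interval with \<open>M\<close>.\<close>

locale wiener_interval = wiener_space T P M
  for T and P M :: "(real \<Rightarrow> real ^ 'd) measure" +
  fixes t :: real
  assumes t: "0 \<le> t" "t \<le> T"
begin

abbreviation "L \<equiv> restrict_space lborel {t..T}"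
abbreviation "N \<equiv> L \<Otimes>\<^sub>M M"

sublocale L: finite_measure L
  by (rule finite_measureI) (use t in \<open>simp add: emeasure_restrict_space space_restrict_space\<close>)

sublocale LM: pair_sigma_finite L M ..

sublocale N: finite_measure N
  by (rule finite_measure_pair_measure) (rule finite_measure_axioms L.finite_measure_axioms)+

lemma sets_L: "sets L = sets (restrict_space borel {t..T})"
  by (rule sets_restrict_space_cong) simp

lemma space_L [simp]: "space L = {t..T}"
  by (simp add: space_restrict_space)

lemma measurable_N: "borel_measurable (restrict_space borel {t..T} \<Otimes>\<^sub>M M) = borel_measurable N"
  by (rule measurable_cong_sets[OF sets_pair_measure_cong[OF sets_L[symmetric] refl] refl])

lemma nn_integral_N:
  assumes "u \<in> borel_measurable N"
  shows "(\<integral>\<^sup>+\<omega>. (\<integral>\<^sup>+s\<in>{t..T}. u (s, \<omega>) \<partial>lborel) \<partial>M) = (\<integral>\<^sup>+z. u z \<partial>N)"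
proof -
  have "(\<integral>\<^sup>+s\<in>{t..T}. u (s, \<omega>) \<partial>lborel) = (\<integral>\<^sup>+s. u (s, \<omega>) \<partial>L)" for \<omega>
    by (rule nn_integral_restrict_space[symmetric]) simp
  then show ?thesis using LM.nn_integral_snd[OF assms] by (simp only:)
qed

lemma M2_square_integrable:
  fixes v :: "real \<Rightarrow> (real \<Rightarrow> real^'d) \<Rightarrow> 'c::euclidean_space"
  assumes "v \<in> M2 M F t T"
  shows "square_integrable N (\<lambda>(s, \<omega>). v s \<omega>)"
proof -
  from assms have m: "(\<lambda>(s, \<omega>). v s \<omega>) \<in> borel_measurable N"
    and b: "(\<integral>\<^sup>+\<omega>. (\<integral>\<^sup>+s\<in>{t..T}. ennreal ((norm (v s \<omega>))\<^sup>2) \<partial>lborel) \<partial>M) < \<infinity>"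
    unfolding M2_def adapted_processes_def mem_Collect_eq measurable_N by blast+
  have "(\<lambda>z. ennreal ((norm (case z of (s, \<omega>) \<Rightarrow> v s \<omega>))\<^sup>2)) \<in> borel_measurable N"
    using m by measurable
  from nn_integral_N[OF this] b m show ?thesis
    unfolding square_integrable_nn prod.case by simp
qed

text \<open>Distributing the component over the difference would hide the increments from the lemmas about them.\<close>

declare vector_minus_component [simp del]

definition bounded_meas :: "real \<Rightarrow> ((real \<Rightarrow> real^'d) \<Rightarrow> 'c::euclidean_space) \<Rightarrow> bool" where
  "bounded_meas s p \<longleftrightarrow> p \<in> borel_measurable (F s) \<and> bounded (p ` space M)"

lemma bounded_meas_square_integrable:
  "bounded_meas s p \<Longrightarrow> s \<le> T \<Longrightarrow> square_integrable M p"
  unfolding bounded_meas_def bounded_iff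
  by (auto intro!: square_integrable_bounded F_measurable_M)

lemma bounded_meas_mono: "bounded_meas s p \<Longrightarrow> s \<le> r \<Longrightarrow> bounded_meas r p"
  by (auto simp: bounded_meas_def intro: F_measurable_mono)

lemma square_integrable_bounded_mult:
  fixes p q :: "(real \<Rightarrow> real^'d) \<Rightarrow> real"
  assumes "bounded_meas s p" "s \<le> T" "square_integrable M q"
  shows "square_integrable M (\<lambda>\<omega>. p \<omega> * q \<omega>)"
proof -
  obtain B where B: "\<And>\<omega>. \<omega> \<in> space M \<Longrightarrow> norm (p \<omega>) \<le> B"
    using assms(1) by (auto simp: bounded_meas_def bounded_iff)
  have [measurable]: "p \<in> borel_measurable M" "q \<in> borel_measurable M"
    using assms F_measurable_M by (auto simp: bounded_meas_def square_integrable_def)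
  show ?thesis
  proof (rule square_integrable_bound[OF square_integrable_scaleR[OF assms(3), of B]])
    show "AE \<omega> in M. norm (p \<omega> * q \<omega>) \<le> norm (B *\<^sub>R q \<omega>)"
      using B by (fastforce simp: abs_mult intro!: mult_right_mono)
  qed simp
qed

lemma incr_square_integrable:
  assumes "0 \<le> a" "a \<le> b" "b \<le> T"
  shows "square_integrable M (\<lambda>\<omega>. incr a b \<omega> $ l)" and "square_integrable M (incr a b)"
proof -
  have [measurable]: "W a \<in> borel_measurable M" "W b \<in> borel_measurable M"
    using assms by (auto intro!: W_measurable)
  have m: "incr a b \<in> borel_measurable M" by measurable
  then show *: "square_integrable M (\<lambda>\<omega>. incr a b \<omega> $ l)" for l
    using incr_moments(3)[OF assms, of l l] borel_measurable_vec_component[OF m, of l]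
    by (simp add: square_integrable_def power2_eq_square del: vector_minus_component)
  show "square_integrable M (incr a b)"
    unfolding square_integrable_def norm_vec_square
    using * m by (auto simp: square_integrable_def)
qed

lemma incr_measurable_F: "0 \<le> a \<Longrightarrow> a \<le> b \<Longrightarrow> b \<le> s \<Longrightarrow> (\<lambda>\<omega>. incr a b \<omega> $ l) \<in> borel_measurable (F s)"
proof -
  assume "0 \<le> a" "a \<le> b" "b \<le> s"
  then have [measurable]: "W a \<in> borel_measurable (F s)" "W b \<in> borel_measurable (F s)"
    by (auto intro!: W_measurable_F)
  have "incr a b \<in> borel_measurable (F s)" by measurable
  then show ?thesis by (rule borel_measurable_vec_component)
qed

text \<open>Everything except the later increment is known at its starting time.\<close>

lemma incr_product_disjoint:
  fixes p q :: "(real \<Rightarrow> real^'d) \<Rightarrow> real"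
  assumes "bounded_meas c p" "bounded_meas c q"
    and "0 \<le> a" "a \<le> b" "b \<le> c" "c \<le> d" "d \<le> T"
  shows "(\<integral>\<omega>. (p \<omega> * incr a b \<omega> $ l) * (q \<omega> * incr c d \<omega> $ k) \<partial>M) = 0"
proof -
  have [measurable]: "p \<in> borel_measurable (F c)" "q \<in> borel_measurable (F c)"
    "(\<lambda>\<omega>. incr a b \<omega> $ l) \<in> borel_measurable (F c)"
    using assms incr_measurable_F[of a b c l] by (auto simp: bounded_meas_def)
  have "square_integrable M (\<lambda>\<omega>. p \<omega> * incr a b \<omega> $ l)"
    using assms by (intro square_integrable_bounded_mult[of c] incr_square_integrable) auto
  from square_integrable_bounded_mult[OF assms(2) _ this] assms
  have "square_integrable M (\<lambda>\<omega>. q \<omega> * (p \<omega> * incr a b \<omega> $ l))" by auto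
  from square_integrable_integrable[OF this]
  have "(\<integral>\<omega>. (q \<omega> * (p \<omega> * incr a b \<omega> $ l)) * incr c d \<omega> $ k \<partial>M) = 0"
    using assms by (intro incr_mean) auto
  then show ?thesis by (simp add: ac_simps)
qed

lemma integrable_incr_product:
  fixes p q :: "(real \<Rightarrow> real^'d) \<Rightarrow> real"
  assumes "bounded_meas s p" "s \<le> T" "bounded_meas r q" "r \<le> T"
    and "0 \<le> a" "a \<le> b" "b \<le> T" "0 \<le> c" "c \<le> d" "d \<le> T"
  shows "integrable M (\<lambda>\<omega>. (p \<omega> * incr a b \<omega> $ l) * (q \<omega> * incr c d \<omega> $ k))"
  using integrable_inner[OF square_integrable_bounded_mult[OF assms(1,2) incr_square_integrable(1)[OF assms(5-7)]]
      square_integrable_bounded_mult[OF assms(3,4) incr_square_integrable(1)[OF assms(8-10)]]]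
  unfolding inner_real_def .

text \<open>The longer increment splits at the end of the shorter one; the remainder is orthogonal to everything
  before it, and the common part contributes the covariance of a single increment.\<close>

lemma incr_product_same_left_le:
  fixes p q :: "(real \<Rightarrow> real^'d) \<Rightarrow> real"
  assumes p: "bounded_meas a p" and q: "bounded_meas a q"
    and "0 \<le> a" "a \<le> b" "b \<le> d" "d \<le> T"
  shows "(\<integral>\<omega>. (p \<omega> * incr a b \<omega> $ l) * (q \<omega> * incr a d \<omega> $ k) \<partial>M) =
     (if l = k then b - a else 0) * (\<integral>\<omega>. p \<omega> * q \<omega> \<partial>M)"
proof -
  have aT: "a \<le> T" using assms by auto
  have [measurable]: "p \<in> borel_measurable (F a)" "q \<in> borel_measurable (F a)"
    using p q by (auto simp: bounded_meas_def)
  have split: "(p \<omega> * incr a b \<omega> $ l) * (q \<omega> * incr a d \<omega> $ k) =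
     (p \<omega> * incr a b \<omega> $ l) * (q \<omega> * incr a b \<omega> $ k) + (p \<omega> * incr a b \<omega> $ l) * (q \<omega> * incr b d \<omega> $ k)" for \<omega>
    by (simp add: algebra_simps vector_minus_component)
  have "(\<integral>\<omega>. (p \<omega> * incr a b \<omega> $ l) * (q \<omega> * incr a d \<omega> $ k) \<partial>M) =
     (\<integral>\<omega>. (p \<omega> * incr a b \<omega> $ l) * (q \<omega> * incr a b \<omega> $ k) \<partial>M) +
     (\<integral>\<omega>. (p \<omega> * incr a b \<omega> $ l) * (q \<omega> * incr b d \<omega> $ k) \<partial>M)"
    unfolding split using assms aT
    by (intro Bochner_Integration.integral_add integrable_incr_product[OF p aT q aT]) auto
  also have "(\<integral>\<omega>. (p \<omega> * incr a b \<omega> $ l) * (q \<omega> * incr b d \<omega> $ k) \<partial>M) = 0"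
    using assms by (intro incr_product_disjoint bounded_meas_mono[OF p] bounded_meas_mono[OF q]) auto
  also have "(\<integral>\<omega>. (p \<omega> * incr a b \<omega> $ l) * (q \<omega> * incr a b \<omega> $ k) \<partial>M) =
     (\<integral>\<omega>. (p \<omega> * q \<omega>) * (incr a b \<omega> $ l * incr a b \<omega> $ k) \<partial>M)"
    by (simp add: ac_simps)
  also have "\<dots> = (if l = k then b - a else 0) * (\<integral>\<omega>. p \<omega> * q \<omega> \<partial>M)"
  proof (rule incr_variance(2))
    show "integrable M (\<lambda>\<omega>. p \<omega> * q \<omega>)"
      using integrable_inner[OF bounded_meas_square_integrable[OF p aT] bounded_meas_square_integrable[OF q aT]]
      by simp
  qed (use assms in auto)
  finally show ?thesis by simp
qed

lemma incr_product_same_left: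
  fixes p q :: "(real \<Rightarrow> real^'d) \<Rightarrow> real"
  assumes p: "bounded_meas a p" and q: "bounded_meas a q"
    and "0 \<le> a" "a \<le> b" "b \<le> T" "a \<le> d" "d \<le> T"
  shows "(\<integral>\<omega>. (p \<omega> * incr a b \<omega> $ l) * (q \<omega> * incr a d \<omega> $ k) \<partial>M) =
     (if l = k then min b d - a else 0) * (\<integral>\<omega>. p \<omega> * q \<omega> \<partial>M)"
proof (cases "b \<le> d")
  case True
  then show ?thesis using incr_product_same_left_le[OF p q, of b d l k] assms by simp
next
  case False
  then show ?thesis using incr_product_same_left_le[OF q p, of d b k l] assms
    by (auto simp: ac_simps)
qed

lemma incr_product_le:
  fixes p q :: "(real \<Rightarrow> real^'d) \<Rightarrow> real"
  assumes p: "bounded_meas a p" and q: "bounded_meas c q"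
    and "0 \<le> a" "a \<le> b" "b \<le> T" "c \<le> d" "d \<le> T" "a \<le> c"
  shows "(\<integral>\<omega>. (p \<omega> * incr a b \<omega> $ l) * (q \<omega> * incr c d \<omega> $ k) \<partial>M) =
     (if l = k then max 0 (min b d - c) else 0) * (\<integral>\<omega>. p \<omega> * q \<omega> \<partial>M)"
proof (cases "b \<le> c")
  case True
  then show ?thesis
    using incr_product_disjoint[OF bounded_meas_mono[OF p] q, of a b d l k] assms by auto
next
  case False
  have aT: "a \<le> T" "c \<le> T" using assms by auto
  have split: "(p \<omega> * incr a b \<omega> $ l) * (q \<omega> * incr c d \<omega> $ k) =
     (p \<omega> * incr a c \<omega> $ l) * (q \<omega> * incr c d \<omega> $ k) + (p \<omega> * incr c b \<omega> $ l) * (q \<omega> * incr c d \<omega> $ k)" for \<omega>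
    by (simp add: algebra_simps vector_minus_component)
  have "(\<integral>\<omega>. (p \<omega> * incr a b \<omega> $ l) * (q \<omega> * incr c d \<omega> $ k) \<partial>M) =
     (\<integral>\<omega>. (p \<omega> * incr a c \<omega> $ l) * (q \<omega> * incr c d \<omega> $ k) \<partial>M) +
     (\<integral>\<omega>. (p \<omega> * incr c b \<omega> $ l) * (q \<omega> * incr c d \<omega> $ k) \<partial>M)"
    unfolding split using assms aT False
    by (intro Bochner_Integration.integral_add integrable_incr_product[OF p aT(1) q aT(2)]) auto
  also have "(\<integral>\<omega>. (p \<omega> * incr a c \<omega> $ l) * (q \<omega> * incr c d \<omega> $ k) \<partial>M) = 0"
    using assms by (intro incr_product_disjoint bounded_meas_mono[OF p] q) auto
  also have "(\<integral>\<omega>. (p \<omega> * incr c b \<omega> $ l) * (q \<omega> * incr c d \<omega> $ k) \<partial>M) =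
     (if l = k then min b d - c else 0) * (\<integral>\<omega>. p \<omega> * q \<omega> \<partial>M)"
    using assms False by (intro incr_product_same_left bounded_meas_mono[OF p] q) auto
  finally show ?thesis using False assms by auto
qed

text \<open>The covariance of two weighted increments over arbitrary intervals is proportional to the length of
  their overlap. This bilinear form of the isometry makes it possible to pair simple processes over
  different partitions without refining them.\<close>

lemma incr_product:
  fixes p q :: "(real \<Rightarrow> real^'d) \<Rightarrow> real"
  assumes p: "bounded_meas a p" and q: "bounded_meas c q"
    and "0 \<le> a" "a \<le> b" "b \<le> T" "0 \<le> c" "c \<le> d" "d \<le> T"
  shows "(\<integral>\<omega>. (p \<omega> * incr a b \<omega> $ l) * (q \<omega> * incr c d \<omega> $ k) \<partial>M) =
     (if l = k then max 0 (min b d - max a c) else 0) * (\<integral>\<omega>. p \<omega> * q \<omega> \<partial>M)"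
proof (cases "a \<le> c")
  case True
  then show ?thesis using incr_product_le[OF p q, of b d l k] assms by (simp add: max_def)
next
  case False
  have "(\<integral>\<omega>. (p \<omega> * incr a b \<omega> $ l) * (q \<omega> * incr c d \<omega> $ k) \<partial>M) =
    (\<integral>\<omega>. (q \<omega> * incr c d \<omega> $ k) * (p \<omega> * incr a b \<omega> $ l) \<partial>M)" by (simp only: mult.commute)
  also have "\<dots> = (if k = l then max 0 (min d b - a) else 0) * (\<integral>\<omega>. q \<omega> * p \<omega> \<partial>M)"
    using assms False by (intro incr_product_le) auto
  also have "\<dots> = (if l = k then max 0 (min b d - max a c) else 0) * (\<integral>\<omega>. p \<omega> * q \<omega> \<partial>M)"
    using False by (cases "k = l") (auto simp: mult.commute[of "q _"] min.commute max_absorb1)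
  finally show ?thesis .
qed

lemma bounded_meas_entry:
  fixes \<xi> :: "(real \<Rightarrow> real^'d) \<Rightarrow> real^'d^'n"
  assumes "bounded_meas s \<xi>"
  shows "bounded_meas s (\<lambda>\<omega>. \<xi> \<omega> $ i $ l)"
  unfolding bounded_meas_def
proof
  have [measurable]: "\<xi> \<in> borel_measurable (F s)" using assms by (simp add: bounded_meas_def)
  have "continuous_on UNIV (\<lambda>A::real^'d^'n. A $ i $ l)" by (intro continuous_intros)
  from borel_measurable_continuous_onI[OF this] show "(\<lambda>\<omega>. \<xi> \<omega> $ i $ l) \<in> borel_measurable (F s)" by measurable
  from assms obtain B where "\<And>\<omega>. \<omega> \<in> space M \<Longrightarrow> norm (\<xi> \<omega>) \<le> B"
    by (auto simp: bounded_meas_def bounded_iff)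
  moreover have "norm (A $ i $ l) \<le> norm A" for A :: "real^'d^'n"
    using Finite_Cartesian_Product.norm_nth_le[of "A $ i" l] Finite_Cartesian_Product.norm_nth_le[of A i] by linarith
  ultimately show "bounded ((\<lambda>\<omega>. \<xi> \<omega> $ i $ l) ` space M)"
    unfolding bounded_iff by (auto intro!: exI[of _ B] intro: order_trans)
qed

text \<open>Expand both matrix-vector products; only equal columns of the two matrices survive.\<close>

lemma simple_term_product:
  fixes \<xi> \<zeta> :: "(real \<Rightarrow> real^'d) \<Rightarrow> real^'d^'n"
  assumes p: "bounded_meas a \<xi>" and q: "bounded_meas c \<zeta>"
    and ab: "0 \<le> a" "a \<le> b" "b \<le> T" and cd: "0 \<le> c" "c \<le> d" "d \<le> T"
  shows "(\<integral>\<omega>. (\<xi> \<omega> *v incr a b \<omega>) \<bullet> (\<zeta> \<omega> *v incr c d \<omega>) \<partial>M) =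
     max 0 (min b d - max a c) * (\<integral>\<omega>. \<xi> \<omega> \<bullet> \<zeta> \<omega> \<partial>M)"
proof -
  have aT: "a \<le> T" "c \<le> T" using assms by auto
  define f where "f i l k \<omega> = (\<xi> \<omega> $ i $ l * incr a b \<omega> $ l) * (\<zeta> \<omega> $ i $ k * incr c d \<omega> $ k)" for i l k \<omega>
  have I: "integrable M (f i l k)" for i l k
    unfolding f_def
    by (rule integrable_incr_product[OF bounded_meas_entry[OF p] aT(1) bounded_meas_entry[OF q] aT(2) ab cd])
  have iz: "integrable M (\<lambda>\<omega>. \<xi> \<omega> $ i $ l * \<zeta> \<omega> $ i $ l)" for i l
    using integrable_inner[OF bounded_meas_square_integrable[OF bounded_meas_entry[OF p] aT(1)]
        bounded_meas_square_integrable[OF bounded_meas_entry[OF q] aT(2)]] by simp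
  let ?m = "max 0 (min b d - max a c)"
  have "(\<integral>\<omega>. (\<xi> \<omega> *v incr a b \<omega>) \<bullet> (\<zeta> \<omega> *v incr c d \<omega>) \<partial>M) =
    (\<integral>\<omega>. (\<Sum>i\<in>UNIV. \<Sum>l\<in>UNIV. \<Sum>k\<in>UNIV. f i l k \<omega>) \<partial>M)"
    by (intro Bochner_Integration.integral_cong refl)
      (simp only: inner_vec_def[where 'b='n] matrix_vector_mul_component, 
       simp only: inner_vec_def inner_real_def sum_product f_def)
  also have "\<dots> = (\<Sum>i\<in>UNIV. \<Sum>l\<in>UNIV. \<Sum>k\<in>UNIV. \<integral>\<omega>. f i l k \<omega> \<partial>M)"
    by (simp add: Bochner_Integration.integral_sum I)
  also have "\<dots> = (\<Sum>i\<in>UNIV. \<Sum>l\<in>UNIV. \<Sum>k\<in>UNIV. (if l = k then ?m else 0) * (\<integral>\<omega>. \<xi> \<omega> $ i $ l * \<zeta> \<omega> $ i $ k \<partial>M))"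
    unfolding f_def by (intro sum.cong refl incr_product bounded_meas_entry p q ab cd)
  also have "\<dots> = (\<Sum>i\<in>UNIV. \<Sum>l\<in>UNIV. \<Sum>k\<in>UNIV. if l = k then ?m * (\<integral>\<omega>. \<xi> \<omega> $ i $ l * \<zeta> \<omega> $ i $ k \<partial>M) else 0)"
    by (intro sum.cong refl) auto
  also have "\<dots> = (\<Sum>i\<in>UNIV. \<Sum>l\<in>UNIV. ?m * (\<integral>\<omega>. \<xi> \<omega> $ i $ l * \<zeta> \<omega> $ i $ l \<partial>M))"
    by simp
  also have "\<dots> = ?m * (\<integral>\<omega>. (\<Sum>i\<in>UNIV. \<Sum>l\<in>UNIV. \<xi> \<omega> $ i $ l * \<zeta> \<omega> $ i $ l) \<partial>M)"
    using iz by (simp add: Bochner_Integration.integral_sum sum_distrib_left)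
  finally show ?thesis by (simp only: inner_vec_def inner_real_def)
qed

end

section \<open>Martingale property and isometry of the Ito integral\<close>

lemma borel_measurable_matrix_vector_mult [measurable (raw)]:
  fixes A :: "'a \<Rightarrow> real ^ 'd ^ 'n"
  assumes "A \<in> borel_measurable K" "x \<in> borel_measurable K"
  shows "(\<lambda>\<omega>. A \<omega> *v x \<omega>) \<in> borel_measurable K"
  by (rule borel_measurable_continuous_Pair[OF assms])
    (unfold matrix_vector_mult_def, intro continuous_intros)

context wiener_interval
begin

lemma simple_processD:
  assumes "simple_process M F t T k \<tau> \<xi>"
  shows "\<And>i. i \<le> k \<Longrightarrow> t \<le> \<tau> i" "\<And>i. i \<le> k \<Longrightarrow> \<tau> i \<le> T"
    and "\<And>i. i < k \<Longrightarrow> \<tau> i \<le> \<tau> (Suc i)" "\<And>i. i < k \<Longrightarrow> bounded_meas (\<tau> i) (\<xi> i)"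
proof -
  show inc: "\<tau> i \<le> \<tau> (Suc i)" if "i < k" for i using assms that by (auto simp: simple_process_def)
  show "bounded_meas (\<tau> i) (\<xi> i)" if "i < k" for i
    using assms that by (auto simp: simple_process_def bounded_meas_def)
  show "t \<le> \<tau> i" if "i \<le> k" for i using that
  proof (induction i)
    case 0
    then show ?case using assms by (simp add: simple_process_def)
  next
    case (Suc i)
    then show ?case using inc[of i] by linarith
  qed
  show "\<tau> i \<le> T" if "i \<le> k" for i using that
  proof (induction rule: inc_induct)
    case base
    then show ?case using assms by (simp add: simple_process_def)
  next
    case (step i)
    then show ?case using inc[of i] by linarith
  qed
qed

lemma simple_term_square_integrable:
  fixes \<xi> :: "(real \<Rightarrow> real^'d) \<Rightarrow> real^'d^'n"
  assumes "bounded_meas a \<xi>" "a \<le> T" "0 \<le> b" "b \<le> c" "c \<le> T"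
  shows "square_integrable M (\<lambda>\<omega>. \<xi> \<omega> *v incr b c \<omega>)"
proof -
  obtain B where B: "\<And>\<omega>. \<omega> \<in> space M \<Longrightarrow> norm (\<xi> \<omega>) \<le> B"
    using assms(1) by (auto simp: bounded_meas_def bounded_iff)
  have inc: "square_integrable M (incr b c)" using assms by (intro incr_square_integrable(2)) auto
  have [measurable]: "\<xi> \<in> borel_measurable M" "incr b c \<in> borel_measurable M"
    using assms F_measurable_M inc by (auto simp: bounded_meas_def square_integrable_def)
  have "norm (\<xi> \<omega> *v incr b c \<omega>) \<le> norm (B *\<^sub>R incr b c \<omega>)" if "\<omega> \<in> space M" for \<omega>
  proof -
    have "norm (\<xi> \<omega> *v incr b c \<omega>) \<le> norm (\<xi> \<omega>) * norm (incr b c \<omega>)"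
      by (rule norm_matrix_vector_mult_le)
    also have "\<dots> \<le> \<bar>B\<bar> * norm (incr b c \<omega>)"
      using B[OF that] by (intro mult_right_mono) auto
    finally show ?thesis by simp
  qed
  then show ?thesis
    by (intro square_integrable_bound[OF square_integrable_scaleR[OF inc, of B]]) auto
qed

lemma simple_integral_square_integrable:
  assumes "simple_process M F t T k \<tau> \<xi>" "s \<in> {t..T}"
  shows "square_integrable M (simple_integral W k \<tau> \<xi> s)"
  unfolding simple_integral_def
proof (rule square_integrable_sum)
  fix i assume "i \<in> {..<k}"
  then show "square_integrable M (\<lambda>\<omega>. \<xi> i \<omega> *v incr (min s (\<tau> i)) (min s (\<tau> (Suc i))) \<omega>)"
    using simple_processD[OF assms(1), of i] simple_processD(1,2)[OF assms(1), of "Suc i"] assms(2) t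
    by (intro simple_term_square_integrable[of "\<tau> i"]) auto
qed

text \<open>Each entry of \<open>\<eta>\<close> times each entry of \<open>\<xi>\<close> is an integrable weight
  known at time \<open>u\<close>, so each summand has mean zero.\<close>

lemma simple_term_orthogonal:
  fixes \<xi> :: "(real \<Rightarrow> real^'d) \<Rightarrow> real^'d^'n"
  assumes \<xi>: "bounded_meas u \<xi>" and "0 \<le> u" "u \<le> v" "v \<le> T"
    and \<eta>: "\<eta> \<in> borel_measurable (F u)" "square_integrable M \<eta>"
  shows "(\<integral>\<omega>. \<eta> \<omega> \<bullet> (\<xi> \<omega> *v incr u v \<omega>) \<partial>M) = 0"
proof -
  have uT: "u \<le> T" using assms by simp
  define q where "q i l \<omega> = \<eta> \<omega> $ i * \<xi> \<omega> $ i $ l" for i l \<omega>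
  have \<eta>i: "square_integrable M (\<lambda>\<omega>. \<eta> \<omega> $ i)" for i
    using borel_measurable_vec_component[OF square_integrable_measurable[OF \<eta>(2)]]
    by (intro square_integrable_bound[OF \<eta>(2)]) (auto simp: component_le_norm_cart)
  have m: "q i l \<in> borel_measurable (F u)" for i l
    using borel_measurable_times[OF borel_measurable_vec_component[OF \<eta>(1), of i], of "\<lambda>\<omega>. \<xi> \<omega> $ i $ l"]
      bounded_meas_entry[OF \<xi>, of i l] unfolding q_def[abs_def] bounded_meas_def by simp
  have qi: "integrable M (q i l)" for i l
    using square_integrable_integrable[OF square_integrable_bounded_mult[OF bounded_meas_entry[OF \<xi>] uT \<eta>i]]
    by (simp add: q_def[abs_def] mult.commute)
  note inc = incr_mean[OF assms(2,3,4) m qi]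
  have "(\<integral>\<omega>. \<eta> \<omega> \<bullet> (\<xi> \<omega> *v incr u v \<omega>) \<partial>M) = (\<integral>\<omega>. (\<Sum>i\<in>UNIV. \<Sum>l\<in>UNIV. q i l \<omega> * incr u v \<omega> $ l) \<partial>M)"
    by (intro Bochner_Integration.integral_cong refl)
      (simp only: inner_vec_def[where 'b='n] matrix_vector_mul_component,
       simp only: inner_vec_def inner_real_def q_def sum_distrib_left mult.assoc)
  also have "\<dots> = 0" by (simp add: Bochner_Integration.integral_sum inc)
  finally show ?thesis .
qed

text \<open>The difference of the integral at \<open>T\<close> and at \<open>s\<close> consists of the
  increments of the partition clipped to \<open>[s, T]\<close>, and each of them is orthogonal to
  the information at time \<open>s\<close>.\<close>

lemma simple_integral_martingale:
  assumes S: "simple_process M F t T k \<tau> (\<xi> :: nat \<Rightarrow> _ \<Rightarrow> real^'d^'n)" and s: "s \<in> {t..T}"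
    and \<eta>: "\<eta> \<in> borel_measurable (F s)" "square_integrable M \<eta>"
  shows "(\<integral>\<omega>. \<eta> \<omega> \<bullet> simple_integral W k \<tau> \<xi> T \<omega> \<partial>M) = (\<integral>\<omega>. \<eta> \<omega> \<bullet> simple_integral W k \<tau> \<xi> s \<omega> \<partial>M)"
proof -
  note D = simple_processD[OF S]
  have e: "simple_integral W k \<tau> \<xi> T \<omega> - simple_integral W k \<tau> \<xi> s \<omega> =
      (\<Sum>i<k. \<xi> i \<omega> *v incr (max s (\<tau> i)) (max s (\<tau> (Suc i))) \<omega>)" for \<omega>
  proof -
    have "incr (min T (\<tau> i)) (min T (\<tau> (Suc i))) \<omega> - incr (min s (\<tau> i)) (min s (\<tau> (Suc i))) \<omega>
       = incr (max s (\<tau> i)) (max s (\<tau> (Suc i))) \<omega>" if "i < k" for i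
      using D(2)[of i] D(2)[of "Suc i"] D(3)[of i] that by (auto simp: min_def max_def)
    then show ?thesis
      unfolding simple_integral_def sum_subtractf[symmetric]
      by (intro sum.cong refl) (simp add: matrix_vector_mult_diff_distrib[symmetric])
  qed
  have si: "square_integrable M (\<lambda>\<omega>. \<xi> i \<omega> *v incr (max s (\<tau> i)) (max s (\<tau> (Suc i))) \<omega>)" if "i < k" for i
    using D(1,2)[of i] D(2)[of "Suc i"] D(3,4)[of i] that s t
    by (intro simple_term_square_integrable[of "\<tau> i"]) auto
  have z: "(\<integral>\<omega>. \<eta> \<omega> \<bullet> (\<xi> i \<omega> *v incr (max s (\<tau> i)) (max s (\<tau> (Suc i))) \<omega>) \<partial>M) = 0" if "i < k" for i
    using D(1,2)[of i] D(2)[of "Suc i"] D(3)[of i] D(4)[of i] that s t \<eta>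
    by (intro simple_term_orthogonal bounded_meas_mono[OF D(4)] F_measurable_mono[OF \<eta>(1)]) auto
  have "(\<integral>\<omega>. \<eta> \<omega> \<bullet> simple_integral W k \<tau> \<xi> T \<omega> \<partial>M) - (\<integral>\<omega>. \<eta> \<omega> \<bullet> simple_integral W k \<tau> \<xi> s \<omega> \<partial>M)
     = (\<integral>\<omega>. \<eta> \<omega> \<bullet> simple_integral W k \<tau> \<xi> T \<omega> - \<eta> \<omega> \<bullet> simple_integral W k \<tau> \<xi> s \<omega> \<partial>M)"
    using s t by (intro Bochner_Integration.integral_diff[symmetric] integrable_inner \<eta>
      simple_integral_square_integrable[OF S]) auto
  also have "\<dots> = (\<integral>\<omega>. (\<Sum>i<k. \<eta> \<omega> \<bullet> (\<xi> i \<omega> *v incr (max s (\<tau> i)) (max s (\<tau> (Suc i))) \<omega>)) \<partial>M)"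
    unfolding inner_diff_right[symmetric] e inner_sum_right ..
  also have "\<dots> = 0"
    by (subst Bochner_Integration.integral_sum) (auto simp: z intro!: integrable_inner \<eta> si)
  finally show ?thesis by simp
qed

lemma integral_N_product:
  fixes a :: "real \<Rightarrow> real" and b :: "(real \<Rightarrow> real^'d) \<Rightarrow> real"
  assumes "integrable N (\<lambda>(s, \<omega>). a s * b \<omega>)"
  shows "(\<integral>(s, \<omega>). a s * b \<omega> \<partial>N) = (\<integral>s. a s \<partial>L) * (\<integral>\<omega>. b \<omega> \<partial>M)"
  unfolding LM.integral_fst[OF assms, symmetric]
  by (simp only: integral_mult_right_zero integral_mult_left_zero)

lemma simple_value_term_square_integrable:
  fixes \<xi> :: "(real \<Rightarrow> real^'d) \<Rightarrow> real^'d^'n"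
  assumes "bounded_meas a \<xi>" "a \<le> T" and A: "A \<in> sets borel"
  shows "square_integrable N (\<lambda>z. indicator A (fst z) *\<^sub>R \<xi> (snd z))"
proof -
  obtain B where B: "\<And>\<omega>. \<omega> \<in> space M \<Longrightarrow> norm (\<xi> \<omega>) \<le> B"
    using assms(1) by (auto simp: bounded_meas_def bounded_iff)
  have [measurable]: "\<xi> \<in> borel_measurable M"
    using assms F_measurable_M by (auto simp: bounded_meas_def)
  have [measurable]: "(\<lambda>s. indicator A s :: real) \<in> borel_measurable L"
    using A by (intro measurable_restrict_space1) simp
  show ?thesis
  proof (rule N.square_integrable_bounded[where B="\<bar>B\<bar>"])
    show "(\<lambda>z. indicator A (fst z) *\<^sub>R \<xi> (snd z)) \<in> borel_measurable N" by measurable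
    have "norm (indicator A s *\<^sub>R \<xi> \<omega>) \<le> \<bar>B\<bar>" if "\<omega> \<in> space M" for s \<omega>
      using B[OF that] by (auto simp: indicator_def)
    then show "AE z in N. norm (indicator A (fst z) *\<^sub>R \<xi> (snd z)) \<le> \<bar>B\<bar>"
      by (auto simp: space_pair_measure)
  qed
qed

lemma simple_value_square_integrable:
  assumes S: "simple_process M F t T k \<tau> (\<xi> :: nat \<Rightarrow> _ \<Rightarrow> real^'d^'n)"
  shows "square_integrable N (\<lambda>(s, \<omega>). simple_value k \<tau> \<xi> s \<omega>)"
proof -
  have "square_integrable N (\<lambda>z. \<Sum>i<k. indicator {\<tau> i<..\<tau> (Suc i)} (fst z) *\<^sub>R \<xi> i (snd z))"
    using simple_processD(2,4)[OF S]
    by (intro square_integrable_sum simple_value_term_square_integrable[where a="\<tau> _"]) auto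
  then show ?thesis by (simp add: simple_value_def split_beta')
qed

text \<open>Both sides are double sums over the two partitions, and by \<open>simple_term_product\<close> they
  agree term by term: the integral over time of a product of two indicators is the length of the
  overlap.\<close>

lemma simple_isometry:
  assumes S: "simple_process M F t T k \<tau> (\<xi> :: nat \<Rightarrow> _ \<Rightarrow> real^'d^'n)"
    and R: "simple_process M F t T m \<rho> (\<zeta> :: nat \<Rightarrow> _ \<Rightarrow> real^'d^'n)"
  shows "(\<integral>\<omega>. simple_integral W k \<tau> \<xi> T \<omega> \<bullet> simple_integral W m \<rho> \<zeta> T \<omega> \<partial>M) =
     (\<integral>(s, \<omega>). simple_value k \<tau> \<xi> s \<omega> \<bullet> simple_value m \<rho> \<zeta> s \<omega> \<partial>N)"
proof -
  note D = simple_processD[OF S] and E = simple_processD[OF R]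
  have eT: "simple_integral W k \<tau> \<xi> T \<omega> = (\<Sum>i<k. \<xi> i \<omega> *v incr (\<tau> i) (\<tau> (Suc i)) \<omega>)"
    "simple_integral W m \<rho> \<zeta> T \<omega> = (\<Sum>j<m. \<zeta> j \<omega> *v incr (\<rho> j) (\<rho> (Suc j)) \<omega>)" for \<omega>
    using D(2) E(2) unfolding simple_integral_def by (auto intro!: sum.cong simp: min_absorb2)
  let ?c = "\<lambda>i j. max 0 (min (\<tau> (Suc i)) (\<rho> (Suc j)) - max (\<tau> i) (\<rho> j))"
  let ?a = "\<lambda>i j s. indicator {\<tau> i<..\<tau> (Suc i)} s * indicator {\<rho> j<..\<rho> (Suc j)} s :: real"
  have b: "0 \<le> \<tau> i" "\<tau> i \<le> \<tau> (Suc i)" "\<tau> (Suc i) \<le> T" "\<tau> i \<le> T" "bounded_meas (\<tau> i) (\<xi> i)" if "i < k" for i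
    using D(1,2)[of i] D(2)[of "Suc i"] D(3,4)[of i] that t by auto
  have b': "0 \<le> \<rho> j" "\<rho> j \<le> \<rho> (Suc j)" "\<rho> (Suc j) \<le> T" "\<rho> j \<le> T" "bounded_meas (\<rho> j) (\<zeta> j)" if "j < m" for j
    using E(1,2)[of j] E(2)[of "Suc j"] E(3,4)[of j] that t by auto
  have IN: "integrable N (\<lambda>z. ?a i j (fst z) * (\<xi> i (snd z) \<bullet> \<zeta> j (snd z)))" if "i < k" "j < m" for i j
    using integrable_inner[OF simple_value_term_square_integrable[OF b(5)[OF that(1)] b(4)[OF that(1)]]
        simple_value_term_square_integrable[OF b'(5)[OF that(2)] b'(4)[OF that(2)]],
        of "{\<tau> i<..\<tau> (Suc i)}" "{\<rho> j<..\<rho> (Suc j)}"]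
    by (simp add: mult.assoc mult.left_commute)
  have "(\<integral>\<omega>. simple_integral W k \<tau> \<xi> T \<omega> \<bullet> simple_integral W m \<rho> \<zeta> T \<omega> \<partial>M) =
    (\<integral>\<omega>. (\<Sum>i<k. \<Sum>j<m. (\<xi> i \<omega> *v incr (\<tau> i) (\<tau> (Suc i)) \<omega>) \<bullet> (\<zeta> j \<omega> *v incr (\<rho> j) (\<rho> (Suc j)) \<omega>)) \<partial>M)"
    unfolding eT by (simp only: inner_sum_left, simp only: inner_sum_right)
  also have "\<dots> = (\<Sum>i<k. \<Sum>j<m. \<integral>\<omega>. (\<xi> i \<omega> *v incr (\<tau> i) (\<tau> (Suc i)) \<omega>) \<bullet> (\<zeta> j \<omega> *v incr (\<rho> j) (\<rho> (Suc j)) \<omega>) \<partial>M)"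
  proof -
    have I: "integrable M (\<lambda>\<omega>. (\<xi> i \<omega> *v incr (\<tau> i) (\<tau> (Suc i)) \<omega>) \<bullet> (\<zeta> j \<omega> *v incr (\<rho> j) (\<rho> (Suc j)) \<omega>))"
      if "i < k" "j < m" for i j
      by (rule integrable_inner[OF simple_term_square_integrable[OF b(5) b(4,1,2,3)]
            simple_term_square_integrable[OF b'(5) b'(4,1,2,3)]]) (use that in auto)
    show ?thesis
      by (subst Bochner_Integration.integral_sum) (auto intro!: Bochner_Integration.integrable_sum I
          sum.cong Bochner_Integration.integral_sum)
  qed
  also have "\<dots> = (\<Sum>i<k. \<Sum>j<m. ?c i j * (\<integral>\<omega>. \<xi> i \<omega> \<bullet> \<zeta> j \<omega> \<partial>M))"
    by (intro sum.cong refl simple_term_product b b') auto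
  also have "\<dots> = (\<Sum>i<k. \<Sum>j<m. \<integral>(s, \<omega>). ?a i j s * (\<xi> i \<omega> \<bullet> \<zeta> j \<omega>) \<partial>N)"
  proof (intro sum.cong refl)
    fix i j assume ij: "i \<in> {..<k}" "j \<in> {..<m}"
    have "(\<integral>s. ?a i j s \<partial>L) = (\<integral>s. indicator {max (\<tau> i) (\<rho> j)<..min (\<tau> (Suc i)) (\<rho> (Suc j))} s \<partial>lborel)"
    proof -
      have "indicator {t..T} s *\<^sub>R ?a i j s = indicator {max (\<tau> i) (\<rho> j)<..min (\<tau> (Suc i)) (\<rho> (Suc j))} s" for s
        using D(1)[of i] D(2)[of "Suc i"] ij by (auto simp: indicator_def)
      then show ?thesis by (subst integral_restrict_space) simp_all
    qed
    also have "\<dots> = ?c i j"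
    proof -
      have "measure lborel {u<..v} = max 0 (v - u)" for u v :: real by (cases "u \<le> v") auto
      then show ?thesis by simp
    qed
    finally have c: "(\<integral>s. ?a i j s \<partial>L) = ?c i j" .
    have "integrable N (\<lambda>(s, \<omega>). ?a i j s * (\<xi> i \<omega> \<bullet> \<zeta> j \<omega>))"
      using IN[of i j] ij by (simp add: split_beta')
    from integral_N_product[OF this]
    show "?c i j * (\<integral>\<omega>. \<xi> i \<omega> \<bullet> \<zeta> j \<omega> \<partial>M) = (\<integral>(s, \<omega>). ?a i j s * (\<xi> i \<omega> \<bullet> \<zeta> j \<omega>) \<partial>N)"
      using c by simp
  qed
  also have "\<dots> = (\<integral>(s, \<omega>). simple_value k \<tau> \<xi> s \<omega> \<bullet> simple_value m \<rho> \<zeta> s \<omega> \<partial>N)"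
  proof -
    have "(\<integral>(s, \<omega>). simple_value k \<tau> \<xi> s \<omega> \<bullet> simple_value m \<rho> \<zeta> s \<omega> \<partial>N) =
       (\<integral>z. (\<Sum>i<k. \<Sum>j<m. ?a i j (fst z) * (\<xi> i (snd z) \<bullet> \<zeta> j (snd z))) \<partial>N)"
      unfolding simple_value_def split_beta'
      by (simp only: inner_sum_left, simp only: inner_sum_right) (simp add: mult.assoc mult.left_commute)
    also have "\<dots> = (\<Sum>i<k. \<Sum>j<m. \<integral>z. ?a i j (fst z) * (\<xi> i (snd z) \<bullet> \<zeta> j (snd z)) \<partial>N)"
      by (subst Bochner_Integration.integral_sum) (auto intro!: Bochner_Integration.integrable_sum IN
          sum.cong Bochner_Integration.integral_sum)
    finally show ?thesis by (simp only: split_beta')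
  qed
  finally show ?thesis .
qed

text \<open>Orthogonality of \<open>I T - I s\<close> to all square-integrable variables known at time
  \<open>s\<close> is the martingale property in the form in which it is used: paired with a test
  variable, without conditional expectations.\<close>

definition L2_martingale :: "(real \<Rightarrow> (real \<Rightarrow> real^'d) \<Rightarrow> real^'n) \<Rightarrow> bool" where
  "L2_martingale I \<longleftrightarrow>
     (\<forall>s\<in>{t..T}. I s \<in> borel_measurable (F s) \<and> square_integrable M (I s)) \<and>
     (AE \<omega> in M. I t \<omega> = 0) \<and>
     (\<forall>s\<in>{t..T}. \<forall>\<eta>. \<eta> \<in> borel_measurable (F s) \<and> square_integrable M \<eta> \<longrightarrow>
        (\<integral>\<omega>. \<eta> \<omega> \<bullet> I T \<omega> \<partial>M) = (\<integral>\<omega>. \<eta> \<omega> \<bullet> I s \<omega> \<partial>M))"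

lemma L2_martingale_scaleR:
  "L2_martingale I \<Longrightarrow> L2_martingale (\<lambda>s \<omega>. c *\<^sub>R I s \<omega>)"
  by (auto simp: L2_martingale_def square_integrable_scaleR)

lemma square_integrable_L2_limit:
  assumes u: "u \<in> borel_measurable K" and um: "\<And>m. square_integrable K (u' m)"
    and lim: "(\<lambda>m. \<integral>\<^sup>+x. ennreal ((norm (u x - u' m x))\<^sup>2) \<partial>K) \<longlonglongrightarrow> 0"
  shows "square_integrable K u"
proof -
  have "eventually (\<lambda>m. (\<integral>\<^sup>+x. ennreal ((norm (u x - u' m x))\<^sup>2) \<partial>K) < 1) sequentially"
    by (rule order_tendstoD(2)[OF lim]) simp
  then obtain m where "(\<integral>\<^sup>+x. ennreal ((norm (u x - u' m x))\<^sup>2) \<partial>K) < 1"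
    by (auto simp: eventually_sequentially)
  then have "(\<integral>\<^sup>+x. ennreal ((norm (u x - u' m x))\<^sup>2) \<partial>K) < \<infinity>"
    by (rule order_less_trans) simp
  then have "square_integrable K (\<lambda>x. u x - u' m x)"
    using u square_integrable_measurable[OF um[of m]] by (simp add: square_integrable_nn)
  from square_integrable_add[OF this um[of m]] show ?thesis by simp
qed

lemma ito_integral_square_integrable:
  assumes I: "has_ito_integral M F W t T (H :: _ \<Rightarrow> _ \<Rightarrow> real^'d^'n) I" and s: "s \<in> {t..T}"
  shows "square_integrable M (I s)"
proof -
  from I obtain k \<tau> \<xi> where S: "\<And>m. simple_process M F t T (k m) (\<tau> m) (\<xi> m)"
    and c: "\<And>s. s \<in> {t..T} \<Longrightarrow> (\<lambda>m. \<integral>\<^sup>+\<omega>. ennreal ((norm (I s \<omega> - simple_integral W (k m) (\<tau> m) (\<xi> m) s \<omega>))\<^sup>2) \<partial>M) \<longlonglongrightarrow> 0"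
    unfolding has_ito_integral_def by blast
  have "I s \<in> borel_measurable M"
    using I s F_measurable_M[of "I s" s] unfolding has_ito_integral_def by auto
  from square_integrable_L2_limit[OF this simple_integral_square_integrable[OF S s] c[OF s]]
  show ?thesis .
qed

text \<open>Orthogonality and the initial value \<open>0\<close> hold for the simple integrals and survive the
  \<open>L\<^sup>2\<close>-limit.\<close>

lemma ito_integral_martingale:
  assumes I: "has_ito_integral M F W t T (H :: _ \<Rightarrow> _ \<Rightarrow> real^'d^'n) I"
  shows "L2_martingale I"
  unfolding L2_martingale_def
proof (intro conjI ballI allI impI)
  from I obtain k \<tau> \<xi> where S: "\<And>m. simple_process M F t T (k m) (\<tau> m) (\<xi> m)"
    and c: "\<And>s. s \<in> {t..T} \<Longrightarrow> (\<lambda>m. \<integral>\<^sup>+\<omega>. ennreal ((norm (I s \<omega> - simple_integral W (k m) (\<tau> m) (\<xi> m) s \<omega>))\<^sup>2) \<partial>M) \<longlonglongrightarrow> 0"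
    unfolding has_ito_integral_def by blast
  note sq = ito_integral_square_integrable[OF I]
  have T: "T \<in> {t..T}" using t by simp
  {
    fix s assume s: "s \<in> {t..T}"
    show "I s \<in> borel_measurable (F s)" using I s unfolding has_ito_integral_def by auto
    show "square_integrable M (I s)" by (rule sq[OF s])
    fix \<eta> :: "_ \<Rightarrow> real^'n"
    assume "\<eta> \<in> borel_measurable (F s) \<and> square_integrable M \<eta>"
    then have \<eta>: "\<eta> \<in> borel_measurable (F s)" "square_integrable M \<eta>" by auto
    have "(\<lambda>m. \<integral>\<omega>. \<eta> \<omega> \<bullet> simple_integral W (k m) (\<tau> m) (\<xi> m) r \<omega> \<partial>M) \<longlonglongrightarrow> (\<integral>\<omega>. \<eta> \<omega> \<bullet> I r \<omega> \<partial>M)"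
      if r: "r \<in> {t..T}" for r
      using tendsto_integral_inner[OF \<eta>(2) sq[OF r] \<eta>(2) simple_integral_square_integrable[OF S r] _ c[OF r]]
      by simp
    from this[OF T] this[OF s] show "(\<integral>\<omega>. \<eta> \<omega> \<bullet> I T \<omega> \<partial>M) = (\<integral>\<omega>. \<eta> \<omega> \<bullet> I s \<omega> \<partial>M)"
      unfolding simple_integral_martingale[OF S s \<eta>] by (rule LIMSEQ_unique)
  }
  have tt: "t \<in> {t..T}" using t by simp
  have "simple_integral W (k m) (\<tau> m) (\<xi> m) t \<omega> = 0" for m \<omega>
    unfolding simple_integral_def
    by (rule sum.neutral) (use simple_processD(1)[OF S[of m]] in \<open>auto simp: min_absorb1\<close>)
  with c[OF tt] have "(\<integral>\<^sup>+\<omega>. ennreal ((norm (I t \<omega>))\<^sup>2) \<partial>M) = 0"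
    using LIMSEQ_const_iff by fastforce
  then show "AE \<omega> in M. I t \<omega> = 0"
    using square_integrable_measurable[OF sq[OF tt]] by (subst (asm) nn_integral_0_iff_AE) auto
qed

text \<open>Polarised isometry: pass to the limit in \<open>simple_isometry\<close> along approximating
  sequences for both integrands.\<close>

lemma ito_isometry:
  assumes I: "has_ito_integral M F W t T (H :: _ \<Rightarrow> _ \<Rightarrow> real^'d^'n) I"
    and J: "has_ito_integral M F W t T (K :: _ \<Rightarrow> _ \<Rightarrow> real^'d^'n) J"
  shows "(\<integral>\<omega>. I T \<omega> \<bullet> J T \<omega> \<partial>M) = (\<integral>(s, \<omega>). H s \<omega> \<bullet> K s \<omega> \<partial>N)"
proof -
  have T: "T \<in> {t..T}" using t by simp
  have ap: "\<exists>k \<tau> \<xi>. (\<forall>m. simple_process M F t T (k m) (\<tau> m) (\<xi> m)) \<and>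
      (\<lambda>m. \<integral>\<^sup>+z. ennreal ((norm ((\<lambda>(s, \<omega>). H s \<omega>) z - (\<lambda>(s, \<omega>). simple_value (k m) (\<tau> m) (\<xi> m) s \<omega>) z))\<^sup>2) \<partial>N) \<longlonglongrightarrow> 0 \<and>
      (\<lambda>m. \<integral>\<^sup>+\<omega>. ennreal ((norm (I T \<omega> - simple_integral W (k m) (\<tau> m) (\<xi> m) T \<omega>))\<^sup>2) \<partial>M) \<longlonglongrightarrow> 0"
    if I: "has_ito_integral M F W t T (H :: _ \<Rightarrow> _ \<Rightarrow> real^'d^'n) I" for H I
  proof -
    from I obtain k \<tau> \<xi> where S: "\<And>m. simple_process M F t T (k m) (\<tau> m) (\<xi> m)"
      and c1: "(\<lambda>m. \<integral>\<^sup>+\<omega>. (\<integral>\<^sup>+s\<in>{t..T}.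
            ennreal ((norm (H s \<omega> - simple_value (k m) (\<tau> m) (\<xi> m) s \<omega>))\<^sup>2) \<partial>lborel) \<partial>M) \<longlonglongrightarrow> 0"
      and c: "(\<lambda>m. \<integral>\<^sup>+\<omega>. ennreal ((norm (I T \<omega> - simple_integral W (k m) (\<tau> m) (\<xi> m) T \<omega>))\<^sup>2) \<partial>M) \<longlonglongrightarrow> 0"
      using T unfolding has_ito_integral_def by blast
    have "H \<in> M2 M F t T" using I by (simp add: has_ito_integral_def)
    note H = square_integrable_measurable[OF M2_square_integrable[OF this]]
    have "(\<integral>\<^sup>+\<omega>. (\<integral>\<^sup>+s\<in>{t..T}. ennreal ((norm (H s \<omega> - simple_value (k m) (\<tau> m) (\<xi> m) s \<omega>))\<^sup>2) \<partial>lborel) \<partial>M) =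
       (\<integral>\<^sup>+z. ennreal ((norm ((\<lambda>(s, \<omega>). H s \<omega>) z - (\<lambda>(s, \<omega>). simple_value (k m) (\<tau> m) (\<xi> m) s \<omega>) z))\<^sup>2) \<partial>N)" for m
    proof -
      note V = square_integrable_measurable[OF simple_value_square_integrable[OF S[of m]]]
      have "(\<lambda>z. ennreal ((norm ((\<lambda>(s, \<omega>). H s \<omega>) z - (\<lambda>(s, \<omega>). simple_value (k m) (\<tau> m) (\<xi> m) s \<omega>) z))\<^sup>2)) \<in> borel_measurable N"
        using H V by measurable
      from nn_integral_N[OF this] show ?thesis by simp
    qed
    with c1 have "(\<lambda>m. \<integral>\<^sup>+z. ennreal ((norm ((\<lambda>(s, \<omega>). H s \<omega>) z - (\<lambda>(s, \<omega>). simple_value (k m) (\<tau> m) (\<xi> m) s \<omega>) z))\<^sup>2) \<partial>N) \<longlonglongrightarrow> 0"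
      by (simp only:)
    with S c show ?thesis by blast
  qed
  from ap[OF I] obtain k \<tau> \<xi> where S: "\<And>m. simple_process M F t T (k m) (\<tau> m) (\<xi> m)"
    and c1: "(\<lambda>m. \<integral>\<^sup>+z. ennreal ((norm ((\<lambda>(s, \<omega>). H s \<omega>) z - (\<lambda>(s, \<omega>). simple_value (k m) (\<tau> m) (\<xi> m) s \<omega>) z))\<^sup>2) \<partial>N) \<longlonglongrightarrow> 0"
    and c2: "(\<lambda>m. \<integral>\<^sup>+\<omega>. ennreal ((norm (I T \<omega> - simple_integral W (k m) (\<tau> m) (\<xi> m) T \<omega>))\<^sup>2) \<partial>M) \<longlonglongrightarrow> 0"
    by blast
  from ap[OF J] obtain l \<rho> \<zeta> where R: "\<And>m. simple_process M F t T (l m) (\<rho> m) (\<zeta> m)"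
    and d1: "(\<lambda>m. \<integral>\<^sup>+z. ennreal ((norm ((\<lambda>(s, \<omega>). K s \<omega>) z - (\<lambda>(s, \<omega>). simple_value (l m) (\<rho> m) (\<zeta> m) s \<omega>) z))\<^sup>2) \<partial>N) \<longlonglongrightarrow> 0"
    and d2: "(\<lambda>m. \<integral>\<^sup>+\<omega>. ennreal ((norm (J T \<omega> - simple_integral W (l m) (\<rho> m) (\<zeta> m) T \<omega>))\<^sup>2) \<partial>M) \<longlonglongrightarrow> 0"
    by blast
  have "H \<in> M2 M F t T" "K \<in> M2 M F t T" using I J by (auto simp: has_ito_integral_def)
  note H = M2_square_integrable[OF this(1)] and K = M2_square_integrable[OF this(2)]
  have 1: "(\<lambda>m. \<integral>\<omega>. simple_integral W (k m) (\<tau> m) (\<xi> m) T \<omega> \<bullet> simple_integral W (l m) (\<rho> m) (\<zeta> m) T \<omega> \<partial>M)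
     \<longlonglongrightarrow> (\<integral>\<omega>. I T \<omega> \<bullet> J T \<omega> \<partial>M)"
    by (rule tendsto_integral_inner[OF ito_integral_square_integrable[OF I T] ito_integral_square_integrable[OF J T]
          simple_integral_square_integrable[OF S T] simple_integral_square_integrable[OF R T] c2 d2])
  have 2: "(\<lambda>m. \<integral>z. (\<lambda>(s, \<omega>). simple_value (k m) (\<tau> m) (\<xi> m) s \<omega>) z \<bullet> (\<lambda>(s, \<omega>). simple_value (l m) (\<rho> m) (\<zeta> m) s \<omega>) z \<partial>N)
     \<longlonglongrightarrow> (\<integral>z. (\<lambda>(s, \<omega>). H s \<omega>) z \<bullet> (\<lambda>(s, \<omega>). K s \<omega>) z \<partial>N)"
    by (rule tendsto_integral_inner[OF H K simple_value_square_integrable[OF S]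
          simple_value_square_integrable[OF R] c1 d1])
  have "(\<integral>\<omega>. I T \<omega> \<bullet> J T \<omega> \<partial>M) = (\<integral>z. (\<lambda>(s, \<omega>). H s \<omega>) z \<bullet> (\<lambda>(s, \<omega>). K s \<omega>) z \<partial>N)"
    by (rule LIMSEQ_unique[OF 1]) (use 2 in \<open>simp only: simple_isometry[OF S R] split_beta'\<close>)
  then show ?thesis by (simp add: split_beta')
qed

end

section \<open>The maximal inequality\<close>

context wiener_interval
begin

lemma L2_martingaleD:
  assumes "L2_martingale I"
  shows "s \<in> {t..T} \<Longrightarrow> I s \<in> borel_measurable (F s)" "s \<in> {t..T} \<Longrightarrow> square_integrable M (I s)"
    "AE \<omega> in M. I t \<omega> = 0"
    "s \<in> {t..T} \<Longrightarrow> \<eta> \<in> borel_measurable (F s) \<Longrightarrow> square_integrable M \<eta> \<Longrightarrow>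
        (\<integral>\<omega>. \<eta> \<omega> \<bullet> I T \<omega> \<partial>M) = (\<integral>\<omega>. \<eta> \<omega> \<bullet> I s \<omega> \<partial>M)"
proof -
  note A = assms[unfolded L2_martingale_def]
  note a = conjunct1[OF A] and b = conjunct1[OF conjunct2[OF A]] and c = conjunct2[OF conjunct2[OF A]]
  show "s \<in> {t..T} \<Longrightarrow> I s \<in> borel_measurable (F s)" "s \<in> {t..T} \<Longrightarrow> square_integrable M (I s)"
    by (rule conjunct1[OF bspec[OF a]] conjunct2[OF bspec[OF a]]; assumption)+
  show "AE \<omega> in M. I t \<omega> = 0" by (rule b)
  show "s \<in> {t..T} \<Longrightarrow> \<eta> \<in> borel_measurable (F s) \<Longrightarrow> square_integrable M \<eta> \<Longrightarrow>
        (\<integral>\<omega>. \<eta> \<omega> \<bullet> I T \<omega> \<partial>M) = (\<integral>\<omega>. \<eta> \<omega> \<bullet> I s \<omega> \<partial>M)"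
    using c[rule_format, of s \<eta>] by simp
qed

text \<open>Kolmogorov's argument. On the event that \<open>s\<close> is the first time in \<open>S\<close> with
  \<open>norm (I s) > \<mu>\<close>, orthogonality of the increment \<open>I T - I s\<close> shows
  that the second moment of \<open>I T\<close> is at least that of \<open>I s\<close>, hence at
  least \<open>\<mu>\<^sup>2\<close> times the probability of the event. These events are disjoint.\<close>

lemma maximal_inequality_finite:
  fixes I :: "real \<Rightarrow> (real \<Rightarrow> real^'d) \<Rightarrow> real^'n"
  assumes I: "L2_martingale I" and S: "finite S" "S \<subseteq> {t..T}" and \<mu>: "\<mu> > 0"
  shows "{\<omega> \<in> space M. \<exists>s\<in>S. norm (I s \<omega>) > \<mu>} \<in> sets M"
    and "prob {\<omega> \<in> space M. \<exists>s\<in>S. norm (I s \<omega>) > \<mu>} \<le> (\<integral>\<omega>. (norm (I T \<omega>))\<^sup>2 \<partial>M) / \<mu>\<^sup>2"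
proof -
  note D = L2_martingaleD[OF I]
  let ?U = "{\<omega> \<in> space M. \<exists>s\<in>S. norm (I s \<omega>) > \<mu>}"
  \<comment> \<open>\<open>A s\<close>: the threshold is exceeded at \<open>s\<close> for the first time in \<open>S\<close>.\<close>
  define A where "A s = {\<omega> \<in> space M. norm (I s \<omega>) > \<mu> \<and> (\<forall>r\<in>{r\<in>S. r < s}. norm (I r \<omega>) \<le> \<mu>)}" for s
  have AF: "A s \<in> sets (F s)" if "s \<in> S" for s
  proof -
    have m: "I r \<in> borel_measurable (F s)" if "r \<in> S" "r \<le> s" for r
      using D(1)[of r] F_measurable_mono[of "I r" r s] that S(2) by blast
    have [measurable]: "I s \<in> borel_measurable (F s)" using m that by auto
    have "{\<omega> \<in> space (F s). norm (I r \<omega>) \<le> \<mu>} \<in> sets (F s)" if "r \<in> {r\<in>S. r < s}" for r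
    proof -
      have [measurable]: "I r \<in> borel_measurable (F s)" using m that by auto
      show ?thesis by measurable
    qed
    then have "{\<omega> \<in> space (F s). \<forall>r\<in>{r\<in>S. r < s}. norm (I r \<omega>) \<le> \<mu>} \<in> sets (F s)"
      by (rule sets.sets_Collect_finite_All) (use S in auto)
    moreover have "{\<omega> \<in> space (F s). norm (I s \<omega>) > \<mu>} \<in> sets (F s)" by measurable
    ultimately have "{\<omega> \<in> space (F s). norm (I s \<omega>) > \<mu>} \<inter>
        {\<omega> \<in> space (F s). \<forall>r\<in>{r\<in>S. r < s}. norm (I r \<omega>) \<le> \<mu>} \<in> sets (F s)"
      by (rule sets.Int[rotated])
    also have "{\<omega> \<in> space (F s). norm (I s \<omega>) > \<mu>} \<inter>
        {\<omega> \<in> space (F s). \<forall>r\<in>{r\<in>S. r < s}. norm (I r \<omega>) \<le> \<mu>} = A s"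
      by (auto simp: A_def)
    finally show ?thesis .
  qed
  have AM: "A s \<in> sets M" if "s \<in> S" for s using AF[OF that] F_sub[of s] subsetD[OF S(2) that] by auto
  have UA: "?U = (\<Union>s\<in>S. A s)"
  proof (intro set_eqI iffI)
    fix \<omega> assume "\<omega> \<in> ?U"
    then have w: "\<omega> \<in> space M" and ne: "{s\<in>S. norm (I s \<omega>) > \<mu>} \<noteq> {}" by auto
    let ?s = "Min {s\<in>S. norm (I s \<omega>) > \<mu>}"
    have fin: "finite {s\<in>S. norm (I s \<omega>) > \<mu>}" using S by auto
    have s: "?s \<in> {s\<in>S. norm (I s \<omega>) > \<mu>}" using Min_in[OF fin ne] .
    have "norm (I r \<omega>) \<le> \<mu>" if "r \<in> S" "r < ?s" for r
    proof (rule ccontr)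
      assume "\<not> norm (I r \<omega>) \<le> \<mu>"
      then have "?s \<le> r" using that by (intro Min_le[OF fin]) auto
      with that show False by simp
    qed
    then have "\<omega> \<in> A ?s" using w s by (auto simp: A_def)
    with s show "\<omega> \<in> (\<Union>s\<in>S. A s)" by blast
  qed (auto simp: A_def)
  show U: "?U \<in> sets M" unfolding UA using S AM by auto
  have disj: "disjoint_family_on A S"
    unfolding disjoint_family_on_def
  proof (intro ballI impI)
    fix r s assume rs: "r \<in> S" "s \<in> S" "r \<noteq> s"
    then consider "r < s" | "s < r" by linarith
    then show "A r \<inter> A s = {}" using rs by cases (fastforce simp: A_def)+
  qed
  have T: "T \<in> {t..T}" using t by simp
  note IT = D(2)[OF T]
  have step: "\<mu>\<^sup>2 * prob (A s) \<le> (\<integral>\<omega>. indicator (A s) \<omega> * (norm (I T \<omega>))\<^sup>2 \<partial>M)" if "s \<in> S" for s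
  proof -
    have s: "s \<in> {t..T}" using S that by auto
    define \<eta> where "\<eta> \<omega> = indicat_real (A s) \<omega> *\<^sub>R I s \<omega>" for \<omega>
    have \<eta>F: "\<eta> \<in> borel_measurable (F s)"
      unfolding \<eta>_def[abs_def] using AF[OF that] D(1)[OF s] by measurable
    have [measurable]: "A s \<in> sets M" using AM that by auto
    have \<eta>M: "\<eta> \<in> borel_measurable M" using F_measurable_M[OF \<eta>F] s by auto
    have \<eta>: "square_integrable M \<eta>"
      by (rule square_integrable_bound[OF D(2)[OF s] \<eta>M]) (auto simp: \<eta>_def indicator_def)
    define \<theta> where "\<theta> \<omega> = indicat_real (A s) \<omega> *\<^sub>R I T \<omega>" for \<omega>
    have [measurable]: "I T \<in> borel_measurable M" using IT by (simp add: square_integrable_def)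
    have \<theta>: "square_integrable M \<theta>"
      by (rule square_integrable_bound[OF IT]) (auto simp: \<theta>_def[abs_def] indicator_def)
    have i: "(\<integral>\<omega>. \<eta> \<omega> \<bullet> \<theta> \<omega> \<partial>M) = (\<integral>\<omega>. \<eta> \<omega> \<bullet> \<eta> \<omega> \<partial>M)"
    proof -
      have "(\<integral>\<omega>. \<eta> \<omega> \<bullet> \<theta> \<omega> \<partial>M) = (\<integral>\<omega>. \<eta> \<omega> \<bullet> I T \<omega> \<partial>M)"
        by (intro Bochner_Integration.integral_cong) (auto simp: \<eta>_def \<theta>_def indicator_def)
      also have "\<dots> = (\<integral>\<omega>. \<eta> \<omega> \<bullet> I s \<omega> \<partial>M)" by (rule D(4)[OF s \<eta>F \<eta>])
      also have "\<dots> = (\<integral>\<omega>. \<eta> \<omega> \<bullet> \<eta> \<omega> \<partial>M)"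
        by (intro Bochner_Integration.integral_cong) (auto simp: \<eta>_def indicator_def)
      finally show ?thesis .
    qed
    have "0 \<le> (\<integral>\<omega>. (\<theta> \<omega> - \<eta> \<omega>) \<bullet> (\<theta> \<omega> - \<eta> \<omega>) \<partial>M)" by simp
    also have "\<dots> = (\<integral>\<omega>. \<theta> \<omega> \<bullet> \<theta> \<omega> - 2 * (\<eta> \<omega> \<bullet> \<theta> \<omega>) + \<eta> \<omega> \<bullet> \<eta> \<omega> \<partial>M)"
      by (intro Bochner_Integration.integral_cong) (auto simp: inner_diff inner_commute)
    also have "\<dots> = (\<integral>\<omega>. \<theta> \<omega> \<bullet> \<theta> \<omega> \<partial>M) - 2 * (\<integral>\<omega>. \<eta> \<omega> \<bullet> \<theta> \<omega> \<partial>M) + (\<integral>\<omega>. \<eta> \<omega> \<bullet> \<eta> \<omega> \<partial>M)"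
      using integrable_inner[OF \<theta> \<theta>] integrable_inner[OF \<eta> \<theta>] integrable_inner[OF \<eta> \<eta>] by simp
    finally have le: "(\<integral>\<omega>. \<eta> \<omega> \<bullet> \<eta> \<omega> \<partial>M) \<le> (\<integral>\<omega>. \<theta> \<omega> \<bullet> \<theta> \<omega> \<partial>M)" using i by simp
    have "\<mu>\<^sup>2 * prob (A s) = (\<integral>\<omega>. \<mu>\<^sup>2 * indicator (A s) \<omega> \<partial>M)" by simp
    also have "\<dots> \<le> (\<integral>\<omega>. \<eta> \<omega> \<bullet> \<eta> \<omega> \<partial>M)"
    proof (intro integral_mono integrable_inner \<eta>)
      show "integrable M (\<lambda>\<omega>. \<mu>\<^sup>2 * indicat_real (A s) \<omega>)"
        by (rule integrable_const_bound[where B="\<mu>\<^sup>2"]) (auto simp: indicator_def)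
      fix \<omega> assume "\<omega> \<in> space M"
      show "\<mu>\<^sup>2 * indicat_real (A s) \<omega> \<le> \<eta> \<omega> \<bullet> \<eta> \<omega>"
      proof (cases "\<omega> \<in> A s")
        case True
        then have "\<mu> \<le> norm (I s \<omega>)" by (auto simp: A_def)
        then have "\<mu>\<^sup>2 \<le> (norm (I s \<omega>))\<^sup>2" using \<mu> by (intro power_mono) auto
        then show ?thesis using True by (simp add: \<eta>_def power2_norm_eq_inner)
      qed (simp add: \<eta>_def)
    qed
    also note le
    also have "(\<integral>\<omega>. \<theta> \<omega> \<bullet> \<theta> \<omega> \<partial>M) = (\<integral>\<omega>. indicator (A s) \<omega> * (norm (I T \<omega>))\<^sup>2 \<partial>M)"
      by (intro Bochner_Integration.integral_cong) (auto simp: \<theta>_def indicator_def power2_norm_eq_inner)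
    finally show ?thesis .
  qed
  have [measurable]: "\<And>s. s \<in> S \<Longrightarrow> A s \<in> sets M" by fact
  have i: "integrable M (\<lambda>\<omega>. indicat_real (A s) \<omega> * (norm (I T \<omega>))\<^sup>2)" if "s \<in> S" for s
    using integrable_mult_indicator[OF AM[OF that] square_integrable_norm[OF IT]] by simp
  have "\<mu>\<^sup>2 * prob ?U = (\<Sum>s\<in>S. \<mu>\<^sup>2 * prob (A s))"
    unfolding UA using S AM disj by (subst finite_measure_finite_Union) (auto simp: sum_distrib_left)
  also have "\<dots> \<le> (\<Sum>s\<in>S. \<integral>\<omega>. indicator (A s) \<omega> * (norm (I T \<omega>))\<^sup>2 \<partial>M)"
    by (intro sum_mono step)
  also have "\<dots> = (\<integral>\<omega>. (\<Sum>s\<in>S. indicator (A s) \<omega> * (norm (I T \<omega>))\<^sup>2) \<partial>M)"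
    by (subst Bochner_Integration.integral_sum) (auto simp: i)
  also have "\<dots> = (\<integral>\<omega>. indicator ?U \<omega> * (norm (I T \<omega>))\<^sup>2 \<partial>M)"
    unfolding UA sum_distrib_right[symmetric] indicator_UN_disjoint[OF S(1) disj] ..
  also have "\<dots> \<le> (\<integral>\<omega>. (norm (I T \<omega>))\<^sup>2 \<partial>M)"
  proof (rule integral_mono)
    show "integrable M (\<lambda>\<omega>. indicat_real ?U \<omega> * (norm (I T \<omega>))\<^sup>2)"
      using integrable_mult_indicator[OF U square_integrable_norm[OF IT]] by simp
  qed (use IT in \<open>auto simp: square_integrable_norm indicator_def\<close>)
  finally show "prob ?U \<le> (\<integral>\<omega>. (norm (I T \<omega>))\<^sup>2 \<partial>M) / \<mu>\<^sup>2" using \<mu> by (simp add: field_simps)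
qed

text \<open>Continuous paths exceed \<open>\<mu>\<close> somewhere on \<open>[t, T]\<close> only if they do so
  on a countable dense set, which is exhausted by finite sets. The bound is stated for a measurable
  superset \<open>E\<close> because the supremum is an uncountable one.\<close>

lemma maximal_inequality:
  fixes I :: "real \<Rightarrow> (real \<Rightarrow> real^'d) \<Rightarrow> real^'n"
  assumes I: "L2_martingale I" and \<mu>: "\<mu> > 0"
    and cont: "AE \<omega> in M. continuous_on {t..T} (\<lambda>s. I s \<omega>)"
  obtains E where "E \<in> sets M" "prob E \<le> (\<integral>\<omega>. (norm (I T \<omega>))\<^sup>2 \<partial>M) / \<mu>\<^sup>2"
    "AE \<omega> in M. (\<exists>s\<in>{t..T}. norm (I s \<omega>) > \<mu>) \<longrightarrow> \<omega> \<in> E"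
proof -
  obtain D :: "real set" where D: "countable D" "D \<subseteq> {t..T}" "{t..T} \<subseteq> closure D"
    using separable[of "{t..T}"] by blast
  have "D \<noteq> {}" using D t by auto
  have cl: "closure D = {t..T}" using D closure_minimal[of D "{t..T}"] by auto
  define S where "S n = from_nat_into D ` {..n}" for n :: nat
  have S: "finite (S n)" "S n \<subseteq> {t..T}" for n
    using from_nat_into[OF \<open>D \<noteq> {}\<close>] D(2) by (auto simp: S_def)
  define E where "E n = {\<omega> \<in> space M. \<exists>s\<in>S n. norm (I s \<omega>) > \<mu>}" for n
  note fin = maximal_inequality_finite[OF I S \<mu>, folded E_def]
  have inc: "incseq E" unfolding incseq_def E_def S_def by fastforce
  have lim: "(\<lambda>n. prob (E n)) \<longlonglongrightarrow> prob (\<Union>n. E n)"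
    by (rule finite_Lim_measure_incseq) (use fin inc in auto)
  show ?thesis
  proof (rule that)
    show "(\<Union>n. E n) \<in> sets M" using fin by auto
    show "prob (\<Union>n. E n) \<le> (\<integral>\<omega>. (norm (I T \<omega>))\<^sup>2 \<partial>M) / \<mu>\<^sup>2"
      by (rule LIMSEQ_le_const2[OF lim]) (use fin in auto)
    show "AE \<omega> in M. (\<exists>s\<in>{t..T}. norm (I s \<omega>) > \<mu>) \<longrightarrow> \<omega> \<in> (\<Union>n. E n)"
      using cont AE_space
    proof eventually_elim
      case (elim \<omega>)
      show ?case
      proof (rule impI, rule ccontr)
        assume ex: "\<exists>s\<in>{t..T}. norm (I s \<omega>) > \<mu>" and not: "\<omega> \<notin> (\<Union>n. E n)"
        have le: "norm (I r \<omega>) \<le> \<mu>" if "r \<in> D" for r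
        proof -
          from from_nat_into_surj[OF D(1) that] obtain n where "from_nat_into D n = r" by blast
          then have "r \<in> S n" unfolding S_def by blast
          moreover have "\<omega> \<notin> E n" using not by blast
          ultimately show ?thesis using elim(2) by (auto simp: E_def not_less)
        qed
        have "continuous_on (closure D) (\<lambda>s. norm (I s \<omega>))"
          unfolding cl by (intro continuous_on_norm elim)
        then have "norm (I s \<omega>) \<le> \<mu>" if "s \<in> {t..T}" for s
          by (rule continuous_le_on_closure) (use that cl le in auto)
        with ex show False by force
      qed
    qed
  qed
qed

section \<open>Square-integrable processes and their time integrals\<close>

abbreviation "sqN u \<equiv> square_integrable N (\<lambda>z. u (fst z) (snd z))"

lemma sqN_sections:
  fixes b :: "real \<Rightarrow> (real \<Rightarrow> real^'d) \<Rightarrow> 'c::euclidean_space"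
  assumes b: "sqN b"
  shows "AE \<omega> in M. square_integrable L (\<lambda>s. b s \<omega>)" "AE s in L. square_integrable M (b s)"
proof -
  have m: "(\<lambda>z. b (fst z) (snd z)) \<in> borel_measurable N" and
    i: "integrable N (case_prod (\<lambda>s \<omega>. (norm (b s \<omega>))\<^sup>2))"
    using b by (auto simp: square_integrable_def split_beta')
  show "AE \<omega> in M. square_integrable L (\<lambda>s. b s \<omega>)"
    using LM.AE_integrable_snd[OF i] AE_space
  proof eventually_elim
    case (elim \<omega>)
    then show ?case using measurable_compose[OF measurable_Pair2' m, of \<omega>]
      by (simp add: square_integrable_def)
  qed
  show "AE s in L. square_integrable M (b s)"
    using LM.AE_integrable_fst[OF i] AE_space
  proof eventually_elim
    case (elim s)
    then show ?case using measurable_compose[OF measurable_Pair1' m, of s]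
      by (simp add: square_integrable_def)
  qed
qed

lemma sqN_const:
  assumes "square_integrable M \<eta>"
  shows "sqN (\<lambda>s. \<eta>)"
  unfolding square_integrable_nn
proof
  have [measurable]: "\<eta> \<in> borel_measurable M" using assms by (simp add: square_integrable_def)
  show "(\<lambda>z. \<eta> (snd z)) \<in> borel_measurable N" by measurable
  have "(\<integral>\<^sup>+z. ennreal ((norm (\<eta> (snd z)))\<^sup>2) \<partial>N) = (\<integral>\<^sup>+s. (\<integral>\<^sup>+\<omega>. ennreal ((norm (\<eta> \<omega>))\<^sup>2) \<partial>M) \<partial>L)"
    by (subst nn_integral_fst[symmetric]) auto
  also have "\<dots> < \<infinity>"
    using assms top.not_eq_extremum[THEN iffD1, OF L.emeasure_finite[of "{t..T}"]] by (auto simp: square_integrable_nn ennreal_mult_less_top less_top)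
  finally show "(\<integral>\<^sup>+z. ennreal ((norm (\<eta> (snd z)))\<^sup>2) \<partial>N) < \<infinity>" .
qed

text \<open>Cauchy-Schwarz in time against the constant \<open>1\<close>.\<close>

lemma time_integral_square_integrable:
  fixes b :: "real \<Rightarrow> (real \<Rightarrow> real^'d) \<Rightarrow> 'c::euclidean_space"
  assumes b: "sqN b"
  shows "square_integrable M (\<lambda>\<omega>. \<integral>s. norm (b s \<omega>) \<partial>L)"
proof -
  have m: "(\<lambda>z. b (fst z) (snd z)) \<in> borel_measurable N" and
    i: "integrable N (case_prod (\<lambda>s \<omega>. (norm (b s \<omega>))\<^sup>2))"
    using b by (auto simp: square_integrable_def split_beta')
  have m1: "(\<lambda>(\<omega>, s). norm (b s \<omega>)) \<in> borel_measurable (M \<Otimes>\<^sub>M L)"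
    using measurable_compose[OF measurable_pair_swap' m] by (simp add: split_beta')
  have m2: "(\<lambda>\<omega>. \<integral>s. norm (b s \<omega>) \<partial>L) \<in> borel_measurable M"
    by (rule L.borel_measurable_lebesgue_integral[OF m1])
  let ?c = "measure L (space L)"
  have "integrable M (\<lambda>\<omega>. ?c * (\<integral>s. (norm (b s \<omega>))\<^sup>2 \<partial>L))"
    using LM.integrable_snd[OF i] by simp
  then have "integrable M (\<lambda>\<omega>. (norm (\<integral>s. norm (b s \<omega>) \<partial>L))\<^sup>2)"
  proof (rule Bochner_Integration.integrable_bound)
    show "AE \<omega> in M. norm ((norm (\<integral>s. norm (b s \<omega>) \<partial>L))\<^sup>2) \<le> norm (?c * (\<integral>s. (norm (b s \<omega>))\<^sup>2 \<partial>L))"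
      using sqN_sections(1)[OF b]
    proof eventually_elim
      case (elim \<omega>)
      have 1: "square_integrable L (\<lambda>s. 1 :: real)"
        by (rule L.square_integrable_bounded[of _ 1]) auto
      have 2: "square_integrable L (\<lambda>s. norm (b s \<omega>))"
        using elim by (auto simp: square_integrable_def)
      from Cauchy_Schwarz_integral[OF 1 2] show ?case by simp
    qed
  qed (use m2 in measurable)
  then show ?thesis using m2 by (simp add: square_integrable_def)
qed

lemma inner_time_integral:
  fixes b :: "real \<Rightarrow> (real \<Rightarrow> real^'d) \<Rightarrow> 'c::euclidean_space"
  assumes b: "sqN b" and \<eta>: "square_integrable M \<eta>"
  shows "(\<integral>\<omega>. \<eta> \<omega> \<bullet> (\<integral>s. b s \<omega> \<partial>L) \<partial>M) = (\<integral>z. \<eta> (snd z) \<bullet> b (fst z) (snd z) \<partial>N)"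
proof -
  have i: "integrable N (case_prod (\<lambda>s \<omega>. \<eta> \<omega> \<bullet> b s \<omega>))"
    using integrable_inner[OF sqN_const[OF \<eta>] b] by (simp add: split_beta')
  have "(\<integral>z. \<eta> (snd z) \<bullet> b (fst z) (snd z) \<partial>N) = (\<integral>\<omega>. (\<integral>s. \<eta> \<omega> \<bullet> b s \<omega> \<partial>L) \<partial>M)"
    unfolding LM.integral_snd[OF i] by (simp add: split_beta')
  also have "\<dots> = (\<integral>\<omega>. \<eta> \<omega> \<bullet> (\<integral>s. b s \<omega> \<partial>L) \<partial>M)"
  proof (rule integral_cong_AE)
    have mb: "(\<lambda>(\<omega>, s). b s \<omega>) \<in> borel_measurable (M \<Otimes>\<^sub>M L)"
      using measurable_compose[OF measurable_pair_swap' square_integrable_measurable[OF b]] by (simp add: split_beta')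
    show "(\<lambda>\<omega>. \<eta> \<omega> \<bullet> (\<integral>s. b s \<omega> \<partial>L)) \<in> borel_measurable M"
      by (intro borel_measurable_inner L.borel_measurable_lebesgue_integral[OF mb] square_integrable_measurable[OF \<eta>])
    show "(\<lambda>\<omega>. \<integral>s. \<eta> \<omega> \<bullet> b s \<omega> \<partial>L) \<in> borel_measurable M"
      using LM.integrable_snd[OF i] by simp
    show "AE \<omega> in M. (\<integral>s. \<eta> \<omega> \<bullet> b s \<omega> \<partial>L) = \<eta> \<omega> \<bullet> (\<integral>s. b s \<omega> \<partial>L)"
      using sqN_sections(1)[OF b]
    proof eventually_elim
      case (elim \<omega>)
      then show ?case using L.square_integrable_integrable[OF elim] by simp
    qed
  qed
  finally show ?thesis by simp
qed

lemma AE_N_snd: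
  assumes "AE \<omega> in M. R \<omega>"
  shows "AE z in N. R (snd z)"
proof -
  obtain Z where Z: "Z \<in> null_sets M" "{\<omega> \<in> space M. \<not> R \<omega>} \<subseteq> Z"
    using assms by (auto elim!: AE_E simp: null_sets_def)
  have [measurable]: "Z \<in> sets M" using Z by auto
  have "AE z in N. snd z \<notin> Z"
    by (rule LM.AE_pair_measure) (use AE_not_in[OF Z(1)] in auto)
  then show ?thesis using AE_space
  proof eventually_elim
    case (elim z)
    then show ?case using Z(2) by (auto simp: space_pair_measure)
  qed
qed

text \<open>The relation \<open>R\<close> selects the times \<open>r\<close> over which \<open>b\<close> is
  integrated when the current time is \<open>s\<close>; the past and the future of \<open>s\<close>
  are the two uses.\<close>

lemma sqN_windowed:
  fixes b :: "real \<Rightarrow> (real \<Rightarrow> real^'d) \<Rightarrow> 'c::euclidean_space"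
  assumes b: "sqN b" and R: "Measurable.pred (borel \<Otimes>\<^sub>M borel) (\<lambda>(s, r). R s (r::real))"
  shows "sqN (\<lambda>s \<omega>. \<integral>r. of_bool (R s r) *\<^sub>R b r \<omega> \<partial>L)"
proof (rule square_integrable_bound[OF sqN_const[OF time_integral_square_integrable[OF b]]])
  have mb: "(\<lambda>z. b (fst z) (snd z)) \<in> borel_measurable N" using b by (rule square_integrable_measurable)
  have idL: "(\<lambda>x. x) \<in> L \<rightarrow>\<^sub>M borel" by (intro measurable_restrict_space1) simp
  have [measurable]: "(\<lambda>y. b (snd y) (snd (fst y))) \<in> borel_measurable (N \<Otimes>\<^sub>M L)"
    using measurable_compose[OF _ mb, of "\<lambda>y. (snd y, snd (fst y))" "N \<Otimes>\<^sub>M L"] by simp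
  have "(\<lambda>y. (fst (fst y), snd y)) \<in> N \<Otimes>\<^sub>M L \<rightarrow>\<^sub>M borel \<Otimes>\<^sub>M borel"
    using measurable_compose[OF measurable_compose[OF measurable_fst measurable_fst] idL]
      measurable_compose[OF measurable_snd idL]
    by (intro measurable_Pair) auto
  from measurable_compose[OF this R] have [measurable]: "Measurable.pred (N \<Otimes>\<^sub>M L) (\<lambda>y. R (fst (fst y)) (snd y))"
    by simp
  show "(\<lambda>z. \<integral>r. of_bool (R (fst z) r) *\<^sub>R b r (snd z) \<partial>L) \<in> borel_measurable N"
    by (rule L.borel_measurable_lebesgue_integral) (simp add: split_beta', measurable)
  show "AE z in N. norm (\<integral>r. of_bool (R (fst z) r) *\<^sub>R b r (snd z) \<partial>L) \<le> norm (\<integral>s. norm (b s (snd z)) \<partial>L)"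
    using AE_N_snd[OF sqN_sections(1)[OF b]]
  proof eventually_elim
    case (elim z)
    then have bi: "integrable L (\<lambda>s. norm (b s (snd z)))"
      by (intro integrable_norm L.square_integrable_integrable)
    have "norm (\<integral>r. of_bool (R (fst z) r) *\<^sub>R b r (snd z) \<partial>L) \<le> (\<integral>s. norm (b s (snd z)) \<partial>L)"
      by (rule order_trans[OF integral_norm_bound integral_mono'[OF bi]]) auto
    then show ?case by simp
  qed
qed

end

section \<open>The product rule in expectation\<close>

context wiener_interval
begin

text \<open>Past and future of \<open>s\<close> are both taken without \<open>s\<close> itself, a null set. Then
  they are exchanged with each other by Fubini's theorem (\<open>triangle_swap\<close>).\<close>

lemma set_integral_past:
  fixes \<beta> :: "real \<Rightarrow> 'c::euclidean_space"
  assumes \<beta>: "\<beta> \<in> borel_measurable L" and s: "s \<in> {t..T}"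
  shows "(LINT r:{t..s}|lborel. \<beta> r) = (\<integral>r. of_bool (r < s) *\<^sub>R \<beta> r \<partial>L)"
proof -
  have m: "(\<lambda>r. indicator {t..T} r *\<^sub>R \<beta> r) \<in> borel_measurable lborel"
    using \<beta> by (subst (asm) borel_measurable_restrict_space_iff) auto
  have "(LINT r:{t..s}|lborel. \<beta> r) = (\<integral>r. of_bool (r \<le> s) *\<^sub>R (indicator {t..T} r *\<^sub>R \<beta> r) \<partial>lborel)"
    unfolding set_lebesgue_integral_def using s
    by (intro Bochner_Integration.integral_cong) (auto simp: indicator_def)
  also have "\<dots> = (\<integral>r. of_bool (r < s) *\<^sub>R (indicator {t..T} r *\<^sub>R \<beta> r) \<partial>lborel)"
  proof (rule integral_cong_AE)
    note [measurable] = m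
    show "(\<lambda>r. of_bool (r \<le> s) *\<^sub>R (indicator {t..T} r *\<^sub>R \<beta> r)) \<in> borel_measurable lborel"
      "(\<lambda>r. of_bool (r < s) *\<^sub>R (indicator {t..T} r *\<^sub>R \<beta> r)) \<in> borel_measurable lborel"
      by measurable
    show "AE r in lborel. of_bool (r \<le> s) *\<^sub>R (indicator {t..T} r *\<^sub>R \<beta> r) = of_bool (r < s) *\<^sub>R (indicator {t..T} r *\<^sub>R \<beta> r)"
      using AE_lborel_singleton[of s] by eventually_elim auto
  qed
  also have "\<dots> = (\<integral>r. of_bool (r < s) *\<^sub>R \<beta> r \<partial>L)"
    by (subst integral_restrict_space) (auto simp: scaleR_left_commute ac_simps)
  finally show ?thesis .
qed

lemma set_integral_future:
  fixes \<beta> :: "real \<Rightarrow> 'c::euclidean_space"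
  assumes \<beta>: "\<beta> \<in> borel_measurable L" and s: "s \<in> {t..T}"
  shows "(LINT r:{s..T}|lborel. \<beta> r) = (\<integral>r. of_bool (s < r) *\<^sub>R \<beta> r \<partial>L)"
proof -
  have m: "(\<lambda>r. indicator {t..T} r *\<^sub>R \<beta> r) \<in> borel_measurable lborel"
    using \<beta> by (subst (asm) borel_measurable_restrict_space_iff) auto
  have "(LINT r:{s..T}|lborel. \<beta> r) = (\<integral>r. of_bool (s \<le> r) *\<^sub>R (indicator {t..T} r *\<^sub>R \<beta> r) \<partial>lborel)"
    unfolding set_lebesgue_integral_def using s
    by (intro Bochner_Integration.integral_cong) (auto simp: indicator_def)
  also have "\<dots> = (\<integral>r. of_bool (s < r) *\<^sub>R (indicator {t..T} r *\<^sub>R \<beta> r) \<partial>lborel)"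
  proof (rule integral_cong_AE)
    note [measurable] = m
    show "(\<lambda>r. of_bool (s \<le> r) *\<^sub>R (indicator {t..T} r *\<^sub>R \<beta> r)) \<in> borel_measurable lborel"
      "(\<lambda>r. of_bool (s < r) *\<^sub>R (indicator {t..T} r *\<^sub>R \<beta> r)) \<in> borel_measurable lborel"
      by measurable
    show "AE r in lborel. of_bool (s \<le> r) *\<^sub>R (indicator {t..T} r *\<^sub>R \<beta> r) = of_bool (s < r) *\<^sub>R (indicator {t..T} r *\<^sub>R \<beta> r)"
      using AE_lborel_singleton[of s] by eventually_elim auto
  qed
  also have "\<dots> = (\<integral>r. of_bool (s < r) *\<^sub>R \<beta> r \<partial>L)"
    by (subst integral_restrict_space) (auto simp: scaleR_left_commute ac_simps)
  finally show ?thesis .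
qed

lemma set_integral_full:
  "(LINT r:{t..T}|lborel. \<beta> r :: 'c::euclidean_space) = (\<integral>r. \<beta> r \<partial>L)"
  by (subst integral_restrict_space) (auto simp: set_lebesgue_integral_def)

lemma integrable_window:
  fixes \<beta> :: "real \<Rightarrow> 'c::euclidean_space"
  assumes "integrable L \<beta>" "Measurable.pred borel R"
  shows "integrable L (\<lambda>r. of_bool (R r) *\<^sub>R \<beta> r)"
proof (rule Bochner_Integration.integrable_bound[OF assms(1)])
  have "Measurable.pred L R" using assms(2) by (intro measurable_restrict_space1) simp
  then have "(\<lambda>r. of_bool (R r) :: real) \<in> borel_measurable L" by measurable
  then show "(\<lambda>r. of_bool (R r) *\<^sub>R \<beta> r) \<in> borel_measurable L" using assms(1) by measurable
qed auto

lemma past_plus_future: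
  fixes \<beta> :: "real \<Rightarrow> 'c::euclidean_space"
  assumes \<beta>: "integrable L \<beta>" and s: "s \<in> {t..T}"
  shows "(\<integral>r. \<beta> r \<partial>L) = (\<integral>r. of_bool (r < s) *\<^sub>R \<beta> r \<partial>L) + (\<integral>r. of_bool (s < r) *\<^sub>R \<beta> r \<partial>L)"
proof -
  have ae: "AE r in L. r \<noteq> s"
    using AE_lborel_singleton[of s] by (subst AE_restrict_space_iff) auto
  have w: "integrable L (\<lambda>r. of_bool (r < s) *\<^sub>R \<beta> r)" "integrable L (\<lambda>r. of_bool (s < r) *\<^sub>R \<beta> r)"
    by (auto intro!: integrable_window \<beta>)
  have "(\<integral>r. \<beta> r \<partial>L) = (\<integral>r. of_bool (r < s) *\<^sub>R \<beta> r + of_bool (s < r) *\<^sub>R \<beta> r \<partial>L)"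
    by (rule integral_cong_AE) (use \<beta> w ae in \<open>auto elim!: eventually_mono\<close>)
  then show ?thesis using w by simp
qed

lemma triangle_swap:
  fixes \<alpha> \<beta> :: "real \<Rightarrow> 'c::euclidean_space"
  assumes \<alpha>: "integrable L \<alpha>" and \<beta>: "integrable L \<beta>"
  shows "(\<integral>s. \<alpha> s \<bullet> (\<integral>r. of_bool (s < r) *\<^sub>R \<beta> r \<partial>L) \<partial>L) = (\<integral>r. (\<integral>s. of_bool (s < r) *\<^sub>R \<alpha> s \<partial>L) \<bullet> \<beta> r \<partial>L)"
proof -
  interpret LL: pair_sigma_finite L L ..
  let ?k = "\<lambda>s r. of_bool (s < r) * (\<alpha> s \<bullet> \<beta> r)"
  have [measurable]: "\<alpha> \<in> borel_measurable L" "\<beta> \<in> borel_measurable L" using \<alpha> \<beta> by auto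
  have idL: "(\<lambda>x. x) \<in> L \<rightarrow>\<^sub>M borel" by (intro measurable_restrict_space1) simp
  have [measurable]: "(\<lambda>z. fst z :: real) \<in> borel_measurable (L \<Otimes>\<^sub>M L)" "(\<lambda>z. snd z :: real) \<in> borel_measurable (L \<Otimes>\<^sub>M L)"
    using measurable_compose[OF measurable_fst idL] measurable_compose[OF measurable_snd idL] by auto
  have "integrable (L \<Otimes>\<^sub>M L) (\<lambda>(s, r). norm (\<alpha> s) * norm (\<beta> r))"
  proof (rule LL.Fubini_integrable)
    show "integrable L (\<lambda>x. \<integral>y. norm (case (x, y) of (s, r) \<Rightarrow> norm (\<alpha> s) * norm (\<beta> r)) \<partial>L)"
      using \<alpha> by simp
    show "AE x in L. integrable L (\<lambda>y. case (x, y) of (s, r) \<Rightarrow> norm (\<alpha> s) * norm (\<beta> r))"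
      using \<beta> by simp
  qed (simp add: split_beta')
  then have k: "integrable (L \<Otimes>\<^sub>M L) (case_prod ?k)"
  proof (rule Bochner_Integration.integrable_bound)
    show "case_prod ?k \<in> borel_measurable (L \<Otimes>\<^sub>M L)" by (simp add: split_beta')
    have "\<bar>a \<bullet> b\<bar> \<le> norm a * norm b" for a b :: 'c by (rule Cauchy_Schwarz_ineq2)
    then show "AE x in L \<Otimes>\<^sub>M L. norm (case_prod ?k x) \<le> norm (case x of (s, r) \<Rightarrow> norm (\<alpha> s) * norm (\<beta> r))"
      by (auto simp: split_beta' abs_mult of_bool_def)
  qed
  have 1: "\<alpha> s \<bullet> (\<integral>r. of_bool (s < r) *\<^sub>R \<beta> r \<partial>L) = (\<integral>r. ?k s r \<partial>L)" for s
    using integral_inner_right[OF integrable_window[OF \<beta>, of "\<lambda>r. s < r"], of "\<alpha> s"] by simp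
  have 2: "(\<integral>s. of_bool (s < r) *\<^sub>R \<alpha> s \<partial>L) \<bullet> \<beta> r = (\<integral>s. ?k s r \<partial>L)" for r
    using integral_inner_left[OF integrable_window[OF \<alpha>, of "\<lambda>s. s < r"], of "\<beta> r"] by simp
  show ?thesis unfolding 1 2 using LL.integral_fst[OF k] LL.integral_snd[OF k] by simp
qed

abbreviation (input) "past a \<equiv> \<lambda>s \<omega>. \<integral>r. of_bool (r < s) *\<^sub>R a r \<omega> \<partial>L"
abbreviation (input) "future b \<equiv> \<lambda>s \<omega>. \<integral>r. of_bool (s < r) *\<^sub>R b r \<omega> \<partial>L"

lemma sqN_past: "sqN a \<Longrightarrow> sqN (past a)" and sqN_future: "sqN b \<Longrightarrow> sqN (future b)"
  for a b :: "real \<Rightarrow> (real \<Rightarrow> real^'d) \<Rightarrow> 'c::euclidean_space"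
  by (rule sqN_windowed; simp)+

lemma past_future_swap:
  fixes a b :: "real \<Rightarrow> (real \<Rightarrow> real^'d) \<Rightarrow> 'c::euclidean_space"
  assumes a: "sqN a" and b: "sqN b"
  shows "(\<integral>z. a (fst z) (snd z) \<bullet> future b (fst z) (snd z) \<partial>N) = (\<integral>z. past a (fst z) (snd z) \<bullet> b (fst z) (snd z) \<partial>N)"
proof -
  have 1: "integrable N (case_prod (\<lambda>s \<omega>. a s \<omega> \<bullet> future b s \<omega>))"
    using integrable_inner[OF a sqN_future[OF b]] by (simp add: split_beta')
  have 2: "integrable N (case_prod (\<lambda>s \<omega>. past a s \<omega> \<bullet> b s \<omega>))"
    using integrable_inner[OF sqN_past[OF a] b] by (simp add: split_beta')
  have "(\<integral>\<omega>. (\<integral>s. a s \<omega> \<bullet> future b s \<omega> \<partial>L) \<partial>M) = (\<integral>\<omega>. (\<integral>s. past a s \<omega> \<bullet> b s \<omega> \<partial>L) \<partial>M)"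
  proof (rule integral_cong_AE)
    show "AE \<omega> in M. (\<integral>s. a s \<omega> \<bullet> future b s \<omega> \<partial>L) = (\<integral>s. past a s \<omega> \<bullet> b s \<omega> \<partial>L)"
      using sqN_sections(1)[OF a] sqN_sections(1)[OF b]
      by eventually_elim (intro triangle_swap L.square_integrable_integrable)
  qed (use LM.integrable_snd[OF 1] LM.integrable_snd[OF 2] in auto)
  then show ?thesis using LM.integral_snd[OF 1] LM.integral_snd[OF 2] by (simp add: split_beta')
qed

text \<open>\<open>J\<close> is known to be measurable for each fixed time only, so its increments enter through
  a jointly measurable version \<open>R\<close>.\<close>

lemma martingale_orthogonal_N:
  fixes c R :: "real \<Rightarrow> (real \<Rightarrow> real^'d) \<Rightarrow> real^'n"
  assumes c: "sqN c" "\<And>s. s \<in> {t..T} \<Longrightarrow> c s \<in> borel_measurable (F s)"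
    and J: "L2_martingale J" and R: "sqN R"
    and RJ: "\<And>s. s \<in> {t..T} \<Longrightarrow> AE \<omega> in M. R s \<omega> = J T \<omega> - J s \<omega>"
  shows "(\<integral>z. c (fst z) (snd z) \<bullet> R (fst z) (snd z) \<partial>N) = 0"
proof -
  note D = L2_martingaleD[OF J]
  have T: "T \<in> {t..T}" using t by simp
  have i: "integrable N (case_prod (\<lambda>s \<omega>. c s \<omega> \<bullet> R s \<omega>))"
    using integrable_inner[OF c(1) R] by (simp add: split_beta')
  have "(\<integral>z. c (fst z) (snd z) \<bullet> R (fst z) (snd z) \<partial>N) = (\<integral>s. (\<integral>\<omega>. c s \<omega> \<bullet> R s \<omega> \<partial>M) \<partial>L)"
    unfolding LM.integral_fst[OF i] by (simp add: split_beta')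
  also have "\<dots> = (\<integral>s. 0 \<partial>L)"
  proof (rule integral_cong_AE)
    show "AE s in L. (\<integral>\<omega>. c s \<omega> \<bullet> R s \<omega> \<partial>M) = 0"
      using sqN_sections(2)[OF c(1)] sqN_sections(2)[OF R] AE_space
    proof eventually_elim
      case (elim s)
      then have s: "s \<in> {t..T}" by simp
      have [measurable]: "c s \<in> borel_measurable M" "R s \<in> borel_measurable M"
        "J s \<in> borel_measurable M" "J T \<in> borel_measurable M"
        using elim D(2)[OF s] D(2)[OF T] by (auto simp: square_integrable_def)
      have "(\<integral>\<omega>. c s \<omega> \<bullet> R s \<omega> \<partial>M) = (\<integral>\<omega>. c s \<omega> \<bullet> J T \<omega> - c s \<omega> \<bullet> J s \<omega> \<partial>M)"
        by (rule integral_cong_AE) (use RJ[OF s] in \<open>auto elim!: eventually_mono simp: inner_diff_right\<close>)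
      also have "\<dots> = (\<integral>\<omega>. c s \<omega> \<bullet> J T \<omega> \<partial>M) - (\<integral>\<omega>. c s \<omega> \<bullet> J s \<omega> \<partial>M)"
        by (rule Bochner_Integration.integral_diff; rule integrable_inner[OF elim(1) D(2)]; fact s T)
      also have "\<dots> = 0" using D(4)[OF s c(2)[OF s] elim(1)] by simp
      finally show ?case .
    qed
  qed (use LM.integrable_fst[OF i] in auto)
  finally show ?thesis by simp
qed

text \<open>Write \<open>U T = u0 + A + I T\<close> and \<open>V T = v0 + B + J T\<close> with the time
  integrals \<open>A\<close> and \<open>B\<close> of the drifts. Pairing a drift \<open>a s\<close>
  with \<open>V T\<close>, the martingale property replaces \<open>V T\<close> by \<open>V s\<close>
  plus the future drift of \<open>V\<close>; pairing \<open>b s\<close> with \<open>I T\<close>, it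
  replaces \<open>I T\<close> by \<open>I s\<close>, that is by \<open>U s\<close> minus the past
  drift of \<open>U\<close> and the initial value. The two drift-drift terms cancel by Fubini's
  theorem.\<close>

theorem ito_product_formula:
  fixes U V a b :: "real \<Rightarrow> (real \<Rightarrow> real^'d) \<Rightarrow> real^'n"
  assumes U: "sqN U" and V: "sqN V" and a: "sqN a" and b: "sqN b"
    and aF: "\<And>s. s \<in> {t..T} \<Longrightarrow> a s \<in> borel_measurable (F s)"
    and bF: "\<And>s. s \<in> {t..T} \<Longrightarrow> b s \<in> borel_measurable (F s)"
    and I: "L2_martingale I" and J: "L2_martingale J"
    and u0: "square_integrable M u0" "u0 \<in> borel_measurable (F t)"
    and v0: "square_integrable M v0" "v0 \<in> borel_measurable (F t)"
    and UT: "square_integrable M (U T)" and VT: "square_integrable M (V T)"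
    and eqU: "AE \<omega> in M. \<forall>s\<in>{t..T}. U s \<omega> = u0 \<omega> + (LINT r:{t..s}|lborel. a r \<omega>) + I s \<omega>"
    and eqV: "AE \<omega> in M. \<forall>s\<in>{t..T}. V s \<omega> = v0 \<omega> + (LINT r:{t..s}|lborel. b r \<omega>) + J s \<omega>"
  shows "(\<integral>\<omega>. U T \<omega> \<bullet> V T \<omega> \<partial>M) = (\<integral>\<omega>. u0 \<omega> \<bullet> v0 \<omega> \<partial>M)
     + (\<integral>z. a (fst z) (snd z) \<bullet> V (fst z) (snd z) \<partial>N) + (\<integral>z. U (fst z) (snd z) \<bullet> b (fst z) (snd z) \<partial>N)
     + (\<integral>\<omega>. I T \<omega> \<bullet> J T \<omega> \<partial>M)"
proof -
  have T: "T \<in> {t..T}" and tt: "t \<in> {t..T}" using t by auto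
  note ID = L2_martingaleD[OF I] and JD = L2_martingaleD[OF J]
  note IT = ID(2)[OF T] and JT = JD(2)[OF T]
  have past_eq: "AE \<omega> in M. \<forall>s\<in>{t..T}. (LINT r:{t..s}|lborel. c r \<omega>) = past c s \<omega>"
    if "sqN c" for c :: "real \<Rightarrow> (real \<Rightarrow> real^'d) \<Rightarrow> real^'n"
    using sqN_sections(1)[OF that]
    by eventually_elim (auto intro!: set_integral_past simp: square_integrable_def)
  have start: "(\<integral>\<omega>. \<eta> \<omega> \<bullet> K T \<omega> \<partial>M) = 0"
    if "square_integrable M \<eta>" "\<eta> \<in> borel_measurable (F t)" "L2_martingale K" for \<eta> K
  proof -
    note KD = L2_martingaleD[OF that(3)]
    have "(\<integral>\<omega>. \<eta> \<omega> \<bullet> K T \<omega> \<partial>M) = (\<integral>\<omega>. \<eta> \<omega> \<bullet> K t \<omega> \<partial>M)" by (rule KD(4)[OF tt that(2,1)])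
    also have "\<dots> = (\<integral>\<omega>. 0 \<partial>M)"
      by (rule integral_cong_AE)
        (use KD(3) borel_measurable_integrable[OF integrable_inner[OF that(1) KD(2)[OF tt]]] in \<open>auto elim!: eventually_mono\<close>)
    finally show ?thesis by simp
  qed
  define A B where "A \<omega> = U T \<omega> - u0 \<omega> - I T \<omega>" and "B \<omega> = V T \<omega> - v0 \<omega> - J T \<omega>" for \<omega>
  have A: "square_integrable M A" and B: "square_integrable M B"
    unfolding A_def[abs_def] B_def[abs_def] by (intro square_integrable_diff UT VT u0 v0 IT JT)+
  have Aeq: "AE \<omega> in M. A \<omega> = (\<integral>r. a r \<omega> \<partial>L)"
    using eqU by eventually_elim (use T in \<open>auto simp: A_def set_integral_full\<close>)
  have Beq: "AE \<omega> in M. B \<omega> = (\<integral>r. b r \<omega> \<partial>L)"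
    using eqV by eventually_elim (use T in \<open>auto simp: B_def set_integral_full\<close>)
  have int_drift: "(\<integral>\<omega>. \<eta> \<omega> \<bullet> C \<omega> \<partial>M) = (\<integral>z. \<eta> (snd z) \<bullet> c (fst z) (snd z) \<partial>N)"
    if \<eta>: "square_integrable M \<eta>" and c: "sqN c" and C: "square_integrable M C"
      and eq: "AE \<omega> in M. C \<omega> = (\<integral>r. c r \<omega> \<partial>L)" for \<eta> C c :: "_ \<Rightarrow> _"
  proof -
    have mb: "(\<lambda>(\<omega>, s). c s \<omega>) \<in> borel_measurable (M \<Otimes>\<^sub>M L)"
      using measurable_compose[OF measurable_pair_swap' square_integrable_measurable[OF c]] by (simp add: split_beta')
    have "(\<integral>\<omega>. \<eta> \<omega> \<bullet> C \<omega> \<partial>M) = (\<integral>\<omega>. \<eta> \<omega> \<bullet> (\<integral>r. c r \<omega> \<partial>L) \<partial>M)"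
      by (rule integral_cong_AE)
        (use eq square_integrable_measurable[OF \<eta>] square_integrable_measurable[OF C]
          L.borel_measurable_lebesgue_integral[OF mb] in \<open>auto elim!: eventually_mono\<close>)
    then show ?thesis using inner_time_integral[OF c \<eta>] by simp
  qed
  have N_VT: "sqN (\<lambda>s. V T)" "sqN (\<lambda>s. I T)" "sqN (\<lambda>s. u0)" using sqN_const VT IT u0 by auto
  note P = sqN_past[OF a] and Q = sqN_future[OF b]
  \<comment> \<open>The bracket is a jointly measurable version of \<open>J T - J s\<close>.\<close>
  have o1: "(\<integral>z. a (fst z) (snd z) \<bullet> (V T (snd z) - V (fst z) (snd z) - future b (fst z) (snd z)) \<partial>N) = 0"
  proof (rule martingale_orthogonal_N[OF a aF J])
    show "sqN (\<lambda>s \<omega>. V T \<omega> - V s \<omega> - future b s \<omega>)"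
      by (intro square_integrable_diff N_VT V Q)
    fix s assume s: "s \<in> {t..T}"
    show "AE \<omega> in M. V T \<omega> - V s \<omega> - future b s \<omega> = J T \<omega> - J s \<omega>"
      using eqV past_eq[OF b] sqN_sections(1)[OF b]
    proof eventually_elim
      case (elim \<omega>)
      have "(\<integral>r. b r \<omega> \<partial>L) = past b s \<omega> + future b s \<omega>"
        using L.square_integrable_integrable[OF elim(3)] s by (rule past_plus_future)
      then show ?case using bspec[OF elim(1) s] bspec[OF elim(1) T] bspec[OF elim(2) s]
        by (simp add: set_integral_full)
    qed
  qed
  \<comment> \<open>The bracket is a jointly measurable version of \<open>I T - I s\<close>.\<close>
  have o2: "(\<integral>z. b (fst z) (snd z) \<bullet> (I T (snd z) - (U (fst z) (snd z) - u0 (snd z) - past a (fst z) (snd z))) \<partial>N) = 0"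
  proof (rule martingale_orthogonal_N[OF b bF I])
    show "sqN (\<lambda>s \<omega>. I T \<omega> - (U s \<omega> - u0 \<omega> - past a s \<omega>))"
      by (intro square_integrable_diff N_VT U P)
    fix s assume s: "s \<in> {t..T}"
    show "AE \<omega> in M. I T \<omega> - (U s \<omega> - u0 \<omega> - past a s \<omega>) = I T \<omega> - I s \<omega>"
      using eqU past_eq[OF a] by eventually_elim (use s in auto)
  qed
  let ?a = "\<lambda>z. a (fst z) (snd z)" and ?b = "\<lambda>z. b (fst z) (snd z)"
    and ?U = "\<lambda>z. U (fst z) (snd z)" and ?V = "\<lambda>z. V (fst z) (snd z)"
    and ?P = "\<lambda>z. past a (fst z) (snd z)" and ?Q = "\<lambda>z. future b (fst z) (snd z)"
  note iN = integrable_inner[OF a N_VT(1)] integrable_inner[OF a V] integrable_inner[OF a Q]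
    integrable_inner[OF b N_VT(2)] integrable_inner[OF b U] integrable_inner[OF b N_VT(3)] integrable_inner[OF b P]
  have e1: "(\<integral>z. ?a z \<bullet> V T (snd z) \<partial>N) = (\<integral>z. ?a z \<bullet> ?V z \<partial>N) + (\<integral>z. ?a z \<bullet> ?Q z \<partial>N)"
  proof -
    have "0 = (\<integral>z. ?a z \<bullet> V T (snd z) - ?a z \<bullet> ?V z - ?a z \<bullet> ?Q z \<partial>N)"
      using o1 by (simp only: inner_diff_right)
    also have "\<dots> = (\<integral>z. ?a z \<bullet> V T (snd z) \<partial>N) - (\<integral>z. ?a z \<bullet> ?V z \<partial>N) - (\<integral>z. ?a z \<bullet> ?Q z \<partial>N)"
      by (intro has_bochner_integral_integral_eq has_bochner_integral_diff has_bochner_integral_integrable iN)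
    finally show ?thesis by simp
  qed
  have e2: "(\<integral>z. ?b z \<bullet> I T (snd z) \<partial>N) = (\<integral>z. ?b z \<bullet> ?U z \<partial>N) - (\<integral>z. ?b z \<bullet> u0 (snd z) \<partial>N) - (\<integral>z. ?b z \<bullet> ?P z \<partial>N)"
  proof -
    have "0 = (\<integral>z. ?b z \<bullet> I T (snd z) - (?b z \<bullet> ?U z - ?b z \<bullet> u0 (snd z) - ?b z \<bullet> ?P z) \<partial>N)"
      using o2 by (simp only: inner_diff_right)
    also have "\<dots> = (\<integral>z. ?b z \<bullet> I T (snd z) \<partial>N) - ((\<integral>z. ?b z \<bullet> ?U z \<partial>N) - (\<integral>z. ?b z \<bullet> u0 (snd z) \<partial>N) - (\<integral>z. ?b z \<bullet> ?P z \<partial>N))"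
      by (intro has_bochner_integral_integral_eq has_bochner_integral_diff has_bochner_integral_integrable iN)
    finally show ?thesis by simp
  qed
  have e3: "(\<integral>z. ?a z \<bullet> ?Q z \<partial>N) = (\<integral>z. ?b z \<bullet> ?P z \<partial>N)"
    using past_future_swap[OF a b] by (simp add: inner_commute)
  note iM = integrable_inner[OF u0(1) v0(1)] integrable_inner[OF u0(1) B] integrable_inner[OF u0(1) JT]
    integrable_inner[OF VT A] integrable_inner[OF v0(1) IT] integrable_inner[OF IT B] integrable_inner[OF IT JT]
  have "(\<integral>\<omega>. U T \<omega> \<bullet> V T \<omega> \<partial>M) = (\<integral>\<omega>. (((((u0 \<omega> \<bullet> v0 \<omega> + u0 \<omega> \<bullet> B \<omega>) + u0 \<omega> \<bullet> J T \<omega>) + V T \<omega> \<bullet> A \<omega>)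
      + v0 \<omega> \<bullet> I T \<omega>) + I T \<omega> \<bullet> B \<omega>) + I T \<omega> \<bullet> J T \<omega> \<partial>M)"
    by (intro Bochner_Integration.integral_cong refl)
      (simp add: A_def B_def inner_diff_left inner_diff_right inner_commute)
  also have "\<dots> = ((((((\<integral>\<omega>. u0 \<omega> \<bullet> v0 \<omega> \<partial>M) + (\<integral>\<omega>. u0 \<omega> \<bullet> B \<omega> \<partial>M)) + (\<integral>\<omega>. u0 \<omega> \<bullet> J T \<omega> \<partial>M)) + (\<integral>\<omega>. V T \<omega> \<bullet> A \<omega> \<partial>M))
      + (\<integral>\<omega>. v0 \<omega> \<bullet> I T \<omega> \<partial>M)) + (\<integral>\<omega>. I T \<omega> \<bullet> B \<omega> \<partial>M)) + (\<integral>\<omega>. I T \<omega> \<bullet> J T \<omega> \<partial>M)"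
    by (intro has_bochner_integral_integral_eq has_bochner_integral_add has_bochner_integral_integrable iM)
  also have "(\<integral>\<omega>. u0 \<omega> \<bullet> J T \<omega> \<partial>M) = 0" by (rule start[OF u0 J])
  also have "(\<integral>\<omega>. v0 \<omega> \<bullet> I T \<omega> \<partial>M) = 0" by (rule start[OF v0 I])
  also have "(\<integral>\<omega>. u0 \<omega> \<bullet> B \<omega> \<partial>M) = (\<integral>z. ?b z \<bullet> u0 (snd z) \<partial>N)"
    using int_drift[OF u0(1) b B Beq] by (simp add: inner_commute)
  also have "(\<integral>\<omega>. V T \<omega> \<bullet> A \<omega> \<partial>M) = (\<integral>z. ?a z \<bullet> V T (snd z) \<partial>N)"
    using int_drift[OF VT a A Aeq] by (simp add: inner_commute)
  also have "(\<integral>\<omega>. I T \<omega> \<bullet> B \<omega> \<partial>M) = (\<integral>z. ?b z \<bullet> I T (snd z) \<partial>N)"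
    using int_drift[OF IT b B Beq] by (simp add: inner_commute)
  finally show ?thesis using e1 e2 e3 by (simp add: inner_commute)
qed

end

section \<open>The coefficients\<close>

text \<open>The assumptions on the coefficients hold, for fixed arguments, for almost every time only. Since
  both sides are continuous in time, they hold for every time, and so the exceptional null sets
  cannot depend on the arguments.\<close>

lemma AE_le_continuous_imp_le:
  fixes \<phi> \<psi> :: "real \<Rightarrow> real"
  assumes T: "T > 0" and c: "continuous_on {0..T} \<phi>" "continuous_on {0..T} \<psi>"
    and ae: "AE r\<in>{0..T} in lborel. \<phi> r \<le> \<psi> r" and r: "r \<in> {0..T}"
  shows "\<phi> r \<le> \<psi> r"
proof (rule ccontr)
  assume "\<not> \<phi> r \<le> \<psi> r"
  then have pos: "0 < \<phi> r - \<psi> r" by simp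
  have "continuous_on {0..T} (\<lambda>s. \<phi> s - \<psi> s)" by (intro continuous_intros c)
  then obtain d where d: "d > 0" "\<And>s. s \<in> {0..T} \<Longrightarrow> dist s r < d \<Longrightarrow> dist (\<phi> s - \<psi> s) (\<phi> r - \<psi> r) < \<phi> r - \<psi> r"
    using pos r unfolding continuous_on_iff by metis
  let ?l = "max 0 (r - d)" and ?u = "min T (r + d)"
  have lu: "?l < ?u" using T r d(1) by auto
  have "AE s in lborel. s \<notin> {?l<..<?u}"
    using ae
  proof eventually_elim
    case (elim s)
    show ?case
    proof
      assume s: "s \<in> {?l<..<?u}"
      then have s': "s \<in> {0..T}" "dist s r < d" using r by (auto simp: dist_real_def)
      from d(2)[OF s'] have "0 < \<phi> s - \<psi> s" by (auto simp: dist_real_def)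
      moreover have "\<phi> s \<le> \<psi> s" using elim s' by simp
      ultimately show False by simp
    qed
  qed
  then have "{?l<..<?u} \<in> null_sets lborel" by (subst AE_iff_null_sets) auto
  then show False using lu by (auto simp: null_sets_def)
qed

text \<open>The increment splits into a change of state, controlled by the Lipschitz bound uniformly in time,
  and a change of time at a fixed state. Joint continuity is what makes the coefficients measurable
  along processes.\<close>

lemma continuous_on_Lipschitz_parameter:
  fixes G :: "real \<Rightarrow> 'a::real_normed_vector \<Rightarrow> 'b::real_normed_vector"
  assumes c: "\<And>u. continuous_on S (\<lambda>r. G r u)"
    and lip: "\<And>r u v. r \<in> S \<Longrightarrow> norm (G r u - G r v) \<le> C * norm (u - v)"
  shows "continuous_on (S \<times> UNIV) (\<lambda>z. G (fst z) (snd z))"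
  unfolding continuous_on_def
proof
  fix z0 assume z0: "z0 \<in> S \<times> (UNIV :: 'a set)"
  let ?F = "at z0 within S \<times> UNIV"
  have "continuous_on (S \<times> (UNIV :: 'a set)) (\<lambda>z. G (fst z) (snd z0))"
    by (rule continuous_on_compose2[OF c[of "snd z0"] continuous_on_fst[OF continuous_on_id]]) auto
  with z0 have 1: "((\<lambda>z. G (fst z) (snd z0)) \<longlongrightarrow> G (fst z0) (snd z0)) ?F"
    by (auto simp: continuous_on_def)
  have "((\<lambda>z. C * norm (snd z - snd z0) + norm (G (fst z) (snd z0) - G (fst z0) (snd z0))) \<longlongrightarrow>
      C * norm (snd z0 - snd z0) + norm (G (fst z0) (snd z0) - G (fst z0) (snd z0))) ?F"
    by (intro tendsto_intros 1)
  then have 2: "((\<lambda>z. C * norm (snd z - snd z0) + norm (G (fst z) (snd z0) - G (fst z0) (snd z0))) \<longlongrightarrow> 0) ?F"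
    by simp
  have "((\<lambda>z. G (fst z) (snd z) - G (fst z0) (snd z0)) \<longlongrightarrow> 0) ?F"
  proof (rule Lim_null_comparison[OF _ 2])
    show "\<forall>\<^sub>F z in ?F. norm (G (fst z) (snd z) - G (fst z0) (snd z0))
        \<le> C * norm (snd z - snd z0) + norm (G (fst z) (snd z0) - G (fst z0) (snd z0))"
      unfolding eventually_at_filter
    proof (intro always_eventually allI impI)
      fix z assume "z \<noteq> z0" "z \<in> S \<times> (UNIV :: 'a set)"
      then have "fst z \<in> S" by auto
      from lip[OF this, of "snd z" "snd z0"]
      show "norm (G (fst z) (snd z) - G (fst z0) (snd z0))
        \<le> C * norm (snd z - snd z0) + norm (G (fst z) (snd z0) - G (fst z0) (snd z0))"
        using norm_triangle_ineq[of "G (fst z) (snd z) - G (fst z) (snd z0)" "G (fst z) (snd z0) - G (fst z0) (snd z0)"]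
        by simp
    qed
  qed
  then show "((\<lambda>z. G (fst z) (snd z)) \<longlongrightarrow> G (fst z0) (snd z0)) ?F"
    using Lim_null by blast
qed

lemma assumption_A1_everywhere:
  assumes T: "T > 0" and A1: "assumption_A1 T f \<sigma> g h"
  obtains C where "C > 0"
    "\<And>r x1 y1 z1 x2 y2 z2. r \<in> {0..T} \<Longrightarrow>
       norm (g r x1 y1 z1 - g r x2 y2 z2) \<le> C * (norm (x1 - x2) + norm (y1 - y2) + norm (z1 - z2))"
    "\<And>r x1 y1 x2 y2. r \<in> {0..T} \<Longrightarrow> norm (f r x1 y1 - f r x2 y2) \<le> C * (norm (x1 - x2) + norm (y1 - y2))"
    "\<And>r x1 y1 x2 y2. r \<in> {0..T} \<Longrightarrow> norm (\<sigma> r x1 y1 - \<sigma> r x2 y2) \<le> C * (norm (x1 - x2) + norm (y1 - y2))"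
    "\<And>x1 x2. norm (h x1 - h x2) \<le> C * norm (x1 - x2)"
proof -
  note A = A1[unfolded assumption_A1_def]
  note c = conjunct1[OF A, rule_format] conjunct1[OF conjunct2[OF A], rule_format]
    conjunct1[OF conjunct2[OF conjunct2[OF A]], rule_format]
  from conjunct2[OF conjunct2[OF conjunct2[OF A]]] obtain C where C: "C > 0"
    and lip: "\<And>x1 x2 y1 y2 z1 z2. AE r\<in>{0..T} in lborel. norm (g r x1 y1 z1 - g r x2 y2 z2)
             \<le> C * (norm (x1 - x2) + norm (y1 - y2) + norm (z1 - z2))"
     "\<And>x1 x2 y1 y2. AE r\<in>{0..T} in lborel. norm (f r x1 y1 - f r x2 y2) \<le> C * (norm (x1 - x2) + norm (y1 - y2))"
     "\<And>x1 x2 y1 y2. AE r\<in>{0..T} in lborel. norm (\<sigma> r x1 y1 - \<sigma> r x2 y2) \<le> C * (norm (x1 - x2) + norm (y1 - y2))"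
     "\<And>x1 x2. norm (h x1 - h x2) \<le> C * norm (x1 - x2)"
    by (elim exE conjE) blast
  show ?thesis
    by (rule that[OF C])
      (rule AE_le_continuous_imp_le[OF T _ _ lip(1)] AE_le_continuous_imp_le[OF T _ _ lip(2)]
        AE_le_continuous_imp_le[OF T _ _ lip(3)] lip(4); (intro continuous_intros c)?; assumption?)+
qed

text \<open>The part \<open>\<surd>\<epsilon>\<close> of the monotonicity constant is dropped, which leaves a
  constant that is uniform in \<open>\<epsilon>\<close>.\<close>

lemma assumption_A2_everywhere:
  fixes f :: "real \<Rightarrow> real^'n \<Rightarrow> real^'n \<Rightarrow> real^'n" and \<sigma> :: "real \<Rightarrow> real^'n \<Rightarrow> real^'n \<Rightarrow> real^'d^'n"
  assumes T: "T > 0" and A1: "assumption_A1 T f \<sigma> g h" and A2: "assumption_A2 T f \<sigma> g h"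
  obtains C where "C > 0"
    "\<And>\<epsilon> r x1 y1 z1 x2 y2 z2. \<epsilon> \<in> {0<..1} \<Longrightarrow> r \<in> {0..T} \<Longrightarrow>
       (f r x1 y1 - f r x2 y2) \<bullet> (y1 - y2) - (g r x1 y1 z1 - g r x2 y2 z2) \<bullet> (x1 - x2)
         + sqrt \<epsilon> * ((\<sigma> r x1 y1 - \<sigma> r x2 y2) \<bullet> (z1 - z2))
       \<le> - C * ((norm (x1 - x2))\<^sup>2 + (norm (y1 - y2))\<^sup>2)"
    "\<And>x1 x2. (h x1 - h x2) \<bullet> (x1 - x2) \<ge> C * (norm (x1 - x2))\<^sup>2"
proof -
  note A = A1[unfolded assumption_A1_def]
  note c = conjunct1[OF A, rule_format] conjunct1[OF conjunct2[OF A], rule_format]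
    conjunct1[OF conjunct2[OF conjunct2[OF A]], rule_format]
  from A2 obtain C where C: "C > 0"
    and mono: "\<And>\<epsilon> x1 y1 z1 x2 y2 z2. \<epsilon> \<in> {0<..1} \<Longrightarrow> AE r\<in>{0..T} in lborel.
           (A_op f \<sigma> g \<epsilon> r (x1, y1, z1) - A_op f \<sigma> g \<epsilon> r (x2, y2, z2)) \<bullet> ((x1, y1, z1) - (x2, y2, z2))
           \<le> - (C + sqrt \<epsilon>) * ((norm (x1 - x2))\<^sup>2 + (norm (y1 - y2))\<^sup>2)"
    and h: "\<And>x1 x2. (h x1 - h x2) \<bullet> (x1 - x2) \<ge> C * (norm (x1 - x2))\<^sup>2"
    unfolding assumption_A2_def by blast
  show ?thesis
  proof (rule that[OF C _ h])
    fix \<epsilon> r :: real and x1 y1 x2 y2 :: "real^'n" and z1 z2 :: "real^'d^'n"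
    assume e: "\<epsilon> \<in> {0<..1}" and r: "r \<in> {0..T}"
    have eq: "(A_op f \<sigma> g \<epsilon> r (x1, y1, z1) - A_op f \<sigma> g \<epsilon> r (x2, y2, z2)) \<bullet> ((x1, y1, z1) - (x2, y2, z2))
      = (f r x1 y1 - f r x2 y2) \<bullet> (y1 - y2) - (g r x1 y1 z1 - g r x2 y2 z2) \<bullet> (x1 - x2)
         + sqrt \<epsilon> * ((\<sigma> r x1 y1 - \<sigma> r x2 y2) \<bullet> (z1 - z2))" for r
      by (simp add: inner_diff_left algebra_simps)
    have "(f r x1 y1 - f r x2 y2) \<bullet> (y1 - y2) - (g r x1 y1 z1 - g r x2 y2 z2) \<bullet> (x1 - x2)
         + sqrt \<epsilon> * ((\<sigma> r x1 y1 - \<sigma> r x2 y2) \<bullet> (z1 - z2))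
       \<le> - (C + sqrt \<epsilon>) * ((norm (x1 - x2))\<^sup>2 + (norm (y1 - y2))\<^sup>2)"
      by (rule AE_le_continuous_imp_le[OF T _ _ mono[OF e, of x1 y1 z1 x2 y2 z2, unfolded eq] r])
        (intro continuous_intros c)+
    also have "\<dots> \<le> - C * ((norm (x1 - x2))\<^sup>2 + (norm (y1 - y2))\<^sup>2)"
      using e by (intro mult_right_mono) auto
    finally show "(f r x1 y1 - f r x2 y2) \<bullet> (y1 - y2) - (g r x1 y1 z1 - g r x2 y2 z2) \<bullet> (x1 - x2)
         + sqrt \<epsilon> * ((\<sigma> r x1 y1 - \<sigma> r x2 y2) \<bullet> (z1 - z2))
       \<le> - C * ((norm (x1 - x2))\<^sup>2 + (norm (y1 - y2))\<^sup>2)" .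
  qed
qed

lemma norm_component_le: "norm (fst w) \<le> norm w" "norm (snd w) \<le> norm w"
  using norm_fst_le[of "fst w" "snd w"] norm_snd_le[of "snd w" "fst w"] by simp_all

text \<open>The coefficients with their constants valid at every time, and the solution \<open>(xx, yy)\<close>
  of the limit system.\<close>

locale fbsde = wiener_interval T P M t
  for T and P M :: "(real \<Rightarrow> real ^ 'd) measure" and t +
  fixes f :: "real \<Rightarrow> real^'n \<Rightarrow> real^'n \<Rightarrow> real^'n"
    and \<sigma> :: "real \<Rightarrow> real^'n \<Rightarrow> real^'n \<Rightarrow> real^'d^'n"
    and g :: "real \<Rightarrow> real^'n \<Rightarrow> real^'n \<Rightarrow> real^'d^'n \<Rightarrow> real^'n"
    and h :: "real^'n \<Rightarrow> real^'n"
    and x :: "real^'n" and xx yy :: "real \<Rightarrow> real^'n" and C1 C2 :: real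
  assumes f_cont: "\<And>x y. continuous_on {0..T} (\<lambda>r. f r x y)"
    and \<sigma>_cont: "\<And>x y. continuous_on {0..T} (\<lambda>r. \<sigma> r x y)"
    and g_cont: "\<And>x y z. continuous_on {0..T} (\<lambda>r. g r x y z)"
    and C1: "C1 > 0"
    and g_lip: "\<And>r x1 y1 z1 x2 y2 z2. r \<in> {0..T} \<Longrightarrow>
       norm (g r x1 y1 z1 - g r x2 y2 z2) \<le> C1 * (norm (x1 - x2) + norm (y1 - y2) + norm (z1 - z2))"
    and f_lip: "\<And>r x1 y1 x2 y2. r \<in> {0..T} \<Longrightarrow>
       norm (f r x1 y1 - f r x2 y2) \<le> C1 * (norm (x1 - x2) + norm (y1 - y2))"
    and \<sigma>_lip: "\<And>r x1 y1 x2 y2. r \<in> {0..T} \<Longrightarrow>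
       norm (\<sigma> r x1 y1 - \<sigma> r x2 y2) \<le> C1 * (norm (x1 - x2) + norm (y1 - y2))"
    and h_lip: "\<And>x1 x2. norm (h x1 - h x2) \<le> C1 * norm (x1 - x2)"
    and C2: "C2 > 0"
    and monotone: "\<And>\<epsilon> r x1 y1 z1 x2 y2 z2. \<epsilon> \<in> {0<..1} \<Longrightarrow> r \<in> {0..T} \<Longrightarrow>
       (f r x1 y1 - f r x2 y2) \<bullet> (y1 - y2) - (g r x1 y1 z1 - g r x2 y2 z2) \<bullet> (x1 - x2)
         + sqrt \<epsilon> * ((\<sigma> r x1 y1 - \<sigma> r x2 y2) \<bullet> (z1 - z2))
       \<le> - C2 * ((norm (x1 - x2))\<^sup>2 + (norm (y1 - y2))\<^sup>2)"
    and h_monotone: "\<And>x1 x2. (h x1 - h x2) \<bullet> (x1 - x2) \<ge> C2 * (norm (x1 - x2))\<^sup>2"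
    and limit: "limit_solution T f g h t x xx yy"
begin

lemma xx_cont: "continuous_on {t..T} xx" and yy_cont: "continuous_on {t..T} yy"
  and limit_eq: "\<And>s. s \<in> {t..T} \<Longrightarrow> xx s = x + (LINT r:{t..s}|lborel. f r (xx r) (yy r))"
    "\<And>s. s \<in> {t..T} \<Longrightarrow> yy s = h (xx T) + (LINT r:{s..T}|lborel. g r (xx r) (yy r) 0)"
proof -
  note l = limit[unfolded limit_solution_def]
  note e = conjunct2[OF conjunct2[OF l]]
  show "continuous_on {t..T} xx" by (rule conjunct1[OF l])
  show "continuous_on {t..T} yy" by (rule conjunct1[OF conjunct2[OF l]])
  show "xx s = x + (LINT r:{t..s}|lborel. f r (xx r) (yy r))" if "s \<in> {t..T}" for s
    by (rule conjunct1[OF bspec[OF e that]])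
  show "yy s = h (xx T) + (LINT r:{s..T}|lborel. g r (xx r) (yy r) 0)" if "s \<in> {t..T}" for s
    by (rule conjunct2[OF bspec[OF e that]])
qed

lemma f_joint: "continuous_on ({0..T} \<times> UNIV) (\<lambda>z. f (fst z) (fst (snd z)) (snd (snd z)))"
proof (rule continuous_on_Lipschitz_parameter[where G="\<lambda>r u. f r (fst u) (snd u)" and C="2 * C1"])
  fix r :: real and u v :: "(real^'n) \<times> (real^'n)" assume "r \<in> {0..T}"
  then have "norm (f r (fst u) (snd u) - f r (fst v) (snd v)) \<le> C1 * (norm (fst (u - v)) + norm (snd (u - v)))"
    using f_lip[of r "fst u" "snd u" "fst v" "snd v"] by simp
  also have "\<dots> \<le> C1 * (norm (u - v) + norm (u - v))"
    using C1 by (intro mult_left_mono add_mono norm_component_le) simp_all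
  finally show "norm (f r (fst u) (snd u) - f r (fst v) (snd v)) \<le> 2 * C1 * norm (u - v)" by simp
qed (rule f_cont)

lemma \<sigma>_joint: "continuous_on ({0..T} \<times> UNIV) (\<lambda>z. \<sigma> (fst z) (fst (snd z)) (snd (snd z)))"
proof (rule continuous_on_Lipschitz_parameter[where G="\<lambda>r u. \<sigma> r (fst u) (snd u)" and C="2 * C1"])
  fix r :: real and u v :: "(real^'n) \<times> (real^'n)" assume "r \<in> {0..T}"
  then have "norm (\<sigma> r (fst u) (snd u) - \<sigma> r (fst v) (snd v)) \<le> C1 * (norm (fst (u - v)) + norm (snd (u - v)))"
    using \<sigma>_lip[of r "fst u" "snd u" "fst v" "snd v"] by simp
  also have "\<dots> \<le> C1 * (norm (u - v) + norm (u - v))"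
    using C1 by (intro mult_left_mono add_mono norm_component_le) simp_all
  finally show "norm (\<sigma> r (fst u) (snd u) - \<sigma> r (fst v) (snd v)) \<le> 2 * C1 * norm (u - v)" by simp
qed (rule \<sigma>_cont)

lemma g_joint: "continuous_on ({0..T} \<times> UNIV) (\<lambda>z. g (fst z) (fst (snd z)) (fst (snd (snd z))) (snd (snd (snd z))))"
proof (rule continuous_on_Lipschitz_parameter[where G="\<lambda>r u. g r (fst u) (fst (snd u)) (snd (snd u))" and C="3 * C1"])
  fix r :: real and u v :: "(real^'n) \<times> (real^'n) \<times> (real^'d^'n)" assume "r \<in> {0..T}"
  then have "norm (g r (fst u) (fst (snd u)) (snd (snd u)) - g r (fst v) (fst (snd v)) (snd (snd v)))
     \<le> C1 * (norm (fst (u - v)) + norm (fst (snd (u - v))) + norm (snd (snd (u - v))))"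
    using g_lip[of r "fst u" "fst (snd u)" "snd (snd u)" "fst v" "fst (snd v)" "snd (snd v)"] by simp
  also have "\<dots> \<le> C1 * (norm (u - v) + norm (u - v) + norm (u - v))"
    using C1 by (intro mult_left_mono add_mono norm_component_le(1)
      order_trans[OF norm_component_le(1) norm_component_le(2)]
      order_trans[OF norm_component_le(2) norm_component_le(2)]) simp_all
  finally show "norm (g r (fst u) (fst (snd u)) (snd (snd u)) - g r (fst v) (fst (snd v)) (snd (snd v)))
     \<le> 3 * C1 * norm (u - v)" by simp
qed (rule g_cont)

lemma joint_measurable:
  fixes G :: "real \<times> 'a::euclidean_space \<Rightarrow> 'b::euclidean_space"
  assumes "continuous_on ({0..T} \<times> UNIV) G"
    and r: "r \<in> borel_measurable K" "\<And>\<omega>. \<omega> \<in> space K \<Longrightarrow> r \<omega> \<in> {0..T}"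
    and u: "u \<in> borel_measurable K"
  shows "(\<lambda>\<omega>. G (r \<omega>, u \<omega>)) \<in> borel_measurable K"
proof -
  have "G \<in> borel_measurable (restrict_space borel ({0..T} \<times> UNIV))"
    using assms(1) by (rule borel_measurable_continuous_on_restrict)
  moreover have "(\<lambda>\<omega>. (r \<omega>, u \<omega>)) \<in> measurable K (restrict_space borel ({0..T} \<times> UNIV))"
    using borel_measurable_Pair[OF r(1) u] r(2) by (intro measurable_restrict_space2) auto
  ultimately show ?thesis by (rule measurable_compose[rotated])
qed

lemma fst_N_measurable: "(\<lambda>z. fst z :: real) \<in> borel_measurable N"
proof -
  have "(\<lambda>x. x) \<in> L \<rightarrow>\<^sub>M borel" by (intro measurable_restrict_space1) simp
  from measurable_compose[OF measurable_fst this] show ?thesis .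
qed

lemma fst_N_range: "z \<in> space N \<Longrightarrow> fst z \<in> {t..T} \<and> fst z \<in> {0..T}"
  using t by (auto simp: space_pair_measure)

lemma sqN_deterministic:
  fixes u :: "real \<Rightarrow> 'c::euclidean_space"
  assumes "continuous_on {t..T} u"
  shows "sqN (\<lambda>s \<omega>. u s)"
proof -
  have "bounded (u ` {t..T})" by (intro compact_imp_bounded compact_continuous_image assms) simp
  then obtain B where B: "\<And>s. s \<in> {t..T} \<Longrightarrow> norm (u s) \<le> B" unfolding bounded_iff by blast
  have "u \<in> borel_measurable (restrict_space borel {t..T})"
    using assms by (rule borel_measurable_continuous_on_restrict)
  then have "u \<in> borel_measurable L"
    by (subst measurable_cong_sets[OF sets_L refl])
  from measurable_compose[OF measurable_fst this]
  have "(\<lambda>z. u (fst z)) \<in> borel_measurable N" .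
  then show ?thesis
    by (rule N.square_integrable_bounded[where B=B]) (use B fst_N_range in auto)
qed

text \<open>The supremum inside the \<open>S2\<close>-norm need not be measurable. The nonnegative integral is
  monotone on arbitrary functions, so the second moment at each single time is at most the
  \<open>S2\<close>-bound.\<close>

lemma S2_square_integrable:
  fixes v :: "real \<Rightarrow> (real \<Rightarrow> real^'d) \<Rightarrow> 'c::euclidean_space"
  assumes v: "v \<in> S2 M F t T"
  shows "sqN v" and "\<And>s. s \<in> {t..T} \<Longrightarrow> square_integrable M (v s)"
    and "\<And>s. s \<in> {t..T} \<Longrightarrow> v s \<in> borel_measurable (F s)"
proof -
  let ?K = "\<integral>\<^sup>+\<omega>. (SUP s\<in>{t..T}. ennreal ((norm (v s \<omega>))\<^sup>2)) \<partial>M"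
  have m: "(\<lambda>(s, \<omega>). v s \<omega>) \<in> borel_measurable N" and F: "\<And>s. s \<in> {t..T} \<Longrightarrow> v s \<in> borel_measurable (F s)"
    and K: "?K < \<infinity>"
    using v unfolding S2_def adapted_processes_def mem_Collect_eq measurable_N by blast+
  show "\<And>s. s \<in> {t..T} \<Longrightarrow> v s \<in> borel_measurable (F s)" by (rule F)
  have le: "(\<integral>\<^sup>+\<omega>. ennreal ((norm (v s \<omega>))\<^sup>2) \<partial>M) \<le> ?K" if "s \<in> {t..T}" for s
    by (intro nn_integral_mono SUP_upper that)
  show "square_integrable M (v s)" if "s \<in> {t..T}" for s
    unfolding square_integrable_nn
    using le[OF that] K F_measurable_M[OF F[OF that]] that by (auto intro: order_le_less_trans)
  show "sqN v"
    unfolding square_integrable_nn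
  proof
    show mv: "(\<lambda>z. v (fst z) (snd z)) \<in> borel_measurable N" using m by (simp add: split_beta')
    have "(\<integral>\<^sup>+z. ennreal ((norm (v (fst z) (snd z)))\<^sup>2) \<partial>N) = (\<integral>\<^sup>+s. (\<integral>\<^sup>+\<omega>. ennreal ((norm (v s \<omega>))\<^sup>2) \<partial>M) \<partial>L)"
      using mv by (subst nn_integral_fst[symmetric]) auto
    also have "\<dots> \<le> (\<integral>\<^sup>+s. ?K \<partial>L)" by (intro nn_integral_mono le) simp
    also have "\<dots> < \<infinity>"
      using K top.not_eq_extremum[THEN iffD1, OF L.emeasure_finite[of "{t..T}"]]
      by (auto simp: ennreal_mult_less_top)
    finally show "(\<integral>\<^sup>+z. ennreal ((norm (v (fst z) (snd z)))\<^sup>2) \<partial>N) < \<infinity>" .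
  qed
qed

lemma integrable_L_imp_set_integrable:
  fixes \<beta> :: "real \<Rightarrow> 'c::euclidean_space"
  assumes "integrable L \<beta>" "A \<in> sets borel" "A \<subseteq> {t..T}"
  shows "set_integrable lborel A \<beta>"
proof -
  have "set_integrable lborel {t..T} \<beta>"
    using assms(1) by (simp add: set_integrable_def integrable_restrict_space)
  then show ?thesis by (rule set_integrable_subset) (use assms in auto)
qed

end

section \<open>The energy estimate\<close>

lemma young: "K > 0 \<Longrightarrow> 2 * (u * v) \<le> K * u\<^sup>2 + v\<^sup>2 / K" for K u v :: real
proof -
  assume K: "K > 0"
  have "0 \<le> (K * u - v)\<^sup>2 / K" using K by simp
  also have "\<dots> = K * u\<^sup>2 + v\<^sup>2 / K - 2 * (u * v)" using K by (simp add: field_simps power2_eq_square)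
  finally show ?thesis by simp
qed

lemma integral_norm_square: "(\<integral>z. u z \<bullet> u z \<partial>K) = (\<integral>z. (norm (u z))\<^sup>2 \<partial>K)"
  by (simp add: power2_norm_eq_inner)

lemma square_sum_le: "(u + v)\<^sup>2 \<le> 2 * u\<^sup>2 + 2 * v\<^sup>2" for u v :: real
  using sum_squares_bound[of u v] by (simp add: power2_sum)

text \<open>Use \<open>u \<le> u\<^sup>2 / \<surd>\<epsilon> + \<surd>\<epsilon>\<close>: a second moment of
  order \<open>\<epsilon>\<close> gives a first moment of order \<open>\<surd>\<epsilon>\<close>.\<close>

lemma (in finite_measure) integral_norm_le_sqrt:
  fixes u :: "'a \<Rightarrow> 'b::euclidean_space"
  assumes u: "square_integrable M u" and e: "\<epsilon> > 0" and b: "(\<integral>x. (norm (u x))\<^sup>2 \<partial>M) \<le> c * \<epsilon>"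
  shows "(\<integral>x. norm (u x) \<partial>M) \<le> (c + measure M (space M)) * sqrt \<epsilon>"
proof -
  have s: "sqrt \<epsilon> > 0" using e by simp
  have *: "a \<le> a\<^sup>2 / sqrt \<epsilon> + sqrt \<epsilon>" for a
  proof -
    have "0 \<le> (a - sqrt \<epsilon>)\<^sup>2 + a\<^sup>2 + (sqrt \<epsilon>)\<^sup>2" by simp
    then have "a * sqrt \<epsilon> \<le> a\<^sup>2 + (sqrt \<epsilon>)\<^sup>2" by (simp add: power2_diff)
    then have "a \<le> (a\<^sup>2 + (sqrt \<epsilon>)\<^sup>2) / sqrt \<epsilon>" using s by (simp add: field_simps)
    also have "\<dots> = a\<^sup>2 / sqrt \<epsilon> + sqrt \<epsilon>" using s e by (simp add: add_divide_distrib real_div_sqrt)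
    finally show ?thesis .
  qed
  have "(\<integral>x. norm (u x) \<partial>M) \<le> (\<integral>x. (norm (u x))\<^sup>2 / sqrt \<epsilon> + sqrt \<epsilon> \<partial>M)"
    using integrable_norm[OF square_integrable_integrable[OF u]] square_integrable_norm[OF u] *
    by (intro integral_mono) auto
  also have "\<dots> = (\<integral>x. (norm (u x))\<^sup>2 \<partial>M) / sqrt \<epsilon> + measure M (space M) * sqrt \<epsilon>"
    using u by (subst Bochner_Integration.integral_add) (auto simp: square_integrable_norm)
  also have "\<dots> \<le> c * \<epsilon> / sqrt \<epsilon> + measure M (space M) * sqrt \<epsilon>"
    using b s by (intro add_right_mono divide_right_mono) auto
  also have "c * \<epsilon> / sqrt \<epsilon> = c * sqrt \<epsilon>" using e real_div_sqrt[of \<epsilon>] by (simp add: times_divide_eq_right[symmetric] del: times_divide_eq_right)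
  finally show ?thesis by (simp add: algebra_simps)
qed

context fbsde
begin

definition "sig0 s = \<sigma> s (xx s) (yy s)"

lemma path_continuous:
  "continuous_on {t..T} (\<lambda>s. f s (xx s) (yy s))" "continuous_on {t..T} (\<lambda>s. g s (xx s) (yy s) 0)"
  "continuous_on {t..T} sig0"
proof -
  have c: "continuous_on {t..T} (\<lambda>s. (s, xx s, yy s))" "continuous_on {t..T} (\<lambda>s. (s, xx s, yy s, 0 :: real^'d^'n))"
    by (intro continuous_intros xx_cont yy_cont)+
  have sub: "(\<lambda>s. (s, xx s, yy s)) ` {t..T} \<subseteq> {0..T} \<times> UNIV" "(\<lambda>s. (s, xx s, yy s, 0 :: real^'d^'n)) ` {t..T} \<subseteq> {0..T} \<times> UNIV"
    using t by auto
  show "continuous_on {t..T} (\<lambda>s. f s (xx s) (yy s))"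
    using continuous_on_compose2[OF f_joint c(1) sub(1)] by simp
  show "continuous_on {t..T} (\<lambda>s. g s (xx s) (yy s) 0)"
    using continuous_on_compose2[OF g_joint c(2) sub(2)] by simp
  show "continuous_on {t..T} sig0"
    using continuous_on_compose2[OF \<sigma>_joint c(1) sub(1)] by (simp add: sig0_def[abs_def])
qed

lemma integrable_L_continuous:
  fixes u :: "real \<Rightarrow> 'c::euclidean_space"
  assumes "continuous_on {t..T} u"
  shows "integrable L u"
  using borel_integrable_atLeastAtMost'[OF assms] by (simp add: set_integrable_def integrable_restrict_space)

text \<open>\<open>Kback\<close> bounds \<open>Z\<close> and \<open>dY t\<close> by the energy of \<open>(dX,
  dY)\<close>, and \<open>Kenergy * \<epsilon>\<close> bounds this energy. That neither depends on
  \<open>\<epsilon>\<close> is what makes the estimate converge.\<close>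

definition "Ssig0 = (\<integral>z. (norm (sig0 (fst z)))\<^sup>2 \<partial>N)"
definition "Kback = 3 * C1 + 3 * C1\<^sup>2"
definition "Kenergy = 2 * Kback * Ssig0 / C2\<^sup>2"

lemma K_nonneg: "Ssig0 \<ge> 0" "Kback > 0" "Kenergy \<ge> 0"
  using C1 C2 by (auto simp: Ssig0_def Kback_def Kenergy_def add_pos_pos intro!: divide_nonneg_nonneg mult_nonneg_nonneg)

end

text \<open>One solution of the FBSDE, with both stochastic integrals made explicit.\<close>

locale fbsde_sol = fbsde T P M t f \<sigma> g h x xx yy C1 C2
  for T and P M :: "(real \<Rightarrow> real ^ 'd) measure" and t
    and f :: "real \<Rightarrow> real^'n \<Rightarrow> real^'n \<Rightarrow> real^'n" and \<sigma> :: "real \<Rightarrow> real^'n \<Rightarrow> real^'n \<Rightarrow> real^'d^'n"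
    and g h x xx yy C1 C2 +
  fixes \<epsilon> :: real and X Y :: "real \<Rightarrow> (real \<Rightarrow> real^'d) \<Rightarrow> real^'n" and Z :: "real \<Rightarrow> (real \<Rightarrow> real^'d) \<Rightarrow> real^'d^'n"
    and I J
  assumes eps: "\<epsilon> \<in> {0<..1}"
    and X: "X \<in> S2 M F t T" and Y: "Y \<in> S2 M F t T" and Z: "Z \<in> M2 M F t T"
    and I: "has_ito_integral M F W t T (\<lambda>r \<omega>. \<sigma> r (X r \<omega>) (Y r \<omega>)) I"
    and J: "has_ito_integral M F W t T Z J"
    and eq: "AE \<omega> in M. \<forall>s\<in>{t..T}.
            X s \<omega> = x + (LINT r:{t..s}|lborel. f r (X r \<omega>) (Y r \<omega>)) + sqrt \<epsilon> *\<^sub>R I s \<omega> \<and>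
            Y s \<omega> = h (X T \<omega>) + (LINT r:{s..T}|lborel. g r (X r \<omega>) (Y r \<omega>) (Z r \<omega>)) - (J T \<omega> - J s \<omega>)"
begin

definition "dX s \<omega> = X s \<omega> - xx s"
definition "dY s \<omega> = Y s \<omega> - yy s"
definition "df s \<omega> = f s (X s \<omega>) (Y s \<omega>) - f s (xx s) (yy s)"
definition "dg s \<omega> = g s (X s \<omega>) (Y s \<omega>) (Z s \<omega>) - g s (xx s) (yy s) 0"
definition "sig s \<omega> = \<sigma> s (X s \<omega>) (Y s \<omega>)"

lemma T_in: "T \<in> {t..T}" and t_in: "t \<in> {t..T}" using t by auto

lemma sqN_Z: "sqN Z" using M2_square_integrable[OF Z] by (simp add: split_beta')

lemma sqN_sig: "sqN sig"
  using M2_square_integrable[of "\<lambda>r \<omega>. \<sigma> r (X r \<omega>) (Y r \<omega>)"] I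
  by (simp add: split_beta' sig_def has_ito_integral_def)

lemma sqN_sig0: "sqN (\<lambda>s \<omega>. sig0 s)" by (rule sqN_deterministic[OF path_continuous(3)])

lemma sqN_dX: "sqN dX" and sqN_dY: "sqN dY"
  unfolding dX_def dY_def
  by (intro square_integrable_diff S2_square_integrable(1)[OF X] S2_square_integrable(1)[OF Y]
      sqN_deterministic xx_cont yy_cont)+

lemma sq_dX: "s \<in> {t..T} \<Longrightarrow> square_integrable M (dX s)" and sq_dY: "s \<in> {t..T} \<Longrightarrow> square_integrable M (dY s)"
proof -
  have c: "square_integrable M (\<lambda>\<omega>. v)" for v :: "real^'n" by (rule square_integrable_bounded[of _ "norm v"]) auto
  show "s \<in> {t..T} \<Longrightarrow> square_integrable M (dX s)" "s \<in> {t..T} \<Longrightarrow> square_integrable M (dY s)"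
    unfolding dX_def[abs_def] dY_def[abs_def]
    by (intro square_integrable_diff S2_square_integrable(2)[OF X] S2_square_integrable(2)[OF Y] c; assumption)+
qed

lemma norm_df: "s \<in> {0..T} \<Longrightarrow> norm (df s \<omega>) \<le> C1 * (norm (dX s \<omega>) + norm (dY s \<omega>))"
  and norm_dg: "s \<in> {0..T} \<Longrightarrow> norm (dg s \<omega>) \<le> C1 * (norm (dX s \<omega>) + norm (dY s \<omega>) + norm (Z s \<omega>))"
  and norm_sig: "s \<in> {0..T} \<Longrightarrow> norm (sig s \<omega> - sig0 s) \<le> C1 * (norm (dX s \<omega>) + norm (dY s \<omega>))"
  using f_lip g_lip[of s "X s \<omega>" "Y s \<omega>" "Z s \<omega>" "xx s" "yy s" 0] \<sigma>_lip
  by (simp_all add: df_def dg_def sig_def sig0_def dX_def dY_def)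

lemma sqN_norm: "sqN u \<Longrightarrow> sqN (\<lambda>s \<omega>. norm (u s \<omega>))" for u :: "real \<Rightarrow> (real \<Rightarrow> real^'d) \<Rightarrow> 'c::euclidean_space"
  by (auto simp: square_integrable_def)

lemma sqN_df: "sqN df"
proof (rule square_integrable_bound[OF square_integrable_scaleR[OF square_integrable_add[OF sqN_norm[OF sqN_dX] sqN_norm[OF sqN_dY]], of C1]])
  have "(\<lambda>z. (\<lambda>w. f (fst w) (fst (snd w)) (snd (snd w))) (fst z, X (fst z) (snd z), Y (fst z) (snd z))) \<in> borel_measurable N"
    by (rule joint_measurable[OF f_joint fst_N_measurable])
      (use fst_N_range square_integrable_measurable[OF S2_square_integrable(1)[OF X]]
        square_integrable_measurable[OF S2_square_integrable(1)[OF Y]] in auto)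
  then show "(\<lambda>z. df (fst z) (snd z)) \<in> borel_measurable N"
    using square_integrable_measurable[OF sqN_deterministic[OF path_continuous(1)]]
    unfolding df_def by simp
  show "AE z in N. norm (df (fst z) (snd z)) \<le> norm (C1 *\<^sub>R (norm (dX (fst z) (snd z)) + norm (dY (fst z) (snd z))))"
    using norm_df fst_N_range C1 by (intro AE_I2) (simp add: abs_mult)
qed

lemma sqN_dg: "sqN dg"
proof (rule square_integrable_bound[OF square_integrable_scaleR[OF square_integrable_add[OF
        square_integrable_add[OF sqN_norm[OF sqN_dX] sqN_norm[OF sqN_dY]] sqN_norm[OF sqN_Z]], of C1]])
  have "(\<lambda>z. (\<lambda>w. g (fst w) (fst (snd w)) (fst (snd (snd w))) (snd (snd (snd w))))
      (fst z, X (fst z) (snd z), Y (fst z) (snd z), Z (fst z) (snd z))) \<in> borel_measurable N"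
    by (rule joint_measurable[OF g_joint fst_N_measurable])
      (use fst_N_range square_integrable_measurable[OF S2_square_integrable(1)[OF X]]
        square_integrable_measurable[OF S2_square_integrable(1)[OF Y]] square_integrable_measurable[OF sqN_Z] in auto)
  then show "(\<lambda>z. dg (fst z) (snd z)) \<in> borel_measurable N"
    using square_integrable_measurable[OF sqN_deterministic[OF path_continuous(2)]]
    unfolding dg_def by simp
  show "AE z in N. norm (dg (fst z) (snd z)) \<le>
      norm (C1 *\<^sub>R (norm (dX (fst z) (snd z)) + norm (dY (fst z) (snd z)) + norm (Z (fst z) (snd z))))"
    using norm_dg fst_N_range C1 by (intro AE_I2) (simp add: abs_mult)
qed

lemma F_coeff:
  assumes s: "s \<in> {t..T}"
  shows "df s \<in> borel_measurable (F s)" "dg s \<in> borel_measurable (F s)"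
    "dX s \<in> borel_measurable (F s)" "dY s \<in> borel_measurable (F s)"
proof -
  have XF: "X s \<in> borel_measurable (F s)" "Y s \<in> borel_measurable (F s)"
    using S2_square_integrable(3)[OF X s] S2_square_integrable(3)[OF Y s] .
  have ZF: "Z s \<in> borel_measurable (F s)" using Z s unfolding M2_def adapted_processes_def by blast
  have c: "(\<lambda>\<omega>. s) \<in> borel_measurable (F s)" "\<And>\<omega>. \<omega> \<in> space (F s) \<Longrightarrow> s \<in> {0..T}" using s t by auto
  show "dX s \<in> borel_measurable (F s)" "dY s \<in> borel_measurable (F s)"
    unfolding dX_def[abs_def] dY_def[abs_def] using XF by auto
  show "df s \<in> borel_measurable (F s)"
    using joint_measurable[OF f_joint c borel_measurable_Pair[OF XF]] unfolding df_def[abs_def] by simp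
  show "dg s \<in> borel_measurable (F s)"
    using joint_measurable[OF g_joint c borel_measurable_Pair[OF XF(1) borel_measurable_Pair[OF XF(2) ZF]]]
    unfolding dg_def[abs_def] by simp
qed

lemma integrable_sections:
  "AE \<omega> in M. integrable L (\<lambda>r. df r \<omega>) \<and> integrable L (\<lambda>r. f r (X r \<omega>) (Y r \<omega>))
     \<and> integrable L (\<lambda>r. dg r \<omega>) \<and> integrable L (\<lambda>r. g r (X r \<omega>) (Y r \<omega>) (Z r \<omega>))"
  using sqN_sections(1)[OF sqN_df] sqN_sections(1)[OF sqN_dg]
proof eventually_elim
  case (elim \<omega>)
  have i: "integrable L (\<lambda>r. df r \<omega>)" "integrable L (\<lambda>r. dg r \<omega>)"
    using elim by (auto intro: L.square_integrable_integrable)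
  from Bochner_Integration.integrable_add[OF i(1) integrable_L_continuous[OF path_continuous(1)]]
    Bochner_Integration.integrable_add[OF i(2) integrable_L_continuous[OF path_continuous(2)]] i
  show ?case by (simp add: df_def dg_def)
qed

lemma eq_dX: "AE \<omega> in M. \<forall>s\<in>{t..T}. dX s \<omega> = 0 + (LINT r:{t..s}|lborel. df r \<omega>) + sqrt \<epsilon> *\<^sub>R I s \<omega>"
  using eq integrable_sections
proof eventually_elim
  case (elim \<omega>)
  show ?case
  proof
    fix s assume s: "s \<in> {t..T}"
    have "(LINT r:{t..s}|lborel. df r \<omega>) = (LINT r:{t..s}|lborel. f r (X r \<omega>) (Y r \<omega>)) - (LINT r:{t..s}|lborel. f r (xx r) (yy r))"
      unfolding df_def using s elim(2) integrable_L_continuous[OF path_continuous(1)]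
      by (intro set_integral_diff integrable_L_imp_set_integrable) auto
    then show "dX s \<omega> = 0 + (LINT r:{t..s}|lborel. df r \<omega>) + sqrt \<epsilon> *\<^sub>R I s \<omega>"
      using bspec[OF elim(1) s] limit_eq(1)[OF s] unfolding dX_def by simp
  qed
qed

lemma dY_backward: "AE \<omega> in M. \<forall>s\<in>{t..T}. dY s \<omega> = h (X T \<omega>) - h (xx T) + (LINT r:{s..T}|lborel. dg r \<omega>) - (J T \<omega> - J s \<omega>)"
  using eq integrable_sections
proof eventually_elim
  case (elim \<omega>)
  show ?case
  proof
    fix s assume s: "s \<in> {t..T}"
    have "(LINT r:{s..T}|lborel. dg r \<omega>) = (LINT r:{s..T}|lborel. g r (X r \<omega>) (Y r \<omega>) (Z r \<omega>)) - (LINT r:{s..T}|lborel. g r (xx r) (yy r) 0)"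
      unfolding dg_def using s elim(2) integrable_L_continuous[OF path_continuous(2)]
      by (intro set_integral_diff integrable_L_imp_set_integrable) auto
    then show "dY s \<omega> = h (X T \<omega>) - h (xx T) + (LINT r:{s..T}|lborel. dg r \<omega>) - (J T \<omega> - J s \<omega>)"
      using bspec[OF elim(1) s] limit_eq(2)[OF s] unfolding dY_def by simp
  qed
qed

lemma dY_final: "AE \<omega> in M. dY T \<omega> = h (X T \<omega>) - h (xx T)"
  using dY_backward integrable_sections
proof eventually_elim
  case (elim \<omega>)
  have "(LINT r:{T..T}|lborel. dg r \<omega>) = (\<integral>r. of_bool (T < r) *\<^sub>R dg r \<omega> \<partial>L)"
    using elim(2) by (intro set_integral_future T_in) auto
  also have "\<dots> = (\<integral>r. 0 \<partial>L)" by (intro Bochner_Integration.integral_cong) auto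
  finally show ?case using bspec[OF elim(1) T_in] by simp
qed

lemma J_mart: "L2_martingale J" by (rule ito_integral_martingale[OF J])
lemma I_mart: "L2_martingale I" by (rule ito_integral_martingale[OF I])

text \<open>The backward equation is read forward from time \<open>t\<close>, so that the product rule applies
  to it.\<close>

lemma eq_dY: "AE \<omega> in M. \<forall>s\<in>{t..T}. dY s \<omega> = dY t \<omega> + (LINT r:{t..s}|lborel. - dg r \<omega>) + J s \<omega>"
  using dY_backward integrable_sections L2_martingaleD(3)[OF J_mart]
proof eventually_elim
  case (elim \<omega>)
  have ib: "integrable L (\<lambda>r. dg r \<omega>)" using elim by auto
  show ?case
  proof
    fix s assume s: "s \<in> {t..T}"
    have m: "(\<lambda>r. dg r \<omega>) \<in> borel_measurable L" using ib by auto
    have 1: "(LINT r:{t..T}|lborel. dg r \<omega>) = (LINT r:{t..s}|lborel. dg r \<omega>) + (LINT r:{s..T}|lborel. dg r \<omega>)"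
      using past_plus_future[OF ib s] set_integral_past[OF m s] set_integral_future[OF m s] set_integral_full[of "\<lambda>r. dg r \<omega>"] by simp
    have 2: "(LINT r:{t..s}|lborel. - dg r \<omega>) = - (LINT r:{t..s}|lborel. dg r \<omega>)"
      by (simp add: set_lebesgue_integral_def)
    show "dY s \<omega> = dY t \<omega> + (LINT r:{t..s}|lborel. - dg r \<omega>) + J s \<omega>"
      using bspec[OF elim(1) s] bspec[OF elim(1) t_in] elim(3) unfolding 1 2 by simp
  qed
qed

lemma sqN_neg_dg: "sqN (\<lambda>s \<omega>. - dg s \<omega>)" using square_integrable_uminus[OF sqN_dg] .

lemma product_xy:
  "(\<integral>\<omega>. dX T \<omega> \<bullet> dY T \<omega> \<partial>M) = (\<integral>z. df (fst z) (snd z) \<bullet> dY (fst z) (snd z) - dX (fst z) (snd z) \<bullet> dg (fst z) (snd z)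
     + sqrt \<epsilon> * (sig (fst z) (snd z) \<bullet> Z (fst z) (snd z)) \<partial>N)"
proof -
  have z: "square_integrable M (\<lambda>\<omega>. 0 :: real^'n)" by (rule square_integrable_bounded[of _ 0]) auto
  have "(\<integral>\<omega>. dX T \<omega> \<bullet> dY T \<omega> \<partial>M) = (\<integral>\<omega>. 0 \<bullet> dY t \<omega> \<partial>M)
     + (\<integral>z. df (fst z) (snd z) \<bullet> dY (fst z) (snd z) \<partial>N) + (\<integral>z. dX (fst z) (snd z) \<bullet> - dg (fst z) (snd z) \<partial>N)
     + (\<integral>\<omega>. (sqrt \<epsilon> *\<^sub>R I T \<omega>) \<bullet> J T \<omega> \<partial>M)"
    by (rule ito_product_formula[OF sqN_dX sqN_dY sqN_df sqN_neg_dg F_coeff(1) _ L2_martingale_scaleR[OF I_mart] J_mart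
          z _ sq_dY[OF t_in] F_coeff(4)[OF t_in] sq_dX[OF T_in] sq_dY[OF T_in] eq_dX eq_dY])
      (use F_coeff(2) in auto)
  also have "(\<integral>\<omega>. (sqrt \<epsilon> *\<^sub>R I T \<omega>) \<bullet> J T \<omega> \<partial>M) = sqrt \<epsilon> * (\<integral>z. sig (fst z) (snd z) \<bullet> Z (fst z) (snd z) \<partial>N)"
    using ito_isometry[OF I J] by (simp add: sig_def split_beta')
  finally show ?thesis
    using integrable_inner[OF sqN_df sqN_dY] integrable_inner[OF sqN_dX sqN_dg] integrable_inner[OF sqN_sig sqN_Z]
    by simp
qed

lemma product_yy:
  "(\<integral>\<omega>. (norm (dY T \<omega>))\<^sup>2 \<partial>M) = (\<integral>\<omega>. (norm (dY t \<omega>))\<^sup>2 \<partial>M)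
     - 2 * (\<integral>z. dY (fst z) (snd z) \<bullet> dg (fst z) (snd z) \<partial>N) + (\<integral>z. (norm (Z (fst z) (snd z)))\<^sup>2 \<partial>N)"
proof -
  have "(\<integral>\<omega>. dY T \<omega> \<bullet> dY T \<omega> \<partial>M) = (\<integral>\<omega>. dY t \<omega> \<bullet> dY t \<omega> \<partial>M)
     + (\<integral>z. - dg (fst z) (snd z) \<bullet> dY (fst z) (snd z) \<partial>N) + (\<integral>z. dY (fst z) (snd z) \<bullet> - dg (fst z) (snd z) \<partial>N)
     + (\<integral>\<omega>. J T \<omega> \<bullet> J T \<omega> \<partial>M)"
    by (rule ito_product_formula[OF sqN_dY sqN_dY sqN_neg_dg sqN_neg_dg _ _ J_mart J_mart
          sq_dY[OF t_in] F_coeff(4)[OF t_in] sq_dY[OF t_in] F_coeff(4)[OF t_in] sq_dY[OF T_in] sq_dY[OF T_in] eq_dY eq_dY])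
      (use F_coeff(2) in auto)
  also have "(\<integral>\<omega>. J T \<omega> \<bullet> J T \<omega> \<partial>M) = (\<integral>z. Z (fst z) (snd z) \<bullet> Z (fst z) (snd z) \<partial>N)"
    using ito_isometry[OF J J] by (simp add: split_beta')
  finally show ?thesis
    unfolding integral_norm_square by (simp add: inner_commute)
qed

definition "\<alpha> = (\<integral>z. (norm (dX (fst z) (snd z)))\<^sup>2 \<partial>N)"
definition "\<beta> = (\<integral>z. (norm (dY (fst z) (snd z)))\<^sup>2 \<partial>N)"
definition "\<zeta> = (\<integral>z. (norm (Z (fst z) (snd z)))\<^sup>2 \<partial>N)"
definition "\<gamma> = (\<integral>\<omega>. (norm (dX T \<omega>))\<^sup>2 \<partial>M)"
definition "\<nu> = (\<integral>\<omega>. (norm (dY t \<omega>))\<^sup>2 \<partial>M)"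

lemma nonneg: "\<alpha> \<ge> 0" "\<beta> \<ge> 0" "\<zeta> \<ge> 0" "\<gamma> \<ge> 0" "\<nu> \<ge> 0"
  by (auto simp: \<alpha>_def \<beta>_def \<zeta>_def \<gamma>_def \<nu>_def)

lemmas sqs = square_integrable_norm[OF sqN_dX] square_integrable_norm[OF sqN_dY] square_integrable_norm[OF sqN_Z]
  square_integrable_norm[OF sqN_sig0]

text \<open>The product rule for \<open>dX \<bullet> dY\<close> and the two monotonicity conditions. The
  parameter \<open>K\<close> of Young's inequality is fixed only in \<open>energy_estimate\<close>,
  where \<open>\<zeta>\<close> is absorbed.\<close>

lemma monotonicity_estimate:
  assumes K: "K > 0"
  shows "C2 * (\<gamma> + \<alpha> + \<beta>) \<le> (K * \<epsilon> * Ssig0 + \<zeta> / K) / 2"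
proof -
  have e: "\<epsilon> \<ge> 0" using eps by auto
  have "C2 * \<gamma> = (\<integral>\<omega>. C2 * (norm (dX T \<omega>))\<^sup>2 \<partial>M)" by (simp add: \<gamma>_def)
  also have "\<dots> \<le> (\<integral>\<omega>. dX T \<omega> \<bullet> dY T \<omega> \<partial>M)"
  proof (rule integral_mono_AE)
    show "AE \<omega> in M. C2 * (norm (dX T \<omega>))\<^sup>2 \<le> dX T \<omega> \<bullet> dY T \<omega>"
      using dY_final
    proof eventually_elim
      case (elim \<omega>)
      then show ?case using h_monotone[of "xx T" "X T \<omega>"] h_monotone[of "X T \<omega>" "xx T"]
        by (simp add: dX_def inner_commute)
    qed
  qed (use square_integrable_norm[OF sq_dX[OF T_in]] integrable_inner[OF sq_dX[OF T_in] sq_dY[OF T_in]] in auto)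
  also have "\<dots> = (\<integral>z. df (fst z) (snd z) \<bullet> dY (fst z) (snd z) - dX (fst z) (snd z) \<bullet> dg (fst z) (snd z)
     + sqrt \<epsilon> * (sig (fst z) (snd z) \<bullet> Z (fst z) (snd z)) \<partial>N)" by (rule product_xy)
  also have "\<dots> \<le> (\<integral>z. - C2 * ((norm (dX (fst z) (snd z)))\<^sup>2 + (norm (dY (fst z) (snd z)))\<^sup>2)
      + (K * \<epsilon> * (norm (sig0 (fst z)))\<^sup>2 + (norm (Z (fst z) (snd z)))\<^sup>2 / K) / 2 \<partial>N)"
  proof (rule integral_mono)
    show "integrable N (\<lambda>z. df (fst z) (snd z) \<bullet> dY (fst z) (snd z) - dX (fst z) (snd z) \<bullet> dg (fst z) (snd z)
     + sqrt \<epsilon> * (sig (fst z) (snd z) \<bullet> Z (fst z) (snd z)))"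
      using integrable_inner[OF sqN_df sqN_dY] integrable_inner[OF sqN_dX sqN_dg] integrable_inner[OF sqN_sig sqN_Z] by simp
    show "integrable N (\<lambda>z. - C2 * ((norm (dX (fst z) (snd z)))\<^sup>2 + (norm (dY (fst z) (snd z)))\<^sup>2)
      + (K * \<epsilon> * (norm (sig0 (fst z)))\<^sup>2 + (norm (Z (fst z) (snd z)))\<^sup>2 / K) / 2)"
      using sqs by simp
    fix z assume "z \<in> space N"
    then have s: "fst z \<in> {0..T}" using fst_N_range by blast
    let ?s = "fst z" and ?w = "snd z"
    \<comment> \<open>Monotonicity between \<open>(X, Y, Z)\<close> and \<open>(xx, yy, 0)\<close>.\<close>
    have 1: "df ?s ?w \<bullet> dY ?s ?w - dg ?s ?w \<bullet> dX ?s ?w + sqrt \<epsilon> * ((sig ?s ?w - sig0 ?s) \<bullet> (Z ?s ?w))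
       \<le> - C2 * ((norm (dX ?s ?w))\<^sup>2 + (norm (dY ?s ?w))\<^sup>2)"
      using monotone[OF eps s, of "X ?s ?w" "Y ?s ?w" "xx ?s" "yy ?s" "Z ?s ?w" 0]
      by (simp add: df_def dg_def dX_def dY_def sig_def sig0_def)
    have "2 * (sqrt \<epsilon> * (sig0 ?s \<bullet> Z ?s ?w)) \<le> 2 * ((sqrt \<epsilon> * norm (sig0 ?s)) * norm (Z ?s ?w))"
      using norm_cauchy_schwarz[of "sig0 ?s" "Z ?s ?w"] e by (simp add: mult.assoc mult_left_mono)
    also have "\<dots> \<le> K * (sqrt \<epsilon> * norm (sig0 ?s))\<^sup>2 + (norm (Z ?s ?w))\<^sup>2 / K" by (rule young[OF K])
    also have "(sqrt \<epsilon> * norm (sig0 ?s))\<^sup>2 = \<epsilon> * (norm (sig0 ?s))\<^sup>2" using e by (simp add: power_mult_distrib)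
    finally have 2: "sqrt \<epsilon> * (sig0 ?s \<bullet> Z ?s ?w) \<le> (K * \<epsilon> * (norm (sig0 ?s))\<^sup>2 + (norm (Z ?s ?w))\<^sup>2 / K) / 2"
      by (simp add: mult.assoc)
    show "df ?s ?w \<bullet> dY ?s ?w - dX ?s ?w \<bullet> dg ?s ?w + sqrt \<epsilon> * (sig ?s ?w \<bullet> Z ?s ?w)
      \<le> - C2 * ((norm (dX ?s ?w))\<^sup>2 + (norm (dY ?s ?w))\<^sup>2) + (K * \<epsilon> * (norm (sig0 ?s))\<^sup>2 + (norm (Z ?s ?w))\<^sup>2 / K) / 2"
    proof -
      have "sqrt \<epsilon> * ((sig ?s ?w - sig0 ?s) \<bullet> Z ?s ?w) = sqrt \<epsilon> * (sig ?s ?w \<bullet> Z ?s ?w) - sqrt \<epsilon> * (sig0 ?s \<bullet> Z ?s ?w)"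
        by (simp add: inner_diff_left right_diff_distrib)
      then show ?thesis using 1 2 inner_commute[of "dX ?s ?w" "dg ?s ?w"] by linarith
    qed
  qed
  also have "\<dots> = - C2 * (\<alpha> + \<beta>) + (K * \<epsilon> * Ssig0 + \<zeta> / K) / 2"
    using sqs by (simp add: \<alpha>_def \<beta>_def \<zeta>_def Ssig0_def)
  finally show ?thesis by (simp add: algebra_simps)
qed

text \<open>The product rule for \<open>dY \<bullet> dY\<close>. Half of \<open>\<zeta>\<close> is spent on the
  \<open>Z\<close>-dependence of the driver.\<close>

lemma backward_estimate: "\<nu> + \<zeta> / 2 \<le> Kback * (\<gamma> + \<alpha> + \<beta>)"
proof -
  have "(\<integral>\<omega>. (norm (dY T \<omega>))\<^sup>2 \<partial>M) \<le> (\<integral>\<omega>. C1\<^sup>2 * (norm (dX T \<omega>))\<^sup>2 \<partial>M)"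
  proof (rule integral_mono_AE)
    show "AE \<omega> in M. (norm (dY T \<omega>))\<^sup>2 \<le> C1\<^sup>2 * (norm (dX T \<omega>))\<^sup>2"
      using dY_final
    proof eventually_elim
      case (elim \<omega>)
      have "norm (dY T \<omega>) \<le> C1 * norm (dX T \<omega>)" unfolding elim dX_def by (rule h_lip)
      then have "(norm (dY T \<omega>))\<^sup>2 \<le> (C1 * norm (dX T \<omega>))\<^sup>2" by (intro power_mono) auto
      then show ?case by (simp add: power_mult_distrib)
    qed
  qed (use square_integrable_norm[OF sq_dX[OF T_in]] square_integrable_norm[OF sq_dY[OF T_in]] in auto)
  then have 1: "(\<integral>\<omega>. (norm (dY T \<omega>))\<^sup>2 \<partial>M) \<le> C1\<^sup>2 * \<gamma>" by (simp add: \<gamma>_def)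
  have "(\<integral>z. 2 * (dY (fst z) (snd z) \<bullet> dg (fst z) (snd z)) \<partial>N) \<le>
     (\<integral>z. C1 * (norm (dX (fst z) (snd z)))\<^sup>2 + (3 * C1 + 2 * C1\<^sup>2) * (norm (dY (fst z) (snd z)))\<^sup>2 + (norm (Z (fst z) (snd z)))\<^sup>2 / 2 \<partial>N)"
  proof (rule integral_mono)
    show "integrable N (\<lambda>z. 2 * (dY (fst z) (snd z) \<bullet> dg (fst z) (snd z)))"
      using integrable_inner[OF sqN_dY sqN_dg] by simp
    show "integrable N (\<lambda>z. C1 * (norm (dX (fst z) (snd z)))\<^sup>2 + (3 * C1 + 2 * C1\<^sup>2) * (norm (dY (fst z) (snd z)))\<^sup>2 + (norm (Z (fst z) (snd z)))\<^sup>2 / 2)"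
      using sqs by simp
    fix z assume "z \<in> space N"
    then have s: "fst z \<in> {0..T}" using fst_N_range by blast
    define u v w where "u = norm (dX (fst z) (snd z))" and "v = norm (dY (fst z) (snd z))" and "w = norm (Z (fst z) (snd z))"
    have "dY (fst z) (snd z) \<bullet> dg (fst z) (snd z) \<le> v * norm (dg (fst z) (snd z))"
      unfolding v_def by (rule norm_cauchy_schwarz)
    also have "\<dots> \<le> v * (C1 * (u + v + w))"
      unfolding u_def v_def w_def by (intro mult_left_mono norm_dg[OF s]) auto
    finally have "2 * (dY (fst z) (snd z) \<bullet> dg (fst z) (snd z)) \<le> C1 * (2 * (u * v)) + 2 * C1 * v\<^sup>2 + 2 * ((C1 * v) * w)"
      by (simp add: algebra_simps power2_eq_square)
    also have "\<dots> \<le> C1 * (u\<^sup>2 + v\<^sup>2) + 2 * C1 * v\<^sup>2 + (2 * (C1 * v)\<^sup>2 + w\<^sup>2 / 2)"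
      using young[of 1 u v] young[of 2 "C1 * v" w] C1 by (intro add_mono mult_left_mono) auto
    also have "\<dots> = C1 * u\<^sup>2 + (3 * C1 + 2 * C1\<^sup>2) * v\<^sup>2 + w\<^sup>2 / 2" by (simp add: algebra_simps power_mult_distrib)
    finally show "2 * (dY (fst z) (snd z) \<bullet> dg (fst z) (snd z)) \<le> C1 * (norm (dX (fst z) (snd z)))\<^sup>2 + (3 * C1 + 2 * C1\<^sup>2) * (norm (dY (fst z) (snd z)))\<^sup>2 + (norm (Z (fst z) (snd z)))\<^sup>2 / 2"
      unfolding u_def v_def w_def .
  qed
  also have "\<dots> = C1 * \<alpha> + (3 * C1 + 2 * C1\<^sup>2) * \<beta> + \<zeta> / 2"
    using sqs by (simp add: \<alpha>_def \<beta>_def \<zeta>_def)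
  finally have 2: "2 * (\<integral>z. dY (fst z) (snd z) \<bullet> dg (fst z) (snd z) \<partial>N) \<le> C1 * \<alpha> + (3 * C1 + 2 * C1\<^sup>2) * \<beta> + \<zeta> / 2"
    by simp
  have "\<nu> + \<zeta> / 2 \<le> C1\<^sup>2 * \<gamma> + C1 * \<alpha> + (3 * C1 + 2 * C1\<^sup>2) * \<beta>"
    using product_yy[folded \<nu>_def \<zeta>_def] 1 2 by simp
  also have "\<dots> \<le> Kback * \<gamma> + Kback * \<alpha> + Kback * \<beta>"
    using C1 nonneg by (intro add_mono mult_right_mono) (auto simp: Kback_def)
  finally show ?thesis by (simp add: algebra_simps)
qed

lemma energy_estimate: "\<gamma> + \<alpha> + \<beta> \<le> Kenergy * \<epsilon>" "\<nu> \<le> Kback * Kenergy * \<epsilon>"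
proof -
  \<comment> \<open>This \<open>K\<close> makes the \<open>\<zeta>\<close>-term at most half of the left-hand side.\<close>
  let ?G = "\<gamma> + \<alpha> + \<beta>" and ?K = "2 * Kback / C2"
  have K: "?K > 0" using K_nonneg C2 by simp
  have "C2 * ?G \<le> (?K * \<epsilon> * Ssig0 + \<zeta> / ?K) / 2" by (rule monotonicity_estimate[OF K])
  also have "\<dots> = Kback * Ssig0 * \<epsilon> / C2 + C2 / (2 * Kback) * (\<zeta> / 2)" using C2 K_nonneg by (simp add: field_simps)
  also have "\<dots> \<le> Kback * Ssig0 * \<epsilon> / C2 + C2 / (2 * Kback) * (Kback * ?G)"
    using backward_estimate nonneg C2 K_nonneg by (intro add_left_mono mult_left_mono) auto
  also have "\<dots> = Kback * Ssig0 * \<epsilon> / C2 + C2 * ?G / 2" using K_nonneg by (simp add: field_simps)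
  finally have "C2 * ?G / 2 \<le> Kback * Ssig0 * \<epsilon> / C2" by linarith
  then show G: "?G \<le> Kenergy * \<epsilon>" using C2 by (simp add: Kenergy_def field_simps power2_eq_square)
  have "\<nu> \<le> Kback * ?G" using backward_estimate nonneg by linarith
  also have "\<dots> \<le> Kback * (Kenergy * \<epsilon>)" using G K_nonneg by (intro mult_left_mono) auto
  finally show "\<nu> \<le> Kback * Kenergy * \<epsilon>" by simp
qed

end

section \<open>Deviation of the forward component\<close>

context fbsde
begin

definition "vol = measure N (space N)"
text \<open>Bounds the second moment of the stochastic integral in the forward equation.\<close>

definition "Knoise = 2 * Ssig0 + 4 * C1\<^sup>2 * Kenergy"

lemma continuous_set_integral:
  fixes \<beta> :: "real \<Rightarrow> real^'n"
  assumes "integrable L \<beta>"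
  shows "continuous_on {t..T} (\<lambda>s. LINT r:{t..s}|lborel. \<beta> r)"
proof -
  have i: "set_integrable lborel {t..s} \<beta>" if "s \<le> T" for s
    using that by (intro integrable_L_imp_set_integrable[OF assms]) auto
  have "continuous_on {t..T} (\<lambda>s. integral {t..s} \<beta>)"
    by (intro indefinite_integral_continuous_1 set_borel_integral_eq_integral(1) i) simp
  then show ?thesis
    by (rule continuous_on_eq) (use set_borel_integral_eq_integral(2)[OF i, symmetric] in auto)
qed

end

context fbsde_sol
begin

lemma integral_dX_dY:
  "(\<integral>z. norm (dX (fst z) (snd z)) \<partial>N) \<le> (Kenergy + vol) * sqrt \<epsilon>"
  "(\<integral>z. norm (dY (fst z) (snd z)) \<partial>N) \<le> (Kenergy + vol) * sqrt \<epsilon>"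
  "(\<integral>\<omega>. norm (dY t \<omega>) \<partial>M) \<le> (Kback * Kenergy + 1) * sqrt \<epsilon>"
proof -
  have e: "\<epsilon> > 0" using eps by simp
  show "(\<integral>z. norm (dX (fst z) (snd z)) \<partial>N) \<le> (Kenergy + vol) * sqrt \<epsilon>"
    unfolding vol_def by (rule N.integral_norm_le_sqrt[OF sqN_dX e])
      (use energy_estimate(1) nonneg in \<open>simp add: \<alpha>_def[symmetric]\<close>)
  show "(\<integral>z. norm (dY (fst z) (snd z)) \<partial>N) \<le> (Kenergy + vol) * sqrt \<epsilon>"
    unfolding vol_def by (rule N.integral_norm_le_sqrt[OF sqN_dY e])
      (use energy_estimate(1) nonneg in \<open>simp add: \<beta>_def[symmetric]\<close>)
  show "(\<integral>\<omega>. norm (dY t \<omega>) \<partial>M) \<le> (Kback * Kenergy + 1) * sqrt \<epsilon>"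
    using integral_norm_le_sqrt[OF sq_dY[OF t_in] e, of "Kback * Kenergy"] energy_estimate(2)
    by (simp add: \<nu>_def prob_space)
qed

lemma integral_df: "(\<integral>z. norm (df (fst z) (snd z)) \<partial>N) \<le> 2 * C1 * (Kenergy + vol) * sqrt \<epsilon>"
proof -
  have i: "integrable N (\<lambda>z. norm (dX (fst z) (snd z)))" "integrable N (\<lambda>z. norm (dY (fst z) (snd z)))"
    "integrable N (\<lambda>z. norm (df (fst z) (snd z)))"
    by (intro integrable_norm N.square_integrable_integrable sqN_dX sqN_dY sqN_df)+
  have "(\<integral>z. norm (df (fst z) (snd z)) \<partial>N) \<le> (\<integral>z. C1 * (norm (dX (fst z) (snd z)) + norm (dY (fst z) (snd z))) \<partial>N)"
    by (intro integral_mono norm_df) (use i fst_N_range in auto)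
  also have "\<dots> = C1 * ((\<integral>z. norm (dX (fst z) (snd z)) \<partial>N) + (\<integral>z. norm (dY (fst z) (snd z)) \<partial>N))"
    using i by simp
  also have "\<dots> \<le> C1 * ((Kenergy + vol) * sqrt \<epsilon> + (Kenergy + vol) * sqrt \<epsilon>)"
    using C1 integral_dX_dY by (intro mult_left_mono add_mono) auto
  finally show ?thesis by (simp add: algebra_simps)
qed

text \<open>By the isometry this is a bound on \<open>\<sigma>\<close> along the solution, whose difference from
  its value along the limit has a second moment bounded by the energy.\<close>

lemma integral_I: "(\<integral>\<omega>. (norm (I T \<omega>))\<^sup>2 \<partial>M) \<le> Knoise"
proof -
  have "(\<integral>\<omega>. I T \<omega> \<bullet> I T \<omega> \<partial>M) = (\<integral>z. sig (fst z) (snd z) \<bullet> sig (fst z) (snd z) \<partial>N)"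
    using ito_isometry[OF I I] by (simp add: sig_def split_beta')
  then have "(\<integral>\<omega>. (norm (I T \<omega>))\<^sup>2 \<partial>M) = (\<integral>z. (norm (sig (fst z) (snd z)))\<^sup>2 \<partial>N)"
    unfolding integral_norm_square .
  also have "\<dots> \<le> (\<integral>z. 2 * (norm (sig0 (fst z)))\<^sup>2 + 4 * C1\<^sup>2 * (norm (dX (fst z) (snd z)))\<^sup>2 + 4 * C1\<^sup>2 * (norm (dY (fst z) (snd z)))\<^sup>2 \<partial>N)"
  proof (rule integral_mono)
    fix z assume "z \<in> space N"
    then have s: "fst z \<in> {0..T}" using fst_N_range by blast
    define u v where "u = norm (dX (fst z) (snd z))" and "v = norm (dY (fst z) (snd z))"
    have "norm (sig (fst z) (snd z)) \<le> norm (sig0 (fst z)) + norm (sig (fst z) (snd z) - sig0 (fst z))"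
      using norm_triangle_ineq[of "sig0 (fst z)" "sig (fst z) (snd z) - sig0 (fst z)"] by simp
    also have "\<dots> \<le> norm (sig0 (fst z)) + C1 * (u + v)"
      unfolding u_def v_def using norm_sig[OF s] by simp
    finally have "(norm (sig (fst z) (snd z)))\<^sup>2 \<le> (norm (sig0 (fst z)) + C1 * (u + v))\<^sup>2"
      by (intro power_mono) auto
    also have "\<dots> \<le> 2 * (norm (sig0 (fst z)))\<^sup>2 + 2 * (C1 * (u + v))\<^sup>2" by (rule square_sum_le)
    also have "(C1 * (u + v))\<^sup>2 \<le> C1\<^sup>2 * (2 * u\<^sup>2 + 2 * v\<^sup>2)"
      unfolding power_mult_distrib by (intro mult_left_mono square_sum_le) auto
    finally show "(norm (sig (fst z) (snd z)))\<^sup>2 \<le> 2 * (norm (sig0 (fst z)))\<^sup>2 + 4 * C1\<^sup>2 * (norm (dX (fst z) (snd z)))\<^sup>2 + 4 * C1\<^sup>2 * (norm (dY (fst z) (snd z)))\<^sup>2"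
      unfolding u_def v_def by (simp add: algebra_simps)
  qed (use sqs square_integrable_norm[OF sqN_sig] in simp_all)
  also have "\<dots> = 2 * Ssig0 + 4 * C1\<^sup>2 * (\<alpha> + \<beta>)"
    using sqs by (simp add: Ssig0_def \<alpha>_def \<beta>_def algebra_simps)
  also have "\<dots> \<le> 2 * Ssig0 + 4 * C1\<^sup>2 * Kenergy"
  proof -
    have "\<alpha> + \<beta> \<le> Kenergy * \<epsilon>" using energy_estimate(1) nonneg by linarith
    also have "\<dots> \<le> Kenergy * 1" using eps K_nonneg by (intro mult_left_mono) auto
    finally show ?thesis using C1 by (intro add_left_mono mult_left_mono) auto
  qed
  finally show ?thesis by (simp add: Knoise_def)
qed

text \<open>Markov's inequality for the drift and the maximal inequality for the martingale part. If the event
  on the left were not measurable, its \<open>measure\<close> would be \<open>0\<close>.\<close>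

lemma deviation_probability:
  assumes \<delta>: "\<delta> > 0"
  shows "measure M {\<omega> \<in> space M. (SUP s\<in>{t..T}. ennreal (norm (X s \<omega> - xx s))) > ennreal \<delta>}
     \<le> 4 * C1 * (Kenergy + vol) / \<delta> * sqrt \<epsilon> + 4 * Knoise / \<delta>\<^sup>2 * \<epsilon>"
proof -
  have e: "\<epsilon> > 0" using eps by simp
  let ?S = "{\<omega> \<in> space M. (SUP s\<in>{t..T}. ennreal (norm (X s \<omega> - xx s))) > ennreal \<delta>}"
  \<comment> \<open>If \<open>dX\<close> exceeds \<open>\<delta>\<close>, then the drift or \<open>\<surd>\<epsilon> I\<close> exceeds \<open>\<delta> / 2\<close>.\<close>
  define \<mu> where "\<mu> = \<delta> / (2 * sqrt \<epsilon>)"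
  have \<mu>: "\<mu> > 0" using \<delta> e by (simp add: \<mu>_def)
  have cont: "AE \<omega> in M. continuous_on {t..T} (\<lambda>s. I s \<omega>)" using I by (simp add: has_ito_integral_def)
  from maximal_inequality[OF I_mart \<mu> cont] obtain E where E: "E \<in> sets M"
    "prob E \<le> (\<integral>\<omega>. (norm (I T \<omega>))\<^sup>2 \<partial>M) / \<mu>\<^sup>2"
    "AE \<omega> in M. (\<exists>s\<in>{t..T}. norm (I s \<omega>) > \<mu>) \<longrightarrow> \<omega> \<in> E" by blast
  have i: "integrable N (case_prod (\<lambda>s \<omega>. norm (df s \<omega>)))"
    using integrable_norm[OF N.square_integrable_integrable[OF sqN_df]] by (simp add: split_beta')
  define d where "d \<omega> = (\<integral>s. norm (df s \<omega>) \<partial>L)" for \<omega>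
  have di: "integrable M d" using LM.integrable_snd[OF i] by (simp add: d_def[abs_def])
  have d0: "d \<omega> \<ge> 0" for \<omega> by (simp add: d_def)
  have dE: "(\<integral>\<omega>. d \<omega> \<partial>M) \<le> 2 * C1 * (Kenergy + vol) * sqrt \<epsilon>"
    using LM.integral_snd[OF i] integral_df by (simp add: d_def[abs_def] split_beta')
  let ?D = "{\<omega> \<in> space M. d \<omega> \<ge> \<delta> / 2}"
  have D: "?D \<in> sets M" using di by measurable
  have "measure M ?D \<le> (\<integral>\<omega>. d \<omega> \<partial>M) / (\<delta> / 2)"
    using integral_Markov_inequality_measure[OF di, of "space M" "\<delta> / 2"] d0 \<delta> by simp
  also have "\<dots> \<le> 2 * C1 * (Kenergy + vol) * sqrt \<epsilon> / (\<delta> / 2)" using dE \<delta> by (intro divide_right_mono) auto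
  finally have mD: "measure M ?D \<le> 4 * C1 * (Kenergy + vol) / \<delta> * sqrt \<epsilon>" by (simp add: algebra_simps)
  have "prob E \<le> Knoise / \<mu>\<^sup>2" using E(2) integral_I by (meson divide_right_mono order_trans zero_le_power2)
  also have "\<dots> = 4 * Knoise / \<delta>\<^sup>2 * \<epsilon>" using e \<delta> by (simp add: \<mu>_def power_divide power_mult_distrib)
  finally have mE: "prob E \<le> 4 * Knoise / \<delta>\<^sup>2 * \<epsilon>" .
  have ae: "AE \<omega> in M. \<omega> \<in> ?S \<longrightarrow> \<omega> \<in> ?D \<union> E"
    using E(3) eq_dX integrable_sections AE_space
  proof eventually_elim
    case (elim \<omega>)
    show ?case
    proof
      assume "\<omega> \<in> ?S"
      then obtain s where s: "s \<in> {t..T}" and "ennreal \<delta> < ennreal (norm (X s \<omega> - xx s))"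
        by (auto simp: less_SUP_iff)
      then have gt: "\<delta> < norm (dX s \<omega>)" using \<delta> by (simp add: dX_def ennreal_less_iff)
      have ai: "integrable L (\<lambda>r. df r \<omega>)" using elim by auto
      have "norm (LINT r:{t..s}|lborel. df r \<omega>) \<le> d \<omega>"
      proof -
        have "(LINT r:{t..s}|lborel. df r \<omega>) = (\<integral>r. of_bool (r < s) *\<^sub>R df r \<omega> \<partial>L)"
          using ai by (intro set_integral_past s) auto
        then show ?thesis
          unfolding d_def by (simp only:)
            (rule order_trans[OF integral_norm_bound integral_mono'[OF integrable_norm[OF ai]]]; auto)
      qed
      moreover have "norm (dX s \<omega>) \<le> norm (LINT r:{t..s}|lborel. df r \<omega>) + sqrt \<epsilon> * norm (I s \<omega>)"
        using bspec[OF elim(2) s] norm_triangle_ineq[of "LINT r:{t..s}|lborel. df r \<omega>" "sqrt \<epsilon> *\<^sub>R I s \<omega>"] e by simp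
      ultimately have "\<delta> < d \<omega> + sqrt \<epsilon> * norm (I s \<omega>)" using gt by linarith
      then have "d \<omega> \<ge> \<delta> / 2 \<or> sqrt \<epsilon> * norm (I s \<omega>) > \<delta> / 2" by linarith
      moreover have "norm (I s \<omega>) > \<mu>" if "sqrt \<epsilon> * norm (I s \<omega>) > \<delta> / 2"
        using that e by (simp add: \<mu>_def field_simps)
      ultimately show "\<omega> \<in> ?D \<union> E" using elim(1,4) s by auto
    qed
  qed
  have "measure M ?S \<le> measure M (?D \<union> E)"
  proof (cases "?S \<in> sets M")
    case True
    then show ?thesis using D E(1) by (intro finite_measure_mono_AE[OF ae]) auto
  qed (simp add: measure_notin_sets)
  also have "\<dots> \<le> measure M ?D + measure M E" using D E(1) by (intro measure_Un_le) auto
  finally show ?thesis using mD mE by linarith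
qed

lemma Y_continuous: "AE \<omega> in M. continuous_on {t..T} (\<lambda>s. Y s \<omega>)"
proof -
  have "AE \<omega> in M. continuous_on {t..T} (\<lambda>s. J s \<omega>)" using J by (simp add: has_ito_integral_def)
  then show ?thesis using eq_dY integrable_sections
  proof eventually_elim
    case (elim \<omega>)
    have "integrable L (\<lambda>r. - dg r \<omega>)" using elim(3) by auto
    note c = continuous_set_integral[OF this]
    have "continuous_on {t..T} (\<lambda>s. yy s + (dY t \<omega> + (LINT r:{t..s}|lborel. - dg r \<omega>) + J s \<omega>))"
      by (intro continuous_intros yy_cont c elim(1))
    then show ?case
    proof (rule continuous_on_eq)
      fix s assume "s \<in> {t..T}"
      from bspec[OF elim(2) this] show "yy s + (dY t \<omega> + (LINT r:{t..s}|lborel. - dg r \<omega>) + J s \<omega>) = Y s \<omega>"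
        by (simp add: dY_def[of s \<omega>] diff_eq_eq ac_simps)
    qed
  qed
qed

end

section \<open>The Meyer-Zheng topology\<close>

locale meyer_zheng =
  fixes T :: real
  assumes T_pos: "T > 0"
begin

abbreviation "K \<equiv> restrict_space lborel {0..T}"

sublocale K: finite_measure K
  by (rule finite_measureI) (use T_pos in \<open>simp add: emeasure_restrict_space space_restrict_space\<close>)

lemma space_K: "space K = {0..T}"
  by (simp add: space_restrict_space)

lemma mz_dist_eq: "mz_dist T u w = (\<integral>s. min (norm (u s - w s)) 1 \<partial>K)"
  unfolding mz_dist_def set_lebesgue_integral_def by (rule integral_restrict_space[symmetric]) simp

lemma mz_integrable:
  fixes u w :: "real \<Rightarrow> 'a::{banach, second_countable_topology}"
  assumes "u \<in> borel_measurable K" "w \<in> borel_measurable K"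
  shows "integrable K (\<lambda>s. min (norm (u s - w s)) 1)"
  by (rule K.integrable_const_bound[where B=1]) (use assms in auto)

lemma mz_nonneg: "0 \<le> mz_dist T u w"
  unfolding mz_dist_eq by (intro Bochner_Integration.integral_nonneg) auto

lemma mz_commute: "mz_dist T u w = mz_dist T w u"
  unfolding mz_dist_eq by (simp add: norm_minus_commute)

lemma mz_triangle:
  fixes u v w :: "real \<Rightarrow> 'a::{banach, second_countable_topology}"
  assumes "u \<in> borel_measurable K" "v \<in> borel_measurable K" "w \<in> borel_measurable K"
  shows "mz_dist T u w \<le> mz_dist T u v + mz_dist T v w"
proof -
  have "mz_dist T u w \<le> (\<integral>s. min (norm (u s - v s)) 1 + min (norm (v s - w s)) 1 \<partial>K)"
    unfolding mz_dist_eq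
  proof (intro integral_mono mz_integrable Bochner_Integration.integrable_add assms)
    fix s show "min (norm (u s - w s)) 1 \<le> min (norm (u s - v s)) 1 + min (norm (v s - w s)) 1"
    proof -
      have "min a 1 \<le> min b 1 + min c 1" if "a \<le> b + c" "0 \<le> b" "0 \<le> c" for a b c :: real
        using that by (auto simp: min_def)
      from this[of "norm (u s - w s)" "norm (u s - v s)" "norm (v s - w s)"] show ?thesis
        using norm_triangle_ineq[of "u s - v s" "v s - w s"] by simp
    qed
  qed
  also have "\<dots> = mz_dist T u v + mz_dist T v w"
    unfolding mz_dist_eq by (intro Bochner_Integration.integral_add mz_integrable assms)
  finally show ?thesis .
qed

text \<open>\<open>grid_point n (grid_index n s)\<close> is the first point strictly after \<open>s\<close> of
  the grid that divides \<open>[0, T]\<close> into \<open>n + 1\<close> cells, so a right-continuous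
  path is the limit of the step functions which it generates. At \<open>s = T\<close> the index is
  \<open>n + 2\<close>, and the minimum in \<open>grid_point\<close> brings the point back to
  \<open>T\<close>.\<close>

definition grid_index :: "nat \<Rightarrow> real \<Rightarrow> nat" where
  "grid_index n s = nat \<lfloor>real (Suc n) * s / T\<rfloor> + 1"

definition grid_point :: "nat \<Rightarrow> nat \<Rightarrow> real" where
  "grid_point n i = min T (T * real i / real (Suc n))"

lemma grid_index_measurable: "grid_index n \<in> measurable K (count_space UNIV)"
proof -
  have "(\<lambda>s. s) \<in> borel_measurable K" by (intro measurable_restrict_space1) simp
  then show ?thesis unfolding grid_index_def[abs_def] by measurable
qed

lemma step_measurable: "(\<lambda>s. v (grid_index n s)) \<in> borel_measurable K"
  using measurable_compose[OF grid_index_measurable, of v borel n] by simp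

lemma grid_index_le: "s \<in> {0..T} \<Longrightarrow> grid_index n s \<le> n + 2"
proof -
  assume s: "s \<in> {0..T}"
  then have "s / T \<le> 1" using T_pos by simp
  then have "real (Suc n) * (s / T) \<le> real (Suc n) * 1" by (rule mult_left_mono) simp
  then have "real (Suc n) * s / T \<le> real (Suc n)" by simp
  then have "\<lfloor>real (Suc n) * s / T\<rfloor> \<le> \<lfloor>real (Suc n)\<rfloor>" by (rule floor_mono)
  then show ?thesis by (simp add: grid_index_def)
qed

lemma grid_point_in: "grid_point n i \<in> {0..T}"
  using T_pos by (auto simp: grid_point_def)

lemma grid_point_bounds:
  assumes s: "s \<in> {0..<T}"
  shows "s < grid_point n (grid_index n s)" "grid_point n (grid_index n s) \<le> s + T / real (Suc n)"
proof -
  define m where "m = real (Suc n)"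
  have m: "m > 0" by (simp add: m_def)
  let ?q = "m * s / T"
  have q: "?q \<ge> 0" using s T_pos m by simp
  then have i: "real (grid_index n s) = real_of_int \<lfloor>?q\<rfloor> + 1" by (simp add: grid_index_def m_def)
  have "?q < real (grid_index n s)" "real (grid_index n s) \<le> ?q + 1" unfolding i by linarith+
  then have "T * ?q / m < T * real (grid_index n s) / m" "T * real (grid_index n s) / m \<le> T * (?q + 1) / m"
    using T_pos m by (intro divide_strict_right_mono divide_right_mono mult_strict_left_mono mult_left_mono; simp)+
  moreover have "T * ?q / m = s" "T * (?q + 1) / m = s + T / m"
    using T_pos m by (auto simp: field_simps)
  ultimately show "s < grid_point n (grid_index n s)" "grid_point n (grid_index n s) \<le> s + T / real (Suc n)"
    using s unfolding grid_point_def m_def[symmetric] by auto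
qed

lemma cadlag_grid_limit:
  assumes w: "w \<in> cadlag_paths T" and s: "s \<in> {0..T}"
  shows "(\<lambda>n. w (grid_point n (grid_index n s))) \<longlonglongrightarrow> w s"
proof (cases "s = T")
  case True
  have "grid_point n (grid_index n s) = T" for n
  proof -
    have "grid_index n s = n + 2" using True T_pos by (simp add: grid_index_def)
    then show ?thesis using T_pos by (simp add: grid_point_def min_def field_simps)
  qed
  then show ?thesis using True by simp
next
  case False
  with s have s': "s \<in> {0..<T}" by auto
  have lim: "(w \<longlongrightarrow> w s) (at_right s)" using w s' by (auto simp: cadlag_paths_def)
  have "(\<lambda>n. grid_point n (grid_index n s)) \<longlonglongrightarrow> s"
  proof (rule tendsto_sandwich[OF _ _ tendsto_const])
    show "(\<lambda>n. s + T / real (Suc n)) \<longlonglongrightarrow> s"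
      using tendsto_add[OF tendsto_const lim_const_over_n[THEN LIMSEQ_Suc]] by force
  qed (use grid_point_bounds[OF s'] in \<open>auto intro!: always_eventually less_imp_le\<close>)
  moreover have "grid_point n (grid_index n s) \<in> {s<..} \<and> grid_point n (grid_index n s) \<noteq> s" for n
    using grid_point_bounds(1)[OF s', of n] by simp
  ultimately have "filterlim (\<lambda>n. grid_point n (grid_index n s)) (at_right s) sequentially"
    unfolding filterlim_at by (simp add: always_eventually)
  from filterlim_compose[OF lim this] show ?thesis .
qed

lemma cadlag_measurable:
  fixes w :: "real \<Rightarrow> 'a::{banach, second_countable_topology}"
  assumes w: "w \<in> cadlag_paths T"
  shows "w \<in> borel_measurable K"
  by (rule borel_measurable_LIMSEQ_metric[where f="\<lambda>n s. w (grid_point n (grid_index n s))"])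
    (use cadlag_grid_limit[OF w] step_measurable[of "\<lambda>i. w (grid_point _ i)"] in \<open>auto simp: space_K\<close>)

lemma AE_eq_interval:
  assumes "AE s in K. R s" "{c<..<d} \<subseteq> {0..T}" "c < d"
  shows "\<exists>s\<in>{c<..<d}. R s"
proof (rule ccontr)
  assume no: "\<not> ?thesis"
  have "AE s in lborel. s \<in> {0..T} \<longrightarrow> R s" using assms(1) by (subst (asm) AE_restrict_space_iff) auto
  then have "AE s in lborel. s \<notin> {c<..<d}" by eventually_elim (use no assms(2) in auto)
  then have "{c<..<d} \<in> null_sets lborel" by (subst AE_iff_null_sets) auto
  then show False using assms(3) by (auto simp: null_sets_def)
qed

text \<open>Paths that agree almost everywhere agree on a dense set, hence everywhere on \<open>[0, T)\<close>
  by right continuity and at \<open>T\<close> because paths are continuous from the left there.\<close>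

lemma mz_zero_imp_eq:
  fixes w w' :: "real \<Rightarrow> 'a::{banach, second_countable_topology}"
  assumes w: "w \<in> cadlag_paths T" and w': "w' \<in> cadlag_paths T" and z: "mz_dist T w w' = 0"
  shows "w = w'"
proof
  note i = mz_integrable[OF cadlag_measurable[OF w] cadlag_measurable[OF w']]
  have "AE s in K. min (norm (w s - w' s)) 1 = 0"
    using z integral_nonneg_eq_0_iff_AE[OF i] by (auto simp: mz_dist_eq)
  then have ae: "AE s in K. w s = w' s" by eventually_elim (auto simp: min_def split: if_splits)
  have right: "w s = w' s" if s: "s \<in> {0..<T}" for s
  proof (rule ccontr)
    assume ne: "w s \<noteq> w' s"
    have "((\<lambda>r. w r - w' r) \<longlongrightarrow> w s - w' s) (at_right s)"
      using w w' s by (intro tendsto_diff) (auto simp: cadlag_paths_def)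
    then have "eventually (\<lambda>r. w r - w' r \<noteq> 0) (at_right s)"
      using ne by (intro tendsto_imp_eventually_ne) auto
    then obtain d where d: "d > s" "\<And>r. r > s \<Longrightarrow> r < d \<Longrightarrow> w r - w' r \<noteq> 0"
      by (auto simp: eventually_at_right_field)
    have "{s<..<min d T} \<subseteq> {0..T}" "s < min d T" using s d(1) by auto
    from AE_eq_interval[OF ae this] d(2) show False by auto
  qed
  have lT: "(w \<longlongrightarrow> w T) (at_left T)" "(w' \<longlongrightarrow> w' T) (at_left T)" using w w' by (auto simp: cadlag_paths_def)
  have "eventually (\<lambda>r. w r = w' r) (at_left T)"
    unfolding eventually_at_left_field using T_pos right by (intro exI[of _ 0]) auto
  with lT(1) have "(w' \<longlongrightarrow> w T) (at_left T)" by (rule Lim_transform_eventually)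
  with lT(2) have T: "w T = w' T" by (intro tendsto_unique[OF trivial_limit_at_left_real]) auto
  fix s
  consider "s \<in> {0..<T}" | "s = T" | "s \<notin> {0..T}" by fastforce
  then show "w s = w' s"
  proof cases
    case 3
    then show ?thesis using w w' by (auto simp: cadlag_paths_def extensional_def)
  qed (use right T in auto)
qed

lemma mz_metric: "Metric_space (cadlag_paths T) (mz_dist T :: (real \<Rightarrow> 'a::{banach, second_countable_topology}) \<Rightarrow> _)"
proof (rule Metric_space.intro)
  fix x y z :: "real \<Rightarrow> 'a"
  show "0 \<le> mz_dist T x y" "mz_dist T x y = mz_dist T y x" by (rule mz_nonneg mz_commute)+
  assume xy: "x \<in> cadlag_paths T" "y \<in> cadlag_paths T"
  have "mz_dist T x x = 0" by (simp add: mz_dist_eq)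
  then show "mz_dist T x y = 0 \<longleftrightarrow> x = y" using mz_zero_imp_eq[OF xy] by blast
  assume "z \<in> cadlag_paths T"
  with xy show "mz_dist T x z \<le> mz_dist T x y + mz_dist T y z" by (intro mz_triangle cadlag_measurable)
qed

lemma openin_mz:
  fixes U :: "(real \<Rightarrow> 'a::{banach, second_countable_topology}) set"
  shows "openin (mz_topology T) U \<longleftrightarrow> U \<subseteq> cadlag_paths T \<and>
     (\<forall>w\<in>U. \<exists>r>0. \<forall>v\<in>cadlag_paths T. mz_dist T w v < r \<longrightarrow> v \<in> U)"
proof -
  interpret Metric_space "cadlag_paths T" "mz_dist T :: (real \<Rightarrow> 'a) \<Rightarrow> _" by (rule mz_metric)
  have "(\<exists>r>0. mball w r \<subseteq> U) \<longleftrightarrow> (\<exists>r>0. \<forall>v\<in>cadlag_paths T. mz_dist T w v < r \<longrightarrow> v \<in> U)"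
    if "w \<in> cadlag_paths T" for w
  proof -
    have "mball w r \<subseteq> U \<longleftrightarrow> (\<forall>v\<in>cadlag_paths T. mz_dist T w v < r \<longrightarrow> v \<in> U)" for r
      using that by (auto simp: subset_iff)
    then show ?thesis by simp
  qed
  then show ?thesis unfolding mz_topology_def openin_mtopology by blast
qed

lemma topspace_mz: "topspace (mz_topology T :: (real \<Rightarrow> 'a::{banach, second_countable_topology}) topology) = cadlag_paths T"
proof -
  interpret Metric_space "cadlag_paths T" "mz_dist T :: (real \<Rightarrow> 'a) \<Rightarrow> _" by (rule mz_metric)
  show ?thesis unfolding mz_topology_def by simp
qed

lemma mz_open_subset: "{U. openin (mz_topology T) U} \<subseteq> Pow (cadlag_paths T :: (real \<Rightarrow> 'a::{banach, second_countable_topology}) set)"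
  using openin_subset topspace_mz by blast

lemma space_mz: "space (mz_borel T) = cadlag_paths T"
  by (simp add: mz_borel_def space_measure_of_conv)

text \<open>An open set is the set where the distance \<open>d\<close> to its complement is positive, and
  \<open>d \<circ> \<xi>\<close> is the limit of its values at the step functions generated by
  \<open>\<xi>\<close>, which are continuous functions of finitely many coordinates of
  \<open>\<xi>\<close>.\<close>

lemma mz_measurable:
  fixes \<xi> :: "'w \<Rightarrow> real \<Rightarrow> 'a::{banach, second_countable_topology}"
  assumes cad: "\<And>\<omega>. \<omega> \<in> space Q \<Longrightarrow> \<xi> \<omega> \<in> cadlag_paths T"
    and coord: "\<And>s. s \<in> {0..T} \<Longrightarrow> (\<lambda>\<omega>. \<xi> \<omega> s) \<in> borel_measurable Q"
  shows "\<xi> \<in> Q \<rightarrow>\<^sub>M mz_borel T"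
  unfolding mz_borel_def
proof (rule measurable_measure_of[OF mz_open_subset])
  show "\<xi> \<in> space Q \<rightarrow> cadlag_paths T" using cad by auto
  fix U :: "(real \<Rightarrow> 'a) set" assume "U \<in> {U. openin (mz_topology T) U}"
  then have U: "U \<subseteq> cadlag_paths T" "\<And>w. w \<in> U \<Longrightarrow> \<exists>r>0. \<forall>v\<in>cadlag_paths T. mz_dist T w v < r \<longrightarrow> v \<in> U"
    by (auto simp: openin_mz)
  define C where "C = cadlag_paths T - U"
  show "\<xi> -` U \<inter> space Q \<in> sets Q"
  proof (cases "C = {}")
    case True
    then have "\<xi> -` U \<inter> space Q = space Q" using cad by (auto simp: C_def)
    then show ?thesis by simp
  next
    case False
    \<comment> \<open>The distance to the complement, defined for all measurable functions since step functions need not lie in \<open>cadlag_paths T\<close>.\<close>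
    define d where "d u = (INF c\<in>C. mz_dist T u c)" for u :: "real \<Rightarrow> 'a"
    have bdd: "bdd_below ((\<lambda>c. mz_dist T u c) ` C)" for u :: "real \<Rightarrow> 'a"
      by (rule bdd_belowI[of _ 0]) (auto simp: mz_nonneg)
    have Cm: "c \<in> borel_measurable K" if "c \<in> C" for c
      using that cadlag_measurable by (auto simp: C_def)
    have lip: "d u \<le> d v + mz_dist T u v" if "u \<in> borel_measurable K" "v \<in> borel_measurable K" for u v
    proof -
      have "d u - mz_dist T u v \<le> d v"
        unfolding d_def[of v]
      proof (rule cINF_greatest[OF False])
        fix c assume c: "c \<in> C"
        have "d u \<le> mz_dist T u c" unfolding d_def using bdd c by (rule cINF_lower)
        also have "\<dots> \<le> mz_dist T u v + mz_dist T v c" using that Cm[OF c] by (intro mz_triangle) auto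
        finally show "d u - mz_dist T u v \<le> mz_dist T v c" by simp
      qed
      then show ?thesis by simp
    qed
    have lip': "\<bar>d u - d v\<bar> \<le> mz_dist T u v" if "u \<in> borel_measurable K" "v \<in> borel_measurable K" for u v
      using lip[OF that] lip[OF that(2,1)] mz_commute[of u v] by linarith
    have iff: "w \<in> U \<longleftrightarrow> d w > 0" if w: "w \<in> cadlag_paths T" for w
    proof
      assume "w \<in> U"
      then obtain r where r: "r > 0" "\<And>v. v \<in> cadlag_paths T \<Longrightarrow> mz_dist T w v < r \<Longrightarrow> v \<in> U" using U(2) by blast
      have "r \<le> d w" unfolding d_def
        by (rule cINF_greatest[OF False]) (use r(2) in \<open>force simp: C_def not_less[symmetric]\<close>)
      then show "d w > 0" using r(1) by simp
    next
      assume pos: "d w > 0"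
      show "w \<in> U"
      proof (rule ccontr)
        assume "w \<notin> U"
        then have "w \<in> C" using w by (simp add: C_def)
        then have "d w \<le> mz_dist T w w" unfolding d_def using bdd by (intro cINF_lower)
        then show False using pos by (simp add: mz_dist_eq)
      qed
    qed
    define G where "G n v = d (\<lambda>s. v (grid_index n s))" for n and v :: "nat \<Rightarrow> 'a"
    have Gcont: "continuous_on UNIV (G n)" for n
      unfolding continuous_on_def
    proof
      fix v0 :: "nat \<Rightarrow> 'a"
      have "((\<lambda>v. G n v - G n v0) \<longlongrightarrow> 0) (at v0)"
      proof (rule Lim_null_comparison)
        have "((\<lambda>v. T * (\<Sum>i\<le>n+2. norm (v i - v0 i))) \<longlongrightarrow> T * (\<Sum>i\<le>n+2. norm (v0 i - v0 i))) (at v0)"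
          by (intro tendsto_intros continuous_on_product_coordinates[unfolded continuous_on_def, rule_format]) auto
        then show "((\<lambda>v. T * (\<Sum>i\<le>n+2. norm (v i - v0 i))) \<longlongrightarrow> 0) (at v0)" by simp
        show "\<forall>\<^sub>F v in at v0. norm (G n v - G n v0) \<le> T * (\<Sum>i\<le>n+2. norm (v i - v0 i))"
        proof (intro always_eventually allI)
          fix v
          have "norm (G n v - G n v0) \<le> mz_dist T (\<lambda>s. v (grid_index n s)) (\<lambda>s. v0 (grid_index n s))"
            unfolding G_def real_norm_def by (intro lip' step_measurable)
          also have "\<dots> \<le> (\<integral>s. (\<Sum>i\<le>n+2. norm (v i - v0 i)) \<partial>K)"
            unfolding mz_dist_eq
          proof (intro integral_mono mz_integrable step_measurable)
            fix s assume "s \<in> space K"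
            then have "grid_index n s \<in> {..n+2}" using grid_index_le by (auto simp: space_K)
            then have "norm (v (grid_index n s) - v0 (grid_index n s)) \<le> (\<Sum>i\<le>n+2. norm (v i - v0 i))"
              by (intro member_le_sum[where f="\<lambda>i. norm (v i - v0 i)"]) auto
            then show "min (norm (v (grid_index n s) - v0 (grid_index n s))) 1 \<le> (\<Sum>i\<le>n+2. norm (v i - v0 i))" by simp
          qed simp
          also have "\<dots> = T * (\<Sum>i\<le>n+2. norm (v i - v0 i))"
            using T_pos by (simp add: space_K measure_restrict_space)
          finally show "norm (G n v - G n v0) \<le> T * (\<Sum>i\<le>n+2. norm (v i - v0 i))" .
        qed
      qed
      then show "(G n \<longlongrightarrow> G n v0) (at v0 within UNIV)" using Lim_null by blast
    qed
    have lim: "(\<lambda>n. G n (\<lambda>i. \<xi> \<omega> (grid_point n i))) \<longlonglongrightarrow> d (\<xi> \<omega>)" if "\<omega> \<in> space Q" for \<omega>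
    proof -
      note c = cad[OF that]
      let ?s = "\<lambda>n s. \<xi> \<omega> (grid_point n (grid_index n s))"
      have sm: "?s n \<in> borel_measurable K" for n using step_measurable[of "\<lambda>i. \<xi> \<omega> (grid_point n i)" n] by simp
      have "(\<lambda>n. mz_dist T (?s n) (\<xi> \<omega>)) \<longlonglongrightarrow> (\<integral>s. 0 \<partial>K)"
        unfolding mz_dist_eq
      proof (rule integral_dominated_convergence[where w="\<lambda>_. 1"])
        show "AE s in K. (\<lambda>n. min (norm (?s n s - \<xi> \<omega> s)) 1) \<longlonglongrightarrow> 0"
        proof (rule AE_I2)
          fix s assume "s \<in> space K"
          then have "(\<lambda>n. ?s n s) \<longlonglongrightarrow> \<xi> \<omega> s" using cadlag_grid_limit[OF c] by (simp add: space_K)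
          then have "(\<lambda>n. min (norm (?s n s - \<xi> \<omega> s)) 1) \<longlonglongrightarrow> min (norm (\<xi> \<omega> s - \<xi> \<omega> s)) 1"
            by (intro tendsto_intros)
          then show "(\<lambda>n. min (norm (?s n s - \<xi> \<omega> s)) 1) \<longlonglongrightarrow> 0" by simp
        qed
      qed (use mz_integrable[OF sm cadlag_measurable[OF c]] in auto)
      then have m: "(\<lambda>n. mz_dist T (?s n) (\<xi> \<omega>)) \<longlonglongrightarrow> 0" by simp
      have "(\<lambda>n. d (?s n) - d (\<xi> \<omega>)) \<longlonglongrightarrow> 0"
        by (rule Lim_null_comparison[OF always_eventually m])
          (use lip'[OF sm cadlag_measurable[OF c]] in simp)
      then show ?thesis unfolding G_def using Lim_null by blast
    qed
    have "(\<lambda>\<omega>. d (\<xi> \<omega>)) \<in> borel_measurable Q"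
    proof (rule borel_measurable_LIMSEQ_real[OF lim])
      fix n
      have "(\<lambda>\<omega>. (\<lambda>i. \<xi> \<omega> (grid_point n i))) \<in> borel_measurable Q"
        by (intro measurable_coordinatewise_then_product coord grid_point_in)
      from measurable_compose[OF this borel_measurable_continuous_onI[OF Gcont]]
      show "(\<lambda>\<omega>. G n (\<lambda>i. \<xi> \<omega> (grid_point n i))) \<in> borel_measurable Q" .
    qed simp
    then have "{\<omega> \<in> space Q. d (\<xi> \<omega>) > 0} \<in> sets Q" by measurable
    also have "{\<omega> \<in> space Q. d (\<xi> \<omega>) > 0} = \<xi> -` U \<inter> space Q" using iff cad by auto
    finally show ?thesis .
  qed
qed

text \<open>A continuous \<open>\<phi>\<close> with bound \<open>B\<close> that varies by less than
  \<open>e/2\<close> within distance \<open>\<rho>\<close> of \<open>w0\<close> satisfies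
  \<open>|\<phi> v - \<phi> w0| \<le> e/2 + (2 B / \<rho>) mz_dist T v w0\<close> for all paths
  \<open>v\<close>, so convergence in mean of the distance suffices. The distance is dominated by
  \<open>D\<close>, which is easier to integrate.\<close>

lemma weakly_converges_return:
  fixes \<xi> :: "nat \<Rightarrow> 'w \<Rightarrow> real \<Rightarrow> 'a::{banach, second_countable_topology}"
  assumes "prob_space Q"
    and \<xi>: "\<And>k. \<xi> k \<in> Q \<rightarrow>\<^sub>M mz_borel T" and w0: "w0 \<in> cadlag_paths T"
    and D: "\<And>k. integrable Q (D k)" "\<And>k. AE \<omega> in Q. mz_dist T (\<xi> k \<omega>) w0 \<le> D k \<omega>"
    and lim: "(\<lambda>k. \<integral>\<omega>. D k \<omega> \<partial>Q) \<longlonglongrightarrow> 0"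
  shows "weakly_converges (mz_topology T) (\<lambda>k. distr Q (mz_borel T) (\<xi> k)) (return (mz_borel T) w0)"
  unfolding weakly_converges_def
proof (intro allI impI)
  interpret Q: prob_space Q by fact
  fix \<phi> :: "(real \<Rightarrow> 'a) \<Rightarrow> real"
  assume "continuous_map (mz_topology T) euclideanreal \<phi> \<and> bounded (\<phi> ` topspace (mz_topology T))"
  then have cont: "continuous_map (mz_topology T) euclideanreal \<phi>" and "bounded (\<phi> ` cadlag_paths T)"
    by (auto simp: topspace_mz)
  then obtain B where B: "\<And>w. w \<in> cadlag_paths T \<Longrightarrow> \<bar>\<phi> w\<bar> \<le> B" unfolding bounded_iff real_norm_def by blast
  have B0: "B \<ge> 0" using B[OF w0] by linarith
  have op: "openin (mz_topology T) {w \<in> cadlag_paths T. \<phi> w \<in> S}" if "open S" for S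
    using openin_continuous_map_preimage[OF cont, of S] that by (simp add: topspace_mz)
  have \<phi>m: "\<phi> \<in> borel_measurable (mz_borel T)"
  proof (rule borel_measurableI)
    fix S :: "real set" assume "open S"
    from op[OF this] have "{w \<in> cadlag_paths T. \<phi> w \<in> S} \<in> sets (mz_borel T)"
      unfolding mz_borel_def using mz_open_subset by (subst sets_measure_of) auto
    also have "{w \<in> cadlag_paths T. \<phi> w \<in> S} = \<phi> -` S \<inter> space (mz_borel T)" by (auto simp: space_mz)
    finally show "\<phi> -` S \<inter> space (mz_borel T) \<in> sets (mz_borel T)" .
  qed
  have cad: "\<xi> k \<omega> \<in> cadlag_paths T" if "\<omega> \<in> space Q" for k \<omega>
    using measurable_space[OF \<xi> that, of k] by (simp add: space_mz)
  have \<phi>i: "integrable Q (\<lambda>\<omega>. \<phi> (\<xi> k \<omega>))" for k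
    by (rule Q.integrable_const_bound[where B=B]) (use B cad measurable_compose[OF \<xi> \<phi>m] in auto)
  have r: "(\<integral>w. \<phi> w \<partial>return (mz_borel T) w0) = \<phi> w0" using w0 \<phi>m by (intro integral_return) (auto simp: space_mz)
  have l: "(\<integral>w. \<phi> w \<partial>distr Q (mz_borel T) (\<xi> k)) = (\<integral>\<omega>. \<phi> (\<xi> k \<omega>) \<partial>Q)" for k
    by (rule integral_distr[OF \<xi> \<phi>m])
  show "(\<lambda>k. \<integral>w. \<phi> w \<partial>distr Q (mz_borel T) (\<xi> k)) \<longlonglongrightarrow> (\<integral>w. \<phi> w \<partial>return (mz_borel T) w0)"
    unfolding r l
  proof (rule tendstoI)
    fix e :: real assume e: "e > 0"
    have "openin (mz_topology T) {w \<in> cadlag_paths T. \<phi> w \<in> ball (\<phi> w0) (e/2)}" by (intro op) simp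
    moreover have "w0 \<in> {w \<in> cadlag_paths T. \<phi> w \<in> ball (\<phi> w0) (e/2)}" using w0 e by simp
    ultimately obtain \<rho> where \<rho>: "\<rho> > 0"
      "\<And>v. v \<in> cadlag_paths T \<Longrightarrow> mz_dist T w0 v < \<rho> \<Longrightarrow> \<bar>\<phi> w0 - \<phi> v\<bar> < e/2"
      unfolding openin_mz by (auto simp: dist_real_def)
    have est: "\<bar>\<phi> v - \<phi> w0\<bar> \<le> e/2 + (2 * B / \<rho>) * mz_dist T v w0" if v: "v \<in> cadlag_paths T" for v
    proof (cases "mz_dist T w0 v < \<rho>")
      case True
      have "0 \<le> (2 * B / \<rho>) * mz_dist T v w0" using B0 \<rho>(1) mz_nonneg by (intro mult_nonneg_nonneg) auto
      then show ?thesis using \<rho>(2)[OF v True] by linarith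
    next
      case False
      then have "1 \<le> mz_dist T v w0 / \<rho>" using \<rho>(1) by (simp add: mz_commute)
      then have "2 * B * 1 \<le> 2 * B * (mz_dist T v w0 / \<rho>)" using B0 by (intro mult_left_mono) auto
      moreover have "\<bar>\<phi> v - \<phi> w0\<bar> \<le> 2 * B" using B[OF v] B[OF w0] by linarith
      ultimately show ?thesis using e by simp
    qed
    have bound: "\<bar>(\<integral>\<omega>. \<phi> (\<xi> k \<omega>) \<partial>Q) - \<phi> w0\<bar> \<le> e/2 + (2 * B / \<rho>) * (\<integral>\<omega>. D k \<omega> \<partial>Q)" for k
    proof -
      have "\<bar>(\<integral>\<omega>. \<phi> (\<xi> k \<omega>) \<partial>Q) - \<phi> w0\<bar> = \<bar>\<integral>\<omega>. \<phi> (\<xi> k \<omega>) - \<phi> w0 \<partial>Q\<bar>"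
        using \<phi>i by (simp add: Q.prob_space)
      also have "\<dots> \<le> (\<integral>\<omega>. \<bar>\<phi> (\<xi> k \<omega>) - \<phi> w0\<bar> \<partial>Q)" by (rule integral_abs_bound)
      also have "\<dots> \<le> (\<integral>\<omega>. e/2 + (2 * B / \<rho>) * D k \<omega> \<partial>Q)"
      proof (rule integral_mono_AE)
        show "AE \<omega> in Q. \<bar>\<phi> (\<xi> k \<omega>) - \<phi> w0\<bar> \<le> e/2 + (2 * B / \<rho>) * D k \<omega>"
          using D(2)[of k] AE_space
        proof eventually_elim
          case (elim \<omega>)
          have "(2 * B / \<rho>) * mz_dist T (\<xi> k \<omega>) w0 \<le> (2 * B / \<rho>) * D k \<omega>"
            using elim(1) B0 \<rho>(1) by (intro mult_left_mono) auto
          then show ?case using est[OF cad[OF elim(2)], of k] by linarith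
        qed
      qed (use D(1) \<phi>i in auto)
      also have "\<dots> = e/2 + (2 * B / \<rho>) * (\<integral>\<omega>. D k \<omega> \<partial>Q)" using D(1) by (simp add: Q.prob_space)
      finally show ?thesis .
    qed
    have "(\<lambda>k. (2 * B / \<rho>) * (\<integral>\<omega>. D k \<omega> \<partial>Q)) \<longlonglongrightarrow> (2 * B / \<rho>) * 0" by (intro tendsto_intros lim)
    then have "eventually (\<lambda>k. (2 * B / \<rho>) * (\<integral>\<omega>. D k \<omega> \<partial>Q) < e/2) sequentially"
      using e by (intro order_tendstoD(2)) auto
    then show "eventually (\<lambda>k. dist (\<integral>\<omega>. \<phi> (\<xi> k \<omega>) \<partial>Q) (\<phi> w0) < e) sequentially"
    proof eventually_elim
      case (elim k)
      then show ?case using bound[of k] by (simp add: dist_real_def)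
    qed
  qed
qed

lemma continuous_imp_cadlag:
  fixes y :: "real \<Rightarrow> 'a::real_normed_vector"
  assumes t: "0 \<le> t" "t \<le> T" and y: "continuous_on {t..T} y"
  shows "(\<lambda>s\<in>{0..T}. y (max t s)) \<in> cadlag_paths T"
proof -
  let ?w = "\<lambda>s\<in>{0..T}. y (max t s)"
  have "continuous_on {0..T} (\<lambda>s. y (max t s))"
    by (rule continuous_on_compose2[OF y]) (use t in \<open>auto intro!: continuous_intros\<close>)
  then have c: "continuous_on {0..T} ?w" by (rule continuous_on_eq) simp
  have right: "(?w \<longlongrightarrow> ?w s) (at_right s)" if "s \<in> {0..<T}" for s
    by (rule continuous_on_Icc_at_rightD[OF continuous_on_subset[OF c, of "{s..T}"]]) (use that in auto)
  have left: "(?w \<longlongrightarrow> ?w s) (at_left s)" if "s \<in> {0<..T}" for s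
    by (rule continuous_on_Icc_at_leftD[OF continuous_on_subset[OF c, of "{0..s}"]]) (use that in auto)
  show ?thesis
    unfolding cadlag_paths_def
  proof (intro CollectI conjI ballI)
    show "(?w \<longlongrightarrow> ?w T) (at_left T)" using left[of T] T_pos by simp
    show "\<exists>l. (?w \<longlongrightarrow> l) (at_left s)" if "s \<in> {0<..T}" for s using left[OF that] by blast
    show "(?w \<longlongrightarrow> ?w s) (at_right s)" if "s \<in> {0..<T}" for s using right[OF that] .
  qed simp
qed

end

section \<open>Convergence\<close>

context fbsde_sol
begin

interpretation MZ: meyer_zheng T by standard (rule T_pos)

lemma path_map_cadlag: "path_map T t Y \<omega> \<in> cadlag_paths T"
proof -
  have "(\<lambda>s\<in>{0..T}. (\<lambda>_. 0 :: real^'n) (max t s)) \<in> cadlag_paths T"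
    by (rule MZ.continuous_imp_cadlag[OF t]) simp
  then show ?thesis by (simp add: path_map_def Let_def)
qed

lemma path_map_AE: "AE \<omega> in M. path_map T t Y \<omega> = (\<lambda>s\<in>{0..T}. Y (max t s) \<omega>)"
  using Y_continuous
proof eventually_elim
  case (elim \<omega>)
  from MZ.continuous_imp_cadlag[OF t elim] show ?case by (simp add: path_map_def Let_def)
qed

text \<open>Each coordinate agrees almost surely with a value of \<open>Y\<close>, and the space is complete.\<close>

lemma path_map_measurable: "path_map T t Y \<in> M \<rightarrow>\<^sub>M mz_borel T"
proof (rule MZ.mz_measurable)
  show "path_map T t Y \<omega> \<in> cadlag_paths T" for \<omega> by (rule path_map_cadlag)
  fix s assume s: "s \<in> {0..T}"
  then have "max t s \<in> {t..T}" using t by auto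
  from square_integrable_measurable[OF S2_square_integrable(2)[OF Y this]]
  have Ym: "Y (max t s) \<in> borel_measurable M" .
  show "(\<lambda>\<omega>. path_map T t Y \<omega> s) \<in> borel_measurable M"
  proof (rule measurableI)
    fix A :: "(real^'n) set" assume A: "A \<in> sets borel"
    show "(\<lambda>\<omega>. path_map T t Y \<omega> s) -` A \<inter> space M \<in> sets M"
    proof (rule in_sets_AE)
      show "Y (max t s) -` A \<inter> space M \<in> sets M" using Ym A by (rule measurable_sets)
      show "AE \<omega> in M. \<omega> \<in> Y (max t s) -` A \<inter> space M \<longleftrightarrow> \<omega> \<in> (\<lambda>\<omega>. path_map T t Y \<omega> s) -` A \<inter> space M"
        using path_map_AE by eventually_elim (use s in auto)
    qed auto
  qed simp
qed

text \<open>The first summand comes from \<open>[0, t]\<close>, where the path is frozen at its value at time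
  \<open>t\<close>.\<close>

definition "path_error \<omega> = t * norm (dY t \<omega>) + (\<integral>s. norm (dY s \<omega>) \<partial>L)"

lemma path_error:
  "integrable M path_error"
  "(\<integral>\<omega>. path_error \<omega> \<partial>M) \<le> (T * (Kback * Kenergy + 1) + (Kenergy + vol)) * sqrt \<epsilon>"
  "AE \<omega> in M. mz_dist T (path_map T t Y \<omega>) (\<lambda>s\<in>{0..T}. yy (max t s)) \<le> path_error \<omega>"
proof -
  have i1: "integrable M (\<lambda>\<omega>. norm (dY t \<omega>))"
    by (intro integrable_norm square_integrable_integrable sq_dY t_in)
  have i: "integrable N (case_prod (\<lambda>s \<omega>. norm (dY s \<omega>)))"
    using integrable_norm[OF N.square_integrable_integrable[OF sqN_dY]] by (simp add: split_beta')
  have i2: "integrable M (\<lambda>\<omega>. \<integral>s. norm (dY s \<omega>) \<partial>L)" using LM.integrable_snd[OF i] .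
  show "integrable M path_error" unfolding path_error_def[abs_def] using i1 i2 by simp
  have "(\<integral>\<omega>. path_error \<omega> \<partial>M) = t * (\<integral>\<omega>. norm (dY t \<omega>) \<partial>M) + (\<integral>z. norm (dY (fst z) (snd z)) \<partial>N)"
    unfolding path_error_def using i1 i2 LM.integral_snd[OF i] by (simp add: split_beta')
  also have "\<dots> \<le> T * ((Kback * Kenergy + 1) * sqrt \<epsilon>) + (Kenergy + vol) * sqrt \<epsilon>"
    using integral_dX_dY(2,3) t T_pos by (intro add_mono mult_mono) auto
  finally show "(\<integral>\<omega>. path_error \<omega> \<partial>M) \<le> (T * (Kback * Kenergy + 1) + (Kenergy + vol)) * sqrt \<epsilon>"
    by (simp add: algebra_simps)
  show "AE \<omega> in M. mz_dist T (path_map T t Y \<omega>) (\<lambda>s\<in>{0..T}. yy (max t s)) \<le> path_error \<omega>"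
    using path_map_AE sqN_sections(1)[OF sqN_dY]
  proof eventually_elim
    case (elim \<omega>)
    have iL: "integrable L (\<lambda>s. norm (dY s \<omega>))"
      by (intro integrable_norm L.square_integrable_integrable elim)
    then have i2: "integrable lborel (\<lambda>s. indicator {t..T} s * norm (dY s \<omega>))"
      by (simp add: integrable_restrict_space)
    have i1: "integrable lborel (\<lambda>s. indicator {0..t} s * norm (dY t \<omega>))"
      by (intro integrable_mult_left integrable_real_indicator) (use t in auto)
    have "mz_dist T (path_map T t Y \<omega>) (\<lambda>s\<in>{0..T}. yy (max t s))
       \<le> (\<integral>s. indicator {0..t} s * norm (dY t \<omega>) + indicator {t..T} s * norm (dY s \<omega>) \<partial>lborel)"
      unfolding mz_dist_def set_lebesgue_integral_def elim(1)
    proof (rule integral_mono')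
      show "integrable lborel (\<lambda>s. indicator {0..t} s * norm (dY t \<omega>) + indicator {t..T} s * norm (dY s \<omega>))"
        using i1 i2 by simp
      fix s
      show "indicat_real {0..T} s *\<^sub>R min (norm ((\<lambda>s\<in>{0..T}. Y (max t s) \<omega>) s - (\<lambda>s\<in>{0..T}. yy (max t s)) s)) 1
         \<le> indicat_real {0..t} s * norm (dY t \<omega>) + indicat_real {t..T} s * norm (dY s \<omega>)"
        using t by (auto simp: indicator_def dY_def max_def intro: order_trans[OF min.cobounded1])
    qed auto
    also have "\<dots> = t * norm (dY t \<omega>) + (\<integral>s. norm (dY s \<omega>) \<partial>L)"
      using i1 i2 t by (simp add: integral_restrict_space)
    finally show ?case by (simp add: path_error_def)
  qed
qed

end

theorem theorem3p1:
  fixes T t :: real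
    and M :: "(real \<Rightarrow> real ^ 'd) measure"
    and f :: "real \<Rightarrow> real ^ 'n \<Rightarrow> real ^ 'n \<Rightarrow> real ^ 'n"
    and \<sigma> :: "real \<Rightarrow> real ^ 'n \<Rightarrow> real ^ 'n \<Rightarrow> real ^ 'd ^ 'n"
    and g :: "real \<Rightarrow> real ^ 'n \<Rightarrow> real ^ 'n \<Rightarrow> real ^ 'd ^ 'n \<Rightarrow> real ^ 'n"
    and h :: "real ^ 'n \<Rightarrow> real ^ 'n"
    and x :: "real ^ 'n"
    and X Y :: "real \<Rightarrow> real \<Rightarrow> (real \<Rightarrow> real ^ 'd) \<Rightarrow> real ^ 'n"
    and Z :: "real \<Rightarrow> real \<Rightarrow> (real \<Rightarrow> real ^ 'd) \<Rightarrow> real ^ 'd ^ 'n"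
    and \<X> \<Y> :: "real \<Rightarrow> real ^ 'n"
  assumes "T > 0"
    and "classical_wiener_space T M"
    and "assumption_A1 T f \<sigma> g h"
    and "assumption_A2 T f \<sigma> g h"
    and "t \<in> {0..T}"
    and "\<And>\<epsilon>. \<epsilon> \<in> {0<..1} \<Longrightarrow> fbsde_solution M T f \<sigma> g h \<epsilon> t x (X \<epsilon>) (Y \<epsilon>) (Z \<epsilon>)"
    and "limit_solution T f g h t x \<X> \<Y>"
  shows "(\<forall>\<delta>>0.
            ((\<lambda>\<epsilon>. measure M {\<omega> \<in> space M.
                 (SUP s\<in>{t..T}. ennreal (norm (X \<epsilon> s \<omega> - \<X> s))) > ennreal \<delta>})
             \<longlongrightarrow> 0) (at_right 0)) \<and>
         (\<exists>(\<epsilon>s :: nat \<Rightarrow> real) Q.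
            (\<forall>k. \<epsilon>s k \<in> {0<..1}) \<and> \<epsilon>s \<longlonglongrightarrow> 0 \<and>
            prob_space Q \<and> sets Q = sets (mz_borel T) \<and>
            weakly_converges (mz_topology T) (\<lambda>k. path_law M T t (Y (\<epsilon>s k))) Q)"
proof -
  note A1 = assms(3)[unfolded assumption_A1_def]
  note cont = conjunct1[OF A1, rule_format] conjunct1[OF conjunct2[OF A1], rule_format]
    conjunct1[OF conjunct2[OF conjunct2[OF A1]], rule_format]
  from assms(2) obtain P where P: "wiener_measure T P" "M = completion P"
    unfolding classical_wiener_space_def by blast
  obtain C1 where C1: "C1 > 0"
    "\<And>r x1 y1 z1 x2 y2 z2. r \<in> {0..T} \<Longrightarrow>
       norm (g r x1 y1 z1 - g r x2 y2 z2) \<le> C1 * (norm (x1 - x2) + norm (y1 - y2) + norm (z1 - z2))"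
    "\<And>r x1 y1 x2 y2. r \<in> {0..T} \<Longrightarrow> norm (f r x1 y1 - f r x2 y2) \<le> C1 * (norm (x1 - x2) + norm (y1 - y2))"
    "\<And>r x1 y1 x2 y2. r \<in> {0..T} \<Longrightarrow> norm (\<sigma> r x1 y1 - \<sigma> r x2 y2) \<le> C1 * (norm (x1 - x2) + norm (y1 - y2))"
    "\<And>x1 x2. norm (h x1 - h x2) \<le> C1 * norm (x1 - x2)"
    by (rule assumption_A1_everywhere[OF assms(1,3)]) (rule that; blast)
  obtain C2 where C2: "C2 > 0"
    "\<And>\<epsilon> r x1 y1 z1 x2 y2 z2. \<epsilon> \<in> {0<..1} \<Longrightarrow> r \<in> {0..T} \<Longrightarrow>
       (f r x1 y1 - f r x2 y2) \<bullet> (y1 - y2) - (g r x1 y1 z1 - g r x2 y2 z2) \<bullet> (x1 - x2)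
         + sqrt \<epsilon> * ((\<sigma> r x1 y1 - \<sigma> r x2 y2) \<bullet> (z1 - z2))
       \<le> - C2 * ((norm (x1 - x2))\<^sup>2 + (norm (y1 - y2))\<^sup>2)"
    "\<And>x1 x2. (h x1 - h x2) \<bullet> (x1 - x2) \<ge> C2 * (norm (x1 - x2))\<^sup>2"
    by (rule assumption_A2_everywhere[OF assms(1,3,4)]) (rule that; blast)
  interpret fbsde T P M t f \<sigma> g h x \<X> \<Y> C1 C2
  proof unfold_locales
    show "continuous_on {0..T} (\<lambda>r. f r x y)" "continuous_on {0..T} (\<lambda>r. \<sigma> r x y)"
      "continuous_on {0..T} (\<lambda>r. g r x y z)" for x y z
      by (rule cont)+
  qed (use assms(1,5,7) P C1 C2 in \<open>assumption | simp\<close>)+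
  interpret MZ: meyer_zheng T by standard (rule assms(1))
  have sol: "\<exists>I J. fbsde_sol T P M t f \<sigma> g h x \<X> \<Y> C1 C2 \<epsilon> (X \<epsilon>) (Y \<epsilon>) (Z \<epsilon>) I J" if e: "\<epsilon> \<in> {0<..1}" for \<epsilon>
  proof -
    note s = assms(6)[OF e, unfolded fbsde_solution_def Let_def]
    then obtain I J where "has_ito_integral M F W t T (\<lambda>r \<omega>. \<sigma> r (X \<epsilon> r \<omega>) (Y \<epsilon> r \<omega>)) I"
      "has_ito_integral M F W t T (Z \<epsilon>) J"
      "AE \<omega> in M. \<forall>s\<in>{t..T}.
            X \<epsilon> s \<omega> = x + (LINT r:{t..s}|lborel. f r (X \<epsilon> r \<omega>) (Y \<epsilon> r \<omega>)) + sqrt \<epsilon> *\<^sub>R I s \<omega> \<and>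
            Y \<epsilon> s \<omega> = h (X \<epsilon> T \<omega>) + (LINT r:{s..T}|lborel. g r (X \<epsilon> r \<omega>) (Y \<epsilon> r \<omega>) (Z \<epsilon> r \<omega>)) - (J T \<omega> - J s \<omega>)"
      by blast
    with s e have "fbsde_sol T P M t f \<sigma> g h x \<X> \<Y> C1 C2 \<epsilon> (X \<epsilon>) (Y \<epsilon>) (Z \<epsilon>) I J"
      by unfold_locales blast+
    then show ?thesis by blast
  qed
  show ?thesis
  proof (intro conjI allI impI)
    fix \<delta> :: real assume \<delta>: "\<delta> > 0"
    let ?p = "\<lambda>\<epsilon>. measure M {\<omega> \<in> space M. (SUP s\<in>{t..T}. ennreal (norm (X \<epsilon> s \<omega> - \<X> s))) > ennreal \<delta>}"
    let ?b = "\<lambda>\<epsilon>. 4 * C1 * (Kenergy + vol) / \<delta> * sqrt \<epsilon> + 4 * Knoise / \<delta>\<^sup>2 * \<epsilon>"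
    have "?p \<epsilon> \<le> ?b \<epsilon>" if e: "\<epsilon> \<in> {0<..1}" for \<epsilon>
    proof -
      from sol[OF e] obtain I J where "fbsde_sol T P M t f \<sigma> g h x \<X> \<Y> C1 C2 \<epsilon> (X \<epsilon>) (Y \<epsilon>) (Z \<epsilon>) I J" by blast
      then show ?thesis using \<delta> by (rule fbsde_sol.deviation_probability)
    qed
    then have "eventually (\<lambda>\<epsilon>. ?p \<epsilon> \<le> ?b \<epsilon>) (at_right 0)"
      unfolding eventually_at_right_field by (intro exI[of _ 1]) auto
    moreover have "(?b \<longlongrightarrow> 4 * C1 * (Kenergy + vol) / \<delta> * sqrt 0 + 4 * Knoise / \<delta>\<^sup>2 * 0) (at_right 0)"
      by (intro tendsto_intros)
    then have "(?b \<longlongrightarrow> 0) (at_right 0)" by simp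
    ultimately show "(?p \<longlongrightarrow> 0) (at_right 0)"
      by (rule tendsto_sandwich[OF always_eventually _ tendsto_const, rotated]) simp
  next
    define \<epsilon>s where "\<epsilon>s k = 1 / real (Suc k)" for k
    have es: "\<epsilon>s k \<in> {0<..1}" for k by (auto simp: \<epsilon>s_def)
    have e0: "\<epsilon>s \<longlonglongrightarrow> 0" unfolding \<epsilon>s_def[abs_def] by (rule LIMSEQ_Suc[OF lim_1_over_n])
    obtain I J where S: "\<And>k. fbsde_sol T P M t f \<sigma> g h x \<X> \<Y> C1 C2 (\<epsilon>s k) (X (\<epsilon>s k)) (Y (\<epsilon>s k)) (Z (\<epsilon>s k)) (I k) (J k)"
      using sol[OF es] by metis
    let ?w = "\<lambda>s\<in>{0..T}. \<Y> (max t s)"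
    have w: "?w \<in> cadlag_paths T" by (rule MZ.continuous_imp_cadlag[OF t yy_cont])
    let ?D = "\<lambda>k. fbsde_sol.path_error T t \<Y> (Y (\<epsilon>s k))"
    have "(\<lambda>k. \<integral>\<omega>. ?D k \<omega> \<partial>M) \<longlonglongrightarrow> 0"
    proof (rule tendsto_sandwich[OF _ _ tendsto_const])
      let ?c = "T * (Kback * Kenergy + 1) + (Kenergy + vol)"
      have "(\<lambda>k. ?c * sqrt (\<epsilon>s k)) \<longlonglongrightarrow> ?c * sqrt 0" by (intro tendsto_intros e0)
      then show "(\<lambda>k. ?c * sqrt (\<epsilon>s k)) \<longlonglongrightarrow> 0" by simp
      show "\<forall>\<^sub>F k in sequentially. (\<integral>\<omega>. ?D k \<omega> \<partial>M) \<le> ?c * sqrt (\<epsilon>s k)"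
        by (intro always_eventually allI fbsde_sol.path_error(2)[OF S])
      have "0 \<le> ?D k \<omega>" for k \<omega>
        using t by (simp add: fbsde_sol.path_error_def[OF S])
      then show "\<forall>\<^sub>F k in sequentially. 0 \<le> (\<integral>\<omega>. ?D k \<omega> \<partial>M)"
        by (intro always_eventually allI Bochner_Integration.integral_nonneg)
    qed
    then have "weakly_converges (mz_topology T) (\<lambda>k. path_law M T t (Y (\<epsilon>s k))) (return (mz_borel T) ?w)"
      unfolding path_law_def
      by (rule MZ.weakly_converges_return[OF prob_space_axioms fbsde_sol.path_map_measurable[OF S] w
            fbsde_sol.path_error(1)[OF S] fbsde_sol.path_error(3)[OF S]])
    moreover have "prob_space (return (mz_borel T) ?w)"
      using w by (intro prob_space_return) (simp add: MZ.space_mz)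
    ultimately show "\<exists>(\<epsilon>s :: nat \<Rightarrow> real) Q. (\<forall>k. \<epsilon>s k \<in> {0<..1}) \<and> \<epsilon>s \<longlonglongrightarrow> 0 \<and>
            prob_space Q \<and> sets Q = sets (mz_borel T) \<and>
            weakly_converges (mz_topology T) (\<lambda>k. path_law M T t (Y (\<epsilon>s k))) Q"
      using es e0 by (intro exI[of _ \<epsilon>s] exI[of _ "return (mz_borel T) ?w"]) auto
  qed
qed

end
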